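(* Let $\mathfrak{D}=\sum_{i=0}^m\Delta_i\otimes V(\ell_i)$ where each $\ell_i$ is a linear form in $\mathbb{C}[x_0,\dots,x_c]$, the $\Delta_i$ are $\sigma$-polyhedra, and $\sum_i\Delta_i\subsetneq\sigma$. Assume moreover that the hyperplane arrangement $\{V(\ell_i)\}$ is of full rank and in general linear position. Let $w\in\mathrm{relint}(\tau)$ where $\tau$ is a maximal cone in the tropicalized linear space $\mathrm{Trop}(L)$, where $L$ is the image of $\mathbb{P}^c$ in $\mathbb{P}^m$ under $P\mapsto[\ell_0(P):\dots:\ell_m(P)]$. Let $\mathfrak{v}_w$ be a full rank valuation on $R(\mathfrak{D})$ associated with the maximal cone of $\mathrm{Trop}(J_{\mathfrak{D}})$ lifting $\tau$ (see context). Then the value semigroup $S(R(\mathfrak{D}),\mathfrak{v}_w)$ is isomorphic to the semigroup $$S_w=\Big\{(v,u)\in\mathbb{Z}^c\times(\sigma^\vee\cap M)\ :\ \sum_{i=1}^cv_i\le\sum_{j\in\mathcal{I}}\lfloor\Delta_j(u)\rfloor\ \text{ and }\ v_j\ge-\lfloor\Delta_{i_j}(u)\rfloor\ \text{ for all }1\le j\le c\Big\},$$ where $\mathcal{I}$ is the set of indices in $\{0,\dots,m\}$ at which $w$ is minimized and $\{i_1,\dots,i_c\}=\{0,\dots,m\}\setminus\mathcal{I}$.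
   Context: $N$ is a lattice of finite rank, $M=\mathrm{Hom}(N,\mathbb{Z})$, $\sigma\subset N_{\mathbb{Q}}$ a pointed rational polyhedral cone with dual $\sigma^\vee$. A $\sigma$-polyhedron is $\Delta=\Pi+\sigma$ with $\Pi\subset N_{\mathbb{Q}}$ a rational polytope (the empty set also allowed); $\Delta(u)=\min_{v\in\Delta}\langle u,v\rangle$ for $u\in\sigma^\vee$, and $\infty$ if $\Delta=\emptyset$. Full rank and general linear position: any $c+1$ of the $\ell_i$ are linearly independent, and the $\ell_i$ span the linear forms. $R(\mathfrak{D})=\bigoplus_{u\in\sigma^\vee\cap M}H^0(\mathbb{P}^c,\mathcal{O}(\sum_i\lfloor\Delta_i(u)\rfloor V(\ell_i)))\chi^u$. With $t_i=x_i/x_0$ on the torus of $\mathbb{P}^m$, $e_1,\dots,e_m$ the standard basis of $\mathbb{R}^m$, $e_0=-\sum_{i\ge1}e_i$, let $\delta\subseteq\mathbb{R}^m\times N_{\mathbb{R}}$ be the positive hull of $(\{0\}\times\sigma)\cup\bigcup_{i=0}^m\{e_i\}\times\Delta_i$, and $\mathcal{H}$ a Hilbert basis of $\delta^\vee\cap(\mathbb{Z}^m\times M)$. $J_{\mathfrak{D}}$ is the kernel of the surjection $\phi:\mathbb{C}[x_{(h,h')}:(h,h')\in\mathcal{H}]\to R(\mathfrak{D})$ (semi-canonical presentation) sending $x_{(h,h')}$ to the restriction of $t^h\chi^{h'}$ to $L\cong\mathbb{P}^c$, i.e. to $\prod_{i=1}^m(\ell_i/\ell_0)^{h_i}\chi^{h'}$.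 Tropical conventions are min: $\mathrm{Trop}(I)$ is the set of $w$ such that the ideal $\mathrm{in}_w(I)$ of minimal-weight initial forms contains no monomial. $\mathrm{Trop}(L)\subset\mathbb{R}^m\cong\mathbb{R}^{m+1}/\mathbb{R}(1,\dots,1)$ is the tropicalization of $L\cap T_{\mathbb{P}^m}$; it is the Bergman fan of the uniform matroid $U_{c+1,m+1}$ with maximal cones $\mathrm{cone}(e_{i_1},\dots,e_{i_c})$. A point $w=(w_1,\dots,w_m)$ is read as $(w_0=0,w_1,\dots,w_m)$ and $\mathcal{I}=\{i:w_i=\min_kw_k\}$. $\mathrm{Trop}(J_{\mathfrak{D}})$ is the image of $\mathrm{Trop}(L)\times N_{\mathbb{R}}$ under the injective linear map $\Phi(z)=(\langle h,z\rangle)_{h\in\mathcal{H}}$. The valuation: let $d=c+\mathrm{rk}(N)$, choose linearly independent rational vectors $\mathbf{u}_1,\dots,\mathbf{u}_d$ in the relatively open cone $\Phi(\mathrm{relint}(\tau)\times N_{\mathbb{R}})$, and let $A$ be the matrix with rows $\mathbf{u}_i$. For $p=\sum_ac_ax^a$ put $\tilde{\mathfrak{v}}(p)=\min\{Aa: c_a\ne0\}\in\mathbb{Q}^d$ (lexicographic order) and $\mathfrak{v}_w(f)=\max\{\tilde{\mathfrak{v}}(p):\phi(p)=f\}$ for $0\ne f\in R(\mathfrak{D})$. The value semigroup $S(R(\mathfrak{D}),\mathfrak{v}_w)$ is the set of values $\mathfrak{v}_w(f)$, $f\neq0$. *)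

theory Defs
  imports
    "HOL-Analysis.Analysis"
    "HOL-Algebra.Group"
    "HOL-Computational_Algebra.Fraction_Field"
    "HOL-Library.Poly_Mapping"
    "HOL-Library.Function_Algebras"
    "HOL-Library.List_Lexorder"
    "HOL-Library.Extended_Real"
begin

section \<open>Lattices, cones and polyhedra\<close>

text \<open>
  The ambient real vector space \<open>'v\<close> plays the role of \<open>N\<^sub>\<real>\<close>; its dimension may be 0.
  The rank of the lattice \<open>N\<close> is \<^term>\<open>dim N\<close>.
\<close>

definition is_lattice :: "'v::real_vector set \<Rightarrow> bool" where
  "is_lattice N \<longleftrightarrow> (\<exists>B. finite B \<and> independent B \<and> span B = UNIV \<and>
     N = {\<Sum>b\<in>B. of_int (k b) *\<^sub>R b | k :: 'v \<Rightarrow> int. True})"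

definition rational_points :: "'v::real_vector set \<Rightarrow> 'v set" where
  "rational_points N = {x. \<exists>n::nat. n > 0 \<and> of_nat n *\<^sub>R x \<in> N}"

text \<open>
  \<open>M = Hom(N, \<int>)\<close>: since \<open>N\<close> spans \<open>'v\<close>, a homomorphism \<open>N \<rightarrow> \<int>\<close> is the same as a linear
  functional on \<open>'v\<close> that is integral on \<open>N\<close>.
\<close>
definition dual_lattice :: "'v::real_vector set \<Rightarrow> ('v \<Rightarrow> real) set" where
  "dual_lattice N = {u. linear u \<and> (\<forall>x\<in>N. u x \<in> \<int>)}"

text \<open>Cones and polytopes live in \<open>N\<^sub>\<rat>\<close>, so all combinations have rational coefficients.\<close>

definition pointed_rational_cone :: "'v::real_vector set \<Rightarrow> 'v set \<Rightarrow> bool" where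
  "pointed_rational_cone N \<sigma> \<longleftrightarrow>
     (\<exists>G. finite G \<and> G \<subseteq> rational_points N \<and>
        \<sigma> = {\<Sum>g\<in>G. of_rat (q g) *\<^sub>R g | q. \<forall>g\<in>G. q g \<ge> 0}) \<and>
     (\<forall>x. x \<in> \<sigma> \<longrightarrow> - x \<in> \<sigma> \<longrightarrow> x = 0)"

definition rational_polytope :: "'v::real_vector set \<Rightarrow> 'v set \<Rightarrow> bool" where
  "rational_polytope N P \<longleftrightarrow>
     (\<exists>V. finite V \<and> V \<noteq> {} \<and> V \<subseteq> rational_points N \<and>
        P = {\<Sum>x\<in>V. of_rat (q x) *\<^sub>R x | q. (\<forall>x\<in>V. q x \<ge> 0) \<and> sum q V = 1})"

definition sigma_polyhedron :: "'v::real_vector set \<Rightarrow> 'v set \<Rightarrow> 'v set \<Rightarrow> bool" where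
  "sigma_polyhedron N \<sigma> D \<longleftrightarrow> D = {} \<or> (\<exists>P. rational_polytope N P \<and> D = P + \<sigma>)"

definition weight_monoid :: "'v::real_vector set \<Rightarrow> 'v set \<Rightarrow> ('v \<Rightarrow> real) set" where
  "weight_monoid N \<sigma> = {u \<in> dual_lattice N. \<forall>x\<in>\<sigma>. u x \<ge> 0}"

text \<open>
  \<open>\<Delta>(u)\<close>, which is \<open>\<infinity>\<close> for \<open>\<Delta> = \<emptyset>\<close>.  For a \<open>\<sigma>\<close>-polyhedron and \<open>u \<in> \<sigma>\<^sup>\<or>\<close> the infimum over
  a nonempty \<open>\<Delta>\<close> is attained, and \<open>-\<infinity>\<close> does not occur.
\<close>
definition support_value :: "'v set \<Rightarrow> ('v \<Rightarrow> real) \<Rightarrow> ereal" where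
  "support_value D u = (INF v\<in>D. ereal (u v))"

definition floor_value :: "'v set \<Rightarrow> ('v \<Rightarrow> real) \<Rightarrow> ereal" where
  "floor_value D u = (if support_value D u = \<infinity> then \<infinity>
     else ereal (of_int \<lfloor>real_of_ereal (support_value D u)\<rfloor>))"

section \<open>Polynomials and rational functions\<close>

type_synonym 'k cpoly = "('k \<Rightarrow>\<^sub>0 nat) \<Rightarrow>\<^sub>0 complex"

type_synonym ratfun = "nat cpoly fract"

definition Const :: "complex \<Rightarrow> 'k cpoly" where
  "Const a = Poly_Mapping.single 0 a"

definition Var :: "'k \<Rightarrow> 'k cpoly" where
  "Var i = Poly_Mapping.single (Poly_Mapping.single i 1) 1"

definition polys_in :: "'k set \<Rightarrow> 'k cpoly set" where
  "polys_in X = {p. \<forall>a\<in>Poly_Mapping.keys p. Poly_Mapping.keys a \<subseteq> X}"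

definition homogeneous :: "nat \<Rightarrow> 'k cpoly \<Rightarrow> bool" where
  "homogeneous n p \<longleftrightarrow> (\<forall>a\<in>Poly_Mapping.keys p.
     (\<Sum>i\<in>Poly_Mapping.keys a. Poly_Mapping.lookup a i) = n)"

text \<open>The ring homomorphism with \<open>x\<^sub>i \<mapsto> g i\<close> that is \<open>emb\<close> on the constants.\<close>
definition subst :: "(complex \<Rightarrow> 'r::comm_ring_1) \<Rightarrow> ('k \<Rightarrow> 'r) \<Rightarrow> 'k cpoly \<Rightarrow> 'r" where
  "subst emb g p = (\<Sum>a\<in>Poly_Mapping.keys p.
     emb (Poly_Mapping.lookup p a) *
     (\<Prod>i\<in>Poly_Mapping.keys a. g i ^ Poly_Mapping.lookup a i))"

definition linear_form :: "nat \<Rightarrow> nat cpoly \<Rightarrow> bool" where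
  "linear_form c f \<longleftrightarrow> (\<exists>a. f = (\<Sum>j\<le>c. Const (a j) * Var j))"

text \<open>
  The index set \<open>{0,\<dots>,m}\<close> is \<open>'m option\<close> with \<open>m = CARD('m)\<close>: \<^term>\<open>None\<close> is the
  index \<open>0\<close>, and \<open>\<real>\<^sup>m\<close> is \<^typ>\<open>real ^ 'm\<close>.
\<close>

definition general_linear_position :: "nat \<Rightarrow> ('m::finite option \<Rightarrow> nat cpoly) \<Rightarrow> bool" where
  "general_linear_position c ell \<longleftrightarrow>
     (\<forall>K. card K = c + 1 \<longrightarrow>
        (\<forall>a. (\<Sum>i\<in>K. Const (a i) * ell i) = 0 \<longrightarrow> (\<forall>i\<in>K. a i = 0)))"

definition full_rank :: "nat \<Rightarrow> ('m::finite option \<Rightarrow> nat cpoly) \<Rightarrow> bool" where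
  "full_rank c ell \<longleftrightarrow>
     (\<forall>f. linear_form c f \<longrightarrow> (\<exists>a. f = (\<Sum>i\<in>UNIV. Const (a i) * ell i)))"

text \<open>The function field \<open>\<complex>(\<P>\<^sup>c)\<close>, as the degree-0 part of \<open>\<complex>(x\<^sub>0,\<dots>,x\<^sub>c)\<close>.\<close>
definition function_field :: "nat \<Rightarrow> ratfun set" where
  "function_field c = {Fract P Q | P Q. P \<in> polys_in {..c} \<and> Q \<in> polys_in {..c} \<and> Q \<noteq> 0 \<and>
     (\<exists>n. homogeneous n P \<and> homogeneous n Q)}"

text \<open>
  The prime divisors of \<open>\<P>\<^sup>c\<close> are the \<open>V(q)\<close> with \<open>q\<close> an irreducible form, and
  \<open>V(q) = V(q')\<close> iff \<open>q\<close> and \<open>q'\<close> divide each other.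
\<close>
definition irreducible_form :: "nat \<Rightarrow> nat cpoly \<Rightarrow> bool" where
  "irreducible_form c q \<longleftrightarrow> q \<in> polys_in {..c} \<and> irreducible q \<and> (\<exists>n. homogeneous n q)"

definition order_along :: "nat cpoly \<Rightarrow> ratfun \<Rightarrow> int" where
  "order_along q f = (THE k. \<exists>P Q. \<not> q dvd P \<and> \<not> q dvd Q \<and>
     f = Fract q 1 powi k * Fract P Q)"

text \<open>
  \<open>H\<^sup>0(\<P>\<^sup>c, \<O>(\<Sum>\<^sub>i a\<^sub>i V(ell\<^sub>i)))\<close>, i.e. \<open>f = 0\<close> or \<open>div(f) + \<Sum>\<^sub>i a\<^sub>i V(ell\<^sub>i) \<ge> 0\<close>.  A
  coefficient \<open>\<infinity>\<close> allows poles of arbitrary order along \<open>V(ell\<^sub>i)\<close>.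
\<close>
definition global_sections ::
    "nat \<Rightarrow> ('m::finite option \<Rightarrow> nat cpoly) \<Rightarrow> ('m option \<Rightarrow> ereal) \<Rightarrow> ratfun set" where
  "global_sections c ell a = {f \<in> function_field c. f = 0 \<or>
     (\<forall>q. irreducible_form c q \<longrightarrow>
        ereal (of_int (order_along q f)) + (\<Sum>i | q dvd ell i \<and> ell i dvd q. a i) \<ge> 0)}"

section \<open>The ring \<open>R(\<DD>)\<close> and its semi-canonical presentation\<close>

text \<open>Elements \<open>\<Sum>\<^sub>u f\<^sub>u \<chi>\<^sup>u\<close> live in the group algebra over \<open>\<complex>(x\<^sub>0,\<dots>,x\<^sub>c)\<close>.\<close>

type_synonym 'v graded = "('v \<Rightarrow> real) \<Rightarrow>\<^sub>0 ratfun"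

definition divisor_ring ::
    "'v::real_vector set \<Rightarrow> 'v set \<Rightarrow> nat \<Rightarrow> ('m::finite option \<Rightarrow> nat cpoly) \<Rightarrow>
     ('m option \<Rightarrow> 'v set) \<Rightarrow> 'v graded set" where
  "divisor_ring N \<sigma> c ell \<Delta> = {F. \<forall>u\<in>Poly_Mapping.keys F. u \<in> weight_monoid N \<sigma> \<and>
     Poly_Mapping.lookup F u \<in> global_sections c ell (\<lambda>i. floor_value (\<Delta> i) u)}"

definition ray :: "'m::finite option \<Rightarrow> real ^ 'm" where
  "ray i = (case i of None \<Rightarrow> - (\<Sum>j\<in>UNIV. axis j 1) | Some j \<Rightarrow> axis j 1)"

definition delta_cone ::
    "'v::real_vector set \<Rightarrow> ('m::finite option \<Rightarrow> 'v set) \<Rightarrow> ((real ^ 'm) \<times> 'v) set" where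
  "delta_cone \<sigma> \<Delta> = convex_cone hull (({0} \<times> \<sigma>) \<union> (\<Union>i. {ray i} \<times> \<Delta> i))"

type_synonym ('m, 'v) exponent = "(int ^ 'm) \<times> ('v \<Rightarrow> real)"

definition pairing :: "('m::finite, 'v) exponent \<Rightarrow> (real ^ 'm) \<times> 'v \<Rightarrow> real" where
  "pairing h z = (\<Sum>j\<in>UNIV. of_int (fst h $ j) * fst z $ j) + snd h (snd z)"

definition delta_dual_monoid ::
    "'v::real_vector set \<Rightarrow> 'v set \<Rightarrow> ('m::finite option \<Rightarrow> 'v set) \<Rightarrow> ('m, 'v) exponent set" where
  "delta_dual_monoid N \<sigma> \<Delta> =
     {h. snd h \<in> dual_lattice N \<and> (\<forall>z\<in>delta_cone \<sigma> \<Delta>. pairing h z \<ge> 0)}"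

text \<open>
  \<open>\<delta>\<^sup>\<or>\<close> need not be pointed, so a Hilbert basis is taken to be any finite generating set of the
  monoid; inclusion-minimality is not required.
\<close>
definition hilbert_basis :: "'a::monoid_add set \<Rightarrow> 'a set \<Rightarrow> bool" where
  "hilbert_basis H S \<longleftrightarrow> finite H \<and> S = {sum_list hs | hs. set hs \<subseteq> H}"

definition restricted_monomial ::
    "('m::finite option \<Rightarrow> nat cpoly) \<Rightarrow> ('m, 'v) exponent \<Rightarrow> 'v graded" where
  "restricted_monomial ell h =
     Poly_Mapping.single (snd h) (\<Prod>j\<in>UNIV. Fract (ell (Some j)) (ell None) powi (fst h $ j))"

definition presentation ::
    "('m::finite option \<Rightarrow> nat cpoly) \<Rightarrow> ('m, 'v) exponent cpoly \<Rightarrow> 'v graded" where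
  "presentation ell =
     subst (\<lambda>a. Poly_Mapping.single 0 (Fract (Const a) 1)) (restricted_monomial ell)"

section \<open>The tropicalized linear space\<close>

text \<open>A point \<open>w \<in> \<real>\<^sup>m\<close> read as \<open>(0, w\<^sub>1, \<dots>, w\<^sub>m)\<close>.\<close>
definition hom_coord :: "real ^ 'm::finite \<Rightarrow> 'm option \<Rightarrow> real" where
  "hom_coord w i = (case i of None \<Rightarrow> 0 | Some j \<Rightarrow> w $ j)"

definition min_indices :: "real ^ 'm::finite \<Rightarrow> 'm option set" where
  "min_indices w = {i. hom_coord w i = Min (range (hom_coord w))}"

definition weight :: "('k \<Rightarrow> real) \<Rightarrow> ('k \<Rightarrow>\<^sub>0 nat) \<Rightarrow> real" where
  "weight w a = (\<Sum>i\<in>Poly_Mapping.keys a. of_nat (Poly_Mapping.lookup a i) * w i)"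

definition initial_form :: "('k \<Rightarrow> real) \<Rightarrow> 'k cpoly \<Rightarrow> 'k cpoly" where
  "initial_form w p = (\<Sum>a | a \<in> Poly_Mapping.keys p \<and>
     weight w a = Min (weight w ` Poly_Mapping.keys p). Poly_Mapping.single a (Poly_Mapping.lookup p a))"

definition initial_ideal :: "('k \<Rightarrow> real) \<Rightarrow> 'k cpoly set \<Rightarrow> 'k cpoly set" where
  "initial_ideal w I = {\<Sum>k<n. g k * initial_form w (f k) | (n::nat) g f. \<forall>k<n. f k \<in> I}"

text \<open>The homogeneous ideal of \<open>L\<close>, the image of \<open>P \<mapsto> [ell\<^sub>0(P) : \<dots> : ell\<^sub>m(P)]\<close>.\<close>
definition linear_space_ideal ::
    "('m::finite option \<Rightarrow> nat cpoly) \<Rightarrow> 'm option cpoly set" where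
  "linear_space_ideal ell = {p. subst Const ell p = 0}"

definition trop_linear_space :: "('m::finite option \<Rightarrow> nat cpoly) \<Rightarrow> (real ^ 'm) set" where
  "trop_linear_space ell = {w. \<forall>a. Poly_Mapping.single a 1 \<notin>
     initial_ideal (hom_coord w) (linear_space_ideal ell)}"

text \<open>
  The fan structure is that of the Bergman fan of the uniform matroid \<open>U\<^bsub>c+1,m+1\<^esub>\<close>, whose
  maximal cones are spanned by \<open>c\<close> of the rays.  For forms of full rank in general linear
  position, the inclusion in \<open>Trop(L)\<close> holds for every such cone.
\<close>
definition trop_maximal_cone ::
    "nat \<Rightarrow> ('m::finite option \<Rightarrow> nat cpoly) \<Rightarrow> (real ^ 'm) set \<Rightarrow> bool" where
  "trop_maximal_cone c ell \<tau> \<longleftrightarrow> \<tau> \<subseteq> trop_linear_space ell \<and>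
     (\<exists>K. card K = c \<and> \<tau> = convex_cone hull (ray ` K))"

section \<open>The valuation and the two semigroups\<close>

text \<open>
  The rows of \<open>A\<close> are \<open>d\<close> linearly independent rational vectors in the relatively open cone
  \<open>\<Phi>(relint(\<tau>) \<times> N\<^sub>\<real>)\<close>, where \<open>\<Phi>(z) = (\<langle>h, z\<rangle>)\<^sub>h\<close>.
\<close>
definition valuation_matrix ::
    "nat \<Rightarrow> ('m::finite, 'v) exponent set \<Rightarrow> (real ^ 'm) set \<Rightarrow>
     (nat \<Rightarrow> ('m, 'v) exponent \<Rightarrow> rat) \<Rightarrow> bool" where
  "valuation_matrix d H \<tau> A \<longleftrightarrow>
     (\<forall>k<d. \<exists>z \<in> rel_interior \<tau> \<times> UNIV. \<forall>h\<in>H. of_rat (A k h) = pairing h z) \<and>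
     (\<forall>r :: nat \<Rightarrow> rat. (\<forall>h\<in>H. (\<Sum>k<d. r k * A k h) = 0) \<longrightarrow> (\<forall>k<d. r k = 0))"

text \<open>Vectors in \<open>\<rat>\<^sup>d\<close> are lists of length \<open>d\<close>, which carry the lexicographic order.\<close>

definition matrix_weight :: "nat \<Rightarrow> (nat \<Rightarrow> 'k \<Rightarrow> rat) \<Rightarrow> ('k \<Rightarrow>\<^sub>0 nat) \<Rightarrow> rat list" where
  "matrix_weight d A a = map (\<lambda>k.
     \<Sum>h\<in>Poly_Mapping.keys a. A k h * of_nat (Poly_Mapping.lookup a h)) [0..<d]"

definition weight_valuation :: "nat \<Rightarrow> (nat \<Rightarrow> 'k \<Rightarrow> rat) \<Rightarrow> 'k cpoly \<Rightarrow> rat list" where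
  "weight_valuation d A p = Min (matrix_weight d A ` Poly_Mapping.keys p)"

definition valuation ::
    "nat \<Rightarrow> ('m::finite option \<Rightarrow> nat cpoly) \<Rightarrow> ('m, 'v) exponent set \<Rightarrow>
     (nat \<Rightarrow> ('m, 'v) exponent \<Rightarrow> rat) \<Rightarrow> 'v graded \<Rightarrow> rat list" where
  "valuation d ell H A F =
     (GREATEST b. \<exists>p\<in>polys_in H. presentation ell p = F \<and> b = weight_valuation d A p)"

definition value_semigroup ::
    "nat \<Rightarrow> ('m::finite option \<Rightarrow> nat cpoly) \<Rightarrow> ('m, 'v) exponent set \<Rightarrow>
     (nat \<Rightarrow> ('m, 'v) exponent \<Rightarrow> rat) \<Rightarrow> 'v graded set \<Rightarrow> rat list monoid" where
  "value_semigroup d ell H A R =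
     \<lparr>carrier = valuation d ell H A ` (R - {0}), mult = map2 (+), one = replicate d 0\<rparr>"

text \<open>
  \<open>\<int>\<^sup>c\<close> consists of the functions \<open>nat \<Rightarrow> int\<close> vanishing outside \<open>{1..c}\<close>; \<open>idx\<close>
  enumerates the complement \<open>{i\<^sub>1,\<dots>,i\<^sub>c}\<close> of \<^term>\<open>min_indices w\<close>.
\<close>
definition S_w ::
    "'v::real_vector set \<Rightarrow> 'v set \<Rightarrow> nat \<Rightarrow> ('m::finite option \<Rightarrow> 'v set) \<Rightarrow>
     real ^ 'm \<Rightarrow> (nat \<Rightarrow> 'm option) \<Rightarrow> ((nat \<Rightarrow> int) \<times> ('v \<Rightarrow> real)) monoid" where
  "S_w N \<sigma> c \<Delta> w idx =
     \<lparr>carrier = {(v, u). (\<forall>j. j \<notin> {1..c} \<longrightarrow> v j = 0) \<and> u \<in> weight_monoid N \<sigma> \<and>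
        ereal (of_int (\<Sum>j=1..c. v j)) \<le> (\<Sum>i\<in>min_indices w. floor_value (\<Delta> i) u) \<and>
        (\<forall>j\<in>{1..c}. ereal (of_int (v j)) \<ge> - floor_value (\<Delta> (idx j)) u)},
      mult = (+), one = 0\<rparr>"

end

theory Submission
  imports Defs
begin

text \<open>
  Let \<open>K\<close> be the set of the \<open>c\<close> indices whose rays span \<open>\<tau>\<close>, so that \<open>-K\<close> is the set where
  \<open>w\<close> is minimal.  A Laurent monomial on the ambient torus restricts to
  \<open>\<Prod>\<^sub>i ell\<^sub>i powi h\<^sub>i\<close> with exponents \<open>h\<^sub>i\<close>, \<open>i \<in> {0,\<dots>,m}\<close>, that sum to zero.  The monoid
  \<open>\<delta>\<^sup>\<or> \<inter> (\<int>\<^sup>m \<times> M)\<close> consists of the pairs \<open>(h,u)\<close> with \<open>u \<in> \<sigma>\<^sup>\<or>\<close> and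
  \<open>h\<^sub>i \<ge> -\<lfloor>\<Delta>\<^sub>i(u)\<rfloor>\<close>, which says exactly that the restricted monomial is a section in degree
  \<open>u\<close> (\<open>mem_delta_dual_monoid_iff\<close>).  Keeping only the exponents with index in \<open>K\<close> maps
  this monoid onto \<open>S\<^sub>w\<close>: the discarded exponents have lower bounds and a prescribed sum, and integers with
  these properties exist precisely when the first inequality in \<open>S\<^sub>w\<close> holds
  (\<open>project_image_M\<close>).

  The rows of \<open>A\<close> come from points \<open>(\<Sum>\<^sub>K l\<^sub>i e\<^sub>i, x)\<close> with all \<open>l\<^sub>i > 0\<close>.  Pairing with such a
  point involves the exponents in \<open>K\<close> and \<open>u\<close> only, and because the \<open>c + dim N\<close> rows are
  independent, these data are determined by the weights (\<open>weights_injective\<close>).  So the vectors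
  \<open>A a\<close> form a copy of \<open>S\<^sub>w\<close>, and it remains to identify them with the values of the valuation.

  For an index \<open>j0\<close> outside \<open>K\<close>, the quotients \<open>ell\<^sub>i / ell\<^bsub>j0\<^esub>\<close> with \<open>i \<in> K\<close> are affine
  coordinates on \<open>\<P>\<^sup>c\<close>.  By general position no other form vanishes at the origin of
  this chart, so there every monomial in the forms is a monomial in the coordinates times a
  function that is nonzero at the origin.  The weights of the coordinates are positive in every
  row, so the lowest term of a product of forms is the one with the exponents \<open>(h\<^sub>i)\<close>,
  \<open>i \<in> K\<close>.  A polynomial whose lowest weight is attained only once therefore has that weight as
  the value of its image: another preimage of higher weight would have no term to match the lowest one (\<open>leading_exponent_bound\<close>,
  \<open>valuation_presentation\<close>).  Applied to single monomials this shows that every \<open>A a\<close> is a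
  value.  Conversely every element of the ring has a preimage whose monomials have pairwise
  different weights: a section is a form of degree \<open>\<Sum> b\<^sub>i\<close> divided by \<open>\<Prod> ell\<^sub>i powi b\<^sub>i\<close> for
  integers \<open>b\<^sub>i \<le> \<lfloor>\<Delta>\<^sub>i(u)\<rfloor>\<close> (\<open>global_section_normal_form\<close>), and that form is expanded in the
  \<open>c + 1\<close> forms with index in \<open>K \<union> {j0}\<close> (\<open>global_section_expansion\<close>).

  Orders of vanishing are meaningful only because irreducible polynomials in several variables
  are prime.  This is Gauss's lemma, proved here by induction on the number of variables.
\<close>

section \<open>Substitution homomorphisms\<close>

definition is_ring_hom :: "('a::comm_ring_1 \<Rightarrow> 'b::comm_ring_1) \<Rightarrow> bool" where
  "is_ring_hom f \<longleftrightarrow> f 1 = 1 \<and> (\<forall>x y. f (x + y) = f x + f y) \<and> (\<forall>x y. f (x * y) = f x * f y)"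

lemma is_ring_homD:
  assumes "is_ring_hom f"
  shows "f 1 = 1" "f (x + y) = f x + f y" "f (x * y) = f x * f y"
  using assms by (simp_all add: is_ring_hom_def)

lemma is_ring_hom_zero: "is_ring_hom f \<Longrightarrow> f 0 = 0"
  using is_ring_homD(2)[of f 0 0] by simp

lemma is_ring_hom_sum: "is_ring_hom f \<Longrightarrow> f (\<Sum>i\<in>I. g i) = (\<Sum>i\<in>I. f (g i))"
  by (induction I rule: infinite_finite_induct) (simp_all add: is_ring_hom_zero is_ring_homD)

lemma is_ring_hom_prod: "is_ring_hom f \<Longrightarrow> f (\<Prod>i\<in>I. g i) = (\<Prod>i\<in>I. f (g i))"
  by (induction I rule: infinite_finite_induct) (simp_all add: is_ring_homD)

lemma is_ring_hom_power: "is_ring_hom f \<Longrightarrow> f (x ^ n) = f x ^ n"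
  by (induction n) (simp_all add: is_ring_homD)

lemma is_ring_hom_uminus: "is_ring_hom f \<Longrightarrow> f (- x) = - f x"
  using is_ring_homD(2)[of f x "- x"] is_ring_hom_zero[of f]
  by (metis add.right_inverse add_eq_0_iff)

lemma is_ring_hom_diff: "is_ring_hom f \<Longrightarrow> f (x - y) = f x - f y"
  using is_ring_homD(2)[of f x "- y"] is_ring_hom_uminus[of f y] by simp

lemma is_ring_hom_comp: "is_ring_hom f \<Longrightarrow> is_ring_hom g \<Longrightarrow> is_ring_hom (\<lambda>x. g (f x))"
  by (simp add: is_ring_hom_def)

lemma is_ring_hom_Const: "is_ring_hom Const"
  by (simp add: is_ring_hom_def Const_def single_add mult_single)

lemma is_ring_hom_pCons: "is_ring_hom (\<lambda>x. [:x:])"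
  by (simp add: is_ring_hom_def one_pCons)

lemma is_ring_hom_poly: "is_ring_hom (\<lambda>p. poly p x)"
  by (simp add: is_ring_hom_def)

lemma Const_0 [simp]: "Const 0 = 0" and Const_1 [simp]: "Const 1 = 1"
  by (simp_all add: Const_def)

lemma Const_eq_0_iff [simp]: "Const a = 0 \<longleftrightarrow> a = 0"
  by (metis Const_def Const_0 lookup_single_eq)

lemma Const_mult: "Const (a * b) = Const a * Const b"
  and Const_add: "Const (a + b) = Const a + Const b"
  by (simp_all add: is_ring_homD[OF is_ring_hom_Const])

lemma poly_mapping_expand: "p = (\<Sum>a\<in>Poly_Mapping.keys p. Poly_Mapping.single a (Poly_Mapping.lookup p a))"
proof (rule poly_mapping_eqI)
  fix b
  have "Poly_Mapping.lookup (\<Sum>a\<in>Poly_Mapping.keys p. Poly_Mapping.single a (Poly_Mapping.lookup p a)) b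
      = (\<Sum>a\<in>Poly_Mapping.keys p. (if a = b then Poly_Mapping.lookup p b else 0))"
    unfolding lookup_sum by (intro sum.cong) (auto simp: lookup_single when_def)
  then show "Poly_Mapping.lookup p b
      = Poly_Mapping.lookup (\<Sum>a\<in>Poly_Mapping.keys p. Poly_Mapping.single a (Poly_Mapping.lookup p a)) b"
    by (simp add: sum.delta in_keys_iff)
qed

definition power_product :: "('k \<Rightarrow> 'r::comm_ring_1) \<Rightarrow> ('k \<Rightarrow>\<^sub>0 nat) \<Rightarrow> 'r" where
  "power_product g a = (\<Prod>i\<in>Poly_Mapping.keys a. g i ^ Poly_Mapping.lookup a i)"

lemma power_product_superset:
  assumes "finite S" "Poly_Mapping.keys a \<subseteq> S"
  shows "power_product g a = (\<Prod>i\<in>S. g i ^ Poly_Mapping.lookup a i)"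
  unfolding power_product_def
  by (rule prod.mono_neutral_left) (use assms in \<open>auto simp: in_keys_iff\<close>)

lemma power_product_0 [simp]: "power_product g 0 = 1"
  by (simp add: power_product_def)

lemma power_product_add: "power_product g (a + b) = power_product g a * power_product g b"
proof -
  let ?S = "Poly_Mapping.keys a \<union> Poly_Mapping.keys b"
  have "power_product g (a + b) = (\<Prod>i\<in>?S. g i ^ Poly_Mapping.lookup (a + b) i)"
    by (rule power_product_superset) (use keys_add[of a b] in auto)
  also have "\<dots> = (\<Prod>i\<in>?S. g i ^ Poly_Mapping.lookup a i) * (\<Prod>i\<in>?S. g i ^ Poly_Mapping.lookup b i)"
    by (simp add: lookup_add power_add prod.distrib)
  also have "\<dots> = power_product g a * power_product g b"
    by (subst (1 2) power_product_superset[where S = ?S]) auto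
  finally show ?thesis .
qed

lemma power_product_sum: "power_product g (\<Sum>i\<in>I. f i) = (\<Prod>i\<in>I. power_product g (f i))"
  by (induction I rule: infinite_finite_induct) (simp_all add: power_product_add)

lemma power_product_single [simp]: "power_product g (Poly_Mapping.single i n) = g i ^ n"
  by (cases "n = 0") (simp_all add: power_product_def)

lemma subst_superset:
  assumes "is_ring_hom emb" "finite S" "Poly_Mapping.keys p \<subseteq> S"
  shows "subst emb g p = (\<Sum>a\<in>S. emb (Poly_Mapping.lookup p a) * power_product g a)"
  unfolding subst_def power_product_def[symmetric]
  by (rule sum.mono_neutral_left) (use assms in \<open>auto simp: in_keys_iff is_ring_hom_zero\<close>)

lemma subst_single:
  assumes "is_ring_hom emb"
  shows "subst emb g (Poly_Mapping.single a x) = emb x * power_product g a"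
  by (subst subst_superset[where S = "{a}"]) (use assms in auto)

lemma subst_Const:
  assumes "is_ring_hom emb"
  shows "subst emb g (Const x) = emb x"
  by (simp add: Const_def subst_single[OF assms])

lemma subst_Var:
  assumes "is_ring_hom emb"
  shows "subst emb g (Var i) = g i"
  by (simp add: Var_def subst_single[OF assms] is_ring_homD[OF assms])

lemma subst_add:
  assumes "is_ring_hom emb"
  shows "subst emb g (p + q) = subst emb g p + subst emb g q"
proof -
  let ?S = "Poly_Mapping.keys p \<union> Poly_Mapping.keys q"
  show ?thesis
    using keys_add[of p q]
    by (subst (1 2 3) subst_superset[where S = ?S])
      (auto simp: assms lookup_add is_ring_homD[OF assms] sum.distrib distrib_right)
qed

lemma subst_0 [simp]: "subst emb g 0 = 0"
  by (simp add: subst_def)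

lemma subst_sum:
  assumes "is_ring_hom emb"
  shows "subst emb g (\<Sum>i\<in>I. f i) = (\<Sum>i\<in>I. subst emb g (f i))"
  by (induction I rule: infinite_finite_induct) (simp_all add: subst_add[OF assms])

lemma subst_mult:
  assumes "is_ring_hom emb"
  shows "subst emb g (p * q) = subst emb g p * subst emb g q"
proof -
  have "subst emb g (p * q) = subst emb g
      (\<Sum>a\<in>Poly_Mapping.keys p. \<Sum>b\<in>Poly_Mapping.keys q.
        Poly_Mapping.single (a + b) (Poly_Mapping.lookup p a * Poly_Mapping.lookup q b))"
    by (subst poly_mapping_expand[of p], subst poly_mapping_expand[of q])
      (simp add: sum_product mult_single)
  also have "\<dots> = subst emb g p * subst emb g q"
    by (simp add: subst_sum[OF assms] subst_single[OF assms] is_ring_homD[OF assms]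
        power_product_add mult_ac)
      (simp add: subst_def power_product_def[symmetric] sum_product mult_ac)
  finally show ?thesis .
qed

lemma is_ring_hom_subst:
  assumes "is_ring_hom emb"
  shows "is_ring_hom (subst emb g)"
  unfolding is_ring_hom_def
  using subst_Const[OF assms, of g 1] is_ring_homD(1)[OF assms]
  by (simp add: subst_add[OF assms] subst_mult[OF assms])

lemma is_ring_hom_power_product:
  "is_ring_hom f \<Longrightarrow> f (power_product g a) = power_product (\<lambda>i. f (g i)) a"
  by (simp add: power_product_def is_ring_hom_prod is_ring_hom_power)

lemma is_ring_hom_of_subst:
  assumes "is_ring_hom f"
  shows "f (subst emb g p) = subst (\<lambda>x. f (emb x)) (\<lambda>i. f (g i)) p"
  using assms unfolding subst_def power_product_def[symmetric]
  by (simp add: is_ring_hom_sum is_ring_hom_power_product is_ring_homD)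

lemma subst_subst:
  assumes "is_ring_hom emb"
  shows "subst emb g (subst Const f p) = subst emb (\<lambda>i. subst emb g (f i)) p"
  using is_ring_hom_of_subst[OF is_ring_hom_subst[OF assms], of g Const f p]
  by (simp add: subst_Const[OF assms])

lemma power_product_Var: "power_product Var a = Poly_Mapping.single a 1"
proof -
  have 1: "Var i ^ n = Poly_Mapping.single (Poly_Mapping.single i n) 1" for i :: 'a and n
    by (induction n) (simp_all add: Var_def mult_single single_add[symmetric])
  have 2: "(\<Prod>i\<in>S. Poly_Mapping.single (f i) (1::complex)) = Poly_Mapping.single (\<Sum>i\<in>S. f i) 1"
    for S and f :: "'a \<Rightarrow> 'a \<Rightarrow>\<^sub>0 nat"
    by (induction S rule: infinite_finite_induct) (simp_all add: mult_single)
  show ?thesis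
    unfolding power_product_def 1 2 by (subst (3) poly_mapping_expand[of a]) simp
qed

lemma subst_Const_Var [simp]: "subst Const Var p = p"
  unfolding subst_def power_product_def[symmetric] power_product_Var Const_def
  by (subst (3) poly_mapping_expand[of p]) (simp add: mult_single)

lemma subst_cong:
  assumes "p \<in> polys_in X" "\<And>i. i \<in> X \<Longrightarrow> f i = g i"
  shows "subst emb f p = subst emb g p"
proof -
  have "f i = g i" if "a \<in> Poly_Mapping.keys p" "i \<in> Poly_Mapping.keys a" for a i
    using assms that by (auto simp: polys_in_def)
  then show ?thesis by (simp add: subst_def)
qed

lemma polys_in_mono: "p \<in> polys_in X \<Longrightarrow> X \<subseteq> Y \<Longrightarrow> p \<in> polys_in Y"
  by (auto simp: polys_in_def)

lemma polys_in_0 [simp]: "0 \<in> polys_in X"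
  by (simp add: polys_in_def)

lemma polys_in_Const [simp]: "Const a \<in> polys_in X"
  by (auto simp: polys_in_def Const_def split: if_splits)

lemma polys_in_1 [simp]: "1 \<in> polys_in X"
  using polys_in_Const[of 1 X] by (simp del: polys_in_Const)

lemma polys_in_Var [simp]: "Var i \<in> polys_in X \<longleftrightarrow> i \<in> X"
  by (auto simp: polys_in_def Var_def split: if_splits)

lemma polys_in_add [simp]: "p \<in> polys_in X \<Longrightarrow> q \<in> polys_in X \<Longrightarrow> p + q \<in> polys_in X"
  using keys_add[of p q] by (fastforce simp: polys_in_def)

lemma polys_in_uminus [simp]: "p \<in> polys_in X \<Longrightarrow> - p \<in> polys_in X"
  by (simp add: polys_in_def in_keys_iff)

lemma polys_in_diff [simp]: "p \<in> polys_in X \<Longrightarrow> q \<in> polys_in X \<Longrightarrow> p - q \<in> polys_in X"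
  using polys_in_add[of p X "- q"] by simp

lemma polys_in_mult [simp]:
  assumes "p \<in> polys_in X" "q \<in> polys_in X"
  shows "p * q \<in> polys_in X"
  unfolding polys_in_def
proof safe
  fix a x assume "a \<in> Poly_Mapping.keys (p * q)" and x: "x \<in> Poly_Mapping.keys a"
  then obtain b b' where b: "b \<in> Poly_Mapping.keys p" "b' \<in> Poly_Mapping.keys q" "a = b + b'"
    using keys_mult[of p q] by blast
  then show "x \<in> X"
    using x assms keys_add[of b b'] unfolding polys_in_def by blast
qed

lemma polys_in_sum [simp]: "(\<And>i. i \<in> I \<Longrightarrow> f i \<in> polys_in X) \<Longrightarrow> (\<Sum>i\<in>I. f i) \<in> polys_in X"
  by (induction I rule: infinite_finite_induct) auto

lemma polys_in_prod [simp]: "(\<And>i. i \<in> I \<Longrightarrow> f i \<in> polys_in X) \<Longrightarrow> (\<Prod>i\<in>I. f i) \<in> polys_in X"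
  by (induction I rule: infinite_finite_induct) auto

lemma polys_in_power [simp]: "p \<in> polys_in X \<Longrightarrow> p ^ n \<in> polys_in X"
  by (induction n) auto

lemma polys_in_subst:
  assumes "\<And>i. f i \<in> polys_in X"
  shows "subst Const f p \<in> polys_in X"
  unfolding subst_def using assms by auto

lemma polys_in_finite: "\<exists>n. p \<in> polys_in {..<n::nat}"
proof -
  have "finite (\<Union>a\<in>Poly_Mapping.keys p. Poly_Mapping.keys a)" by simp
  then obtain n where "(\<Union>a\<in>Poly_Mapping.keys p. Poly_Mapping.keys a) \<subseteq> {..<n}"
    using finite_nat_iff_bounded by blast
  then show ?thesis by (auto simp: polys_in_def)
qed

section \<open>Univariate views of multivariate polynomials\<close>

lemma is_ring_hom_pCons_Const: "is_ring_hom (\<lambda>a. [:Const a:])"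
  by (rule is_ring_hom_comp[OF is_ring_hom_Const is_ring_hom_pCons])

text \<open>
  Viewing a polynomial as univariate over the remaining variables gives access to degrees and
  leading coefficients in \<open>x\<^sub>n\<close>; evaluating at \<open>x\<^sub>n\<close> undoes it.
\<close>
definition univariate :: "'k \<Rightarrow> 'k cpoly \<Rightarrow> 'k cpoly poly" where
  "univariate n = subst (\<lambda>a. [:Const a:]) (\<lambda>i. if i = n then [:0, 1:] else [:Var i:])"

lemma is_ring_hom_univariate: "is_ring_hom (univariate n)"
  unfolding univariate_def by (rule is_ring_hom_subst[OF is_ring_hom_pCons_Const])

lemma univariate_mult: "univariate n (p * q) = univariate n p * univariate n q"
  by (rule is_ring_homD[OF is_ring_hom_univariate])

lemma poly_univariate [simp]: "poly (univariate n p) (Var n) = p"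
proof -
  have *: "(\<lambda>i. poly (if i = n then [:0, 1:] else [:Var i:]) (Var n)) = Var"
    by (rule ext) simp
  have "poly (univariate n p) (Var n) = subst Const Var p"
    unfolding univariate_def
    by (subst is_ring_hom_of_subst[OF is_ring_hom_poly]) (simp add: *)
  then show ?thesis by simp
qed

lemma univariate_eq_0_iff [simp]: "univariate n p = 0 \<longleftrightarrow> p = 0"
  by (metis is_ring_hom_zero[OF is_ring_hom_univariate] poly_0 poly_univariate)

lemma univariate_constant:
  assumes "p \<in> polys_in X" "n \<notin> X"
  shows "univariate n p = [:p:]"
proof -
  have "univariate n p = subst (\<lambda>a. [:Const a:]) (\<lambda>i. [:Var i:]) p"
    unfolding univariate_def by (rule subst_cong[OF assms(1)]) (use assms(2) in auto)
  also have "\<dots> = [:subst Const Var p:]"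
    by (rule is_ring_hom_of_subst[OF is_ring_hom_pCons, symmetric])
  finally show ?thesis by simp
qed

lemma coeff_univariate_in:
  assumes "p \<in> polys_in (insert n X)"
  shows "coeff (univariate n p) k \<in> polys_in X"
proof -
  let ?S = "{Q :: 'a cpoly poly. \<forall>k. coeff Q k \<in> polys_in X}"
  let ?g = "\<lambda>i. if i = n then [:0, 1:] else [:Var i:]"
  have const: "[:c:] \<in> ?S" if "c \<in> polys_in X" for c
    using that by (auto simp: coeff_pCons split: nat.splits)
  have mult: "P * Q \<in> ?S" if "P \<in> ?S" "Q \<in> ?S" for P Q
    using that by (auto simp: coeff_mult)
  have one: "1 \<in> ?S" unfolding one_pCons by (rule const) simp
  have power: "P ^ m \<in> ?S" if "P \<in> ?S" for P m
    by (induction m) (use that mult one in auto)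
  have prod: "(\<Prod>i\<in>I. f i) \<in> ?S" if "\<And>i. i \<in> I \<Longrightarrow> f i \<in> ?S" for I :: "'a set" and f
    using that by (induction I rule: infinite_finite_induct) (use mult one in auto)
  have sum: "(\<Sum>i\<in>I. f i) \<in> ?S" if "\<And>i. i \<in> I \<Longrightarrow> f i \<in> ?S" for I :: "('a \<Rightarrow>\<^sub>0 nat) set" and f
    using that by (auto simp: coeff_sum)
  have var: "?g i \<in> ?S" if "i \<in> insert n X" for i
    using that const[of "Var i"] by (auto simp: coeff_pCons split: nat.splits)
  have "univariate n p \<in> ?S"
    unfolding univariate_def subst_def
  proof (intro sum mult const prod power polys_in_Const)
    fix a i assume "a \<in> Poly_Mapping.keys p" "i \<in> Poly_Mapping.keys a"
    then show "?g i \<in> ?S" using assms by (intro var) (auto simp: polys_in_def)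
  qed
  then show ?thesis by simp
qed

definition monomial_degree :: "('k \<Rightarrow>\<^sub>0 nat) \<Rightarrow> nat" where
  "monomial_degree a = (\<Sum>i\<in>Poly_Mapping.keys a. Poly_Mapping.lookup a i)"

text \<open>
  Every variable is scaled by a new variable, so the coefficients are the homogeneous parts.
  Additivity of the total degree and homogeneity of factors are then facts about univariate
  polynomials over a domain.
\<close>
definition grade :: "'k cpoly \<Rightarrow> 'k cpoly poly" where
  "grade = subst (\<lambda>a. [:Const a:]) (\<lambda>i. monom (Var i) 1)"

lemma is_ring_hom_grade: "is_ring_hom grade"
  unfolding grade_def by (rule is_ring_hom_subst[OF is_ring_hom_pCons_Const])

lemma poly_grade [simp]: "poly (grade p) 1 = p"
  unfolding grade_def by (subst is_ring_hom_of_subst[OF is_ring_hom_poly]) (simp add: poly_monom)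

lemma grade_eq_0_iff [simp]: "grade p = 0 \<longleftrightarrow> p = 0"
  by (metis is_ring_hom_zero[OF is_ring_hom_grade] poly_0 poly_grade)

lemma grade_expand:
  "grade p = (\<Sum>a\<in>Poly_Mapping.keys p.
     monom (Poly_Mapping.single a (Poly_Mapping.lookup p a)) (monomial_degree a))"
proof -
  have 1: "monom x (1::nat) ^ m = monom (x ^ m) m" for x :: "'a cpoly" and m
    by (simp add: monom_power)
  have 2: "(\<Prod>i\<in>I. monom (f i) (m i)) = monom (\<Prod>i\<in>I. f i) (\<Sum>i\<in>I. m i)"
    for I :: "'a set" and f :: "'a \<Rightarrow> 'a cpoly" and m
    by (induction I rule: infinite_finite_induct) (simp_all add: mult_monom monom_0 one_pCons)
  have "power_product (\<lambda>i. monom (Var i) 1) a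
      = monom (Poly_Mapping.single a 1) (monomial_degree a)" for a :: "'a \<Rightarrow>\<^sub>0 nat"
    unfolding power_product_def 1 2 monomial_degree_def power_product_Var[symmetric] ..
  then show ?thesis
    unfolding grade_def subst_def power_product_def[symmetric]
    by (simp add: smult_monom Const_def mult_single)
qed

lemma homogeneous_iff_grade: "homogeneous n p \<longleftrightarrow> grade p = monom p n"
proof
  assume "homogeneous n p"
  then have "grade p = (\<Sum>a\<in>Poly_Mapping.keys p. monom (Poly_Mapping.single a (Poly_Mapping.lookup p a)) n)"
    unfolding grade_expand by (simp add: homogeneous_def monomial_degree_def)
  also have "\<dots> = monom p n"
    using poly_mapping_expand[of p] by (intro poly_eqI) (simp add: coeff_sum)
  finally show "grade p = monom p n" .
next
  assume *: "grade p = monom p n"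
  show "homogeneous n p"
    unfolding homogeneous_def monomial_degree_def[symmetric]
  proof
    fix a assume a: "a \<in> Poly_Mapping.keys p"
    have "Poly_Mapping.lookup (coeff (grade p) (monomial_degree a)) a
      = (\<Sum>b\<in>Poly_Mapping.keys p. if b = a then Poly_Mapping.lookup p a else 0)"
      unfolding grade_expand coeff_sum lookup_sum
      by (intro sum.cong refl) (auto simp: lookup_single when_def)
    also have "\<dots> \<noteq> 0" using a by (simp add: in_keys_iff)
    finally show "monomial_degree a = n"
      unfolding * by (auto split: if_splits)
  qed
qed

lemma homogeneous_mult: "homogeneous m p \<Longrightarrow> homogeneous n q \<Longrightarrow> homogeneous (m + n) (p * q)"
  by (simp add: homogeneous_iff_grade is_ring_homD[OF is_ring_hom_grade] mult_monom)

lemma homogeneous_Const [simp]: "homogeneous 0 (Const a)"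
  by (auto simp: homogeneous_def Const_def split: if_splits)

lemma homogeneous_Var [simp]: "homogeneous (Suc 0) (Var i)"
  by (auto simp: homogeneous_def Var_def split: if_splits)

lemma homogeneous_0 [simp]: "homogeneous n 0"
  by (simp add: homogeneous_def)

lemma homogeneous_add: "homogeneous n p \<Longrightarrow> homogeneous n q \<Longrightarrow> homogeneous n (p + q)"
  by (simp add: homogeneous_iff_grade is_ring_homD[OF is_ring_hom_grade] add_monom)

lemma homogeneous_sum: "(\<And>i. i \<in> I \<Longrightarrow> homogeneous n (f i)) \<Longrightarrow> homogeneous n (\<Sum>i\<in>I. f i)"
  by (induction I rule: infinite_finite_induct) (auto intro: homogeneous_add)

lemma homogeneous_power: "homogeneous n p \<Longrightarrow> homogeneous (n * k) (p ^ k)"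
  using homogeneous_Const[of 1] by (induction k) (auto simp del: homogeneous_Const intro: homogeneous_mult)

lemma homogeneous_prod:
  "(\<And>i. i \<in> I \<Longrightarrow> homogeneous (n i) (f i)) \<Longrightarrow> homogeneous (\<Sum>i\<in>I. n i) (\<Prod>i\<in>I. f i)"
  using homogeneous_Const[of 1]
  by (induction I rule: infinite_finite_induct) (auto simp del: homogeneous_Const intro: homogeneous_mult)

lemma homogeneous_subst:
  assumes "homogeneous n p" "\<And>i. homogeneous 1 (f i)"
  shows "homogeneous n (subst Const f p)"
  unfolding subst_def
proof (rule homogeneous_sum)
  fix a assume "a \<in> Poly_Mapping.keys p"
  then have *: "(\<Sum>i\<in>Poly_Mapping.keys a. 1 * Poly_Mapping.lookup a i) = n"
    using assms(1) by (simp add: homogeneous_def)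
  have "homogeneous (0 + (\<Sum>i\<in>Poly_Mapping.keys a. 1 * Poly_Mapping.lookup a i))
      (Const (Poly_Mapping.lookup p a) * (\<Prod>i\<in>Poly_Mapping.keys a. f i ^ Poly_Mapping.lookup a i))"
    by (intro homogeneous_mult homogeneous_Const homogeneous_prod homogeneous_power assms(2))
  then show "homogeneous n (Const (Poly_Mapping.lookup p a) * (\<Prod>i\<in>Poly_Mapping.keys a. f i ^ Poly_Mapping.lookup a i))"
    using * by simp
qed

text \<open>
  Reversing the coefficients turns the product into a constant, so the reversed factors are
  constants too.
\<close>
lemma monom_factor:
  fixes P Q :: "'a::idom poly"
  assumes "P * Q = monom c n" "c \<noteq> 0"
  shows "P = monom (lead_coeff P) (degree P)"
proof -
  have "reflect_poly P * reflect_poly Q = [:c:]"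
    unfolding reflect_poly_mult[symmetric] assms(1)
    by (rule poly_eqI)
      (use assms(2) in \<open>auto simp: coeff_reflect_poly degree_monom_eq coeff_pCons split: nat.splits\<close>)
  then have "degree (reflect_poly P) = 0"
    by (metis assms(2) degree_mult_eq_0 degree_pCons_0 mult_eq_0_iff pCons_eq_0_iff)
  then have "coeff P k = 0" if "k < degree P" for k
    using coeff_reflect_poly[of P "degree P - k"] that
    by (metis coeff_eq_0 diff_diff_cancel less_imp_le_nat not_less zero_less_diff diff_le_self)
  then show ?thesis
    by (intro poly_eqI) (metis coeff_eq_0 coeff_monom linorder_neqE_nat)
qed

lemma homogeneous_factor:
  fixes p q :: "nat cpoly"
  assumes "homogeneous n (p * q)" "p * q \<noteq> 0"
  obtains m where "homogeneous m p"
proof -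
  have "grade p * grade q = monom (p * q) n"
    using assms by (simp add: homogeneous_iff_grade is_ring_homD[OF is_ring_hom_grade])
  from monom_factor[OF this assms(2)] have *: "grade p = monom (lead_coeff (grade p)) (degree (grade p))" .
  then have "p = lead_coeff (grade p)"
    by (metis mult.right_neutral poly_grade poly_monom power_one)
  with * show ?thesis using that by (metis homogeneous_iff_grade)
qed

definition total_degree :: "nat cpoly \<Rightarrow> nat" where
  "total_degree p = degree (grade p)"

lemma total_degree_mult: "p \<noteq> 0 \<Longrightarrow> q \<noteq> 0 \<Longrightarrow> total_degree (p * q) = total_degree p + total_degree q"
  by (simp add: total_degree_def is_ring_homD[OF is_ring_hom_grade] degree_mult_eq)

lemma total_degree_homogeneous: "homogeneous n p \<Longrightarrow> p \<noteq> 0 \<Longrightarrow> total_degree p = n"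
  by (simp add: total_degree_def homogeneous_iff_grade degree_monom_eq)

lemma total_degree_0_imp_Const:
  assumes "total_degree p = 0"
  shows "\<exists>a. p = Const a"
proof -
  have "grade p = [:coeff (grade p) 0:]"
    using assms unfolding total_degree_def by (metis degree_0_id)
  then have "grade p = monom p 0"
    by (metis monom_0 mult.right_neutral poly_grade poly_monom power_one)
  then have h: "homogeneous 0 p" by (simp add: homogeneous_iff_grade)
  have "Poly_Mapping.keys p \<subseteq> {0}"
  proof
    fix a assume "a \<in> Poly_Mapping.keys p"
    then have "\<forall>i\<in>Poly_Mapping.keys a. Poly_Mapping.lookup a i = 0"
      using h by (simp add: homogeneous_def)
    then have "a = 0" by (intro poly_mapping_eqI) (auto simp: in_keys_iff)
    then show "a \<in> {0}" by simp
  qed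
  then have "p = Const (Poly_Mapping.lookup p 0)"
    by (intro poly_mapping_eqI) (auto simp: Const_def lookup_single when_def in_keys_iff)
  then show ?thesis by blast
qed

lemma Const_dvd_1: "a \<noteq> 0 \<Longrightarrow> Const a dvd 1"
  by (metis Const_1 Const_mult dvdI right_inverse)

lemma cpoly_unit_iff: "p dvd 1 \<longleftrightarrow> p \<noteq> 0 \<and> total_degree p = 0" for p :: "nat cpoly"
proof
  assume "p dvd 1"
  then obtain q where q: "1 = p * q" by (auto elim: dvdE)
  then have nz: "p \<noteq> 0" "q \<noteq> 0" by auto
  have "total_degree 1 = 0"
    using total_degree_homogeneous[OF homogeneous_Const[of 1]] by simp
  then show "p \<noteq> 0 \<and> total_degree p = 0" using total_degree_mult[OF nz] q nz by simp
next
  assume "p \<noteq> 0 \<and> total_degree p = 0"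
  then show "p dvd 1" using total_degree_0_imp_Const[of p] Const_dvd_1 by auto
qed

text \<open>
  The degree in a variable that is absent from the product is zero, hence zero for the factors.
\<close>
lemma polys_in_factor:
  fixes p q :: "nat cpoly"
  assumes "p * q \<in> polys_in X" "p * q \<noteq> 0"
  shows "p \<in> polys_in X"
proof -
  have "p \<in> polys_in (- {n})" if "n \<notin> X" for n
  proof -
    have "univariate n p * univariate n q = [:p * q:]"
      using univariate_constant[OF assms(1) that] by (simp add: univariate_mult)
    then have "degree (univariate n p) = 0"
      by (metis assms(2) degree_mult_eq_0 degree_pCons_0 mult_eq_0_iff pCons_eq_0_iff)
    then have "univariate n p = [:coeff (univariate n p) 0:]" by (metis degree_0_id)
    then have "p = coeff (univariate n p) 0"
      using poly_univariate[of n p] by (metis add.right_neutral mult_zero_right poly_0 poly_pCons)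
    moreover have "coeff (univariate n p) 0 \<in> polys_in (- {n})"
      by (rule coeff_univariate_in) (auto simp: polys_in_def)
    ultimately show ?thesis by metis
  qed
  then show ?thesis by (auto simp: polys_in_def)
qed

section \<open>Irreducible polynomials are prime\<close>

lemma irreducible_factor_exists:
  fixes p :: "nat cpoly"
  assumes "p \<noteq> 0" "\<not> p dvd 1"
  obtains q r where "irreducible q" "p = q * r"
proof -
  have "\<exists>q. irreducible q \<and> q dvd p" using assms
  proof (induction "total_degree p" arbitrary: p rule: less_induct)
    case less
    show ?case
    proof (cases "irreducible p")
      case False
      then obtain a b where ab: "p = a * b" "\<not> a dvd 1" "\<not> b dvd 1"
        using less.prems by (auto simp: irreducible_def)
      then have nz: "a \<noteq> 0" "b \<noteq> 0" using less.prems by auto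
      have "total_degree b > 0" using ab(3) nz(2) cpoly_unit_iff[of b] by simp
      then have "total_degree a < total_degree p" using total_degree_mult[OF nz] ab by simp
      from less.hyps[OF this nz(1) ab(2)] show ?thesis using ab by auto
    qed auto
  qed
  then show ?thesis using that unfolding dvd_def by blast
qed

text \<open>
  Primality is tested only against polynomials in the first \<open>n\<close> variables, since this is what an
  induction on the number of variables can carry.
\<close>
definition prime_on :: "nat \<Rightarrow> nat cpoly \<Rightarrow> bool" where
  "prime_on n q \<longleftrightarrow> (\<forall>f\<in>polys_in {..<n}. \<forall>g\<in>polys_in {..<n}. q dvd f * g \<longrightarrow> q dvd f \<or> q dvd g)"

lemma coeff_univariate_in_lessThan:
  "p \<in> polys_in {..<Suc n} \<Longrightarrow> coeff (univariate n p) k \<in> polys_in {..<n}"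
  by (rule coeff_univariate_in) (simp add: lessThan_Suc)

lemma dvd_iff_dvd_coeffs:
  fixes \<pi> p :: "nat cpoly"
  assumes "\<pi> \<in> polys_in {..<n}"
  shows "\<pi> dvd p \<longleftrightarrow> (\<forall>k. \<pi> dvd coeff (univariate n p) k)"
proof -
  have c: "univariate n \<pi> = [:\<pi>:]" by (rule univariate_constant[OF assms]) simp
  have "\<pi> dvd p \<longleftrightarrow> [:\<pi>:] dvd univariate n p"
  proof
    assume "\<pi> dvd p"
    then show "[:\<pi>:] dvd univariate n p" using univariate_mult c by (metis dvd_def)
  next
    assume "[:\<pi>:] dvd univariate n p"
    then obtain Q where "univariate n p = [:\<pi>:] * Q" by (auto elim: dvdE)
    from arg_cong[OF this, of "\<lambda>P. poly P (Var n)"] show "\<pi> dvd p" by simp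
  qed
  then show ?thesis by (simp add: const_poly_dvd_iff)
qed

text \<open>
  If neither factor is divisible, take in each the first coefficient in \<open>x\<^sub>n\<close> that is not
  divisible: the product of these two is the only term of its coefficient in \<open>f * g\<close> that is not
  divisible.
\<close>
lemma prime_on_Suc:
  assumes "\<pi> \<in> polys_in {..<n}" "prime_on n \<pi>"
  shows "prime_on (Suc n) \<pi>"
  unfolding prime_on_def
proof (intro ballI impI, rule ccontr)
  fix f g assume fg: "f \<in> polys_in {..<Suc n}" "g \<in> polys_in {..<Suc n}" "\<pi> dvd f * g"
    and "\<not> (\<pi> dvd f \<or> \<pi> dvd g)"
  then have ex: "\<exists>i. \<not> \<pi> dvd coeff (univariate n f) i" "\<exists>j. \<not> \<pi> dvd coeff (univariate n g) j"
    using dvd_iff_dvd_coeffs[OF assms(1)] by blast+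
  define i where "i = (LEAST i. \<not> \<pi> dvd coeff (univariate n f) i)"
  define j where "j = (LEAST j. \<not> \<pi> dvd coeff (univariate n g) j)"
  have i: "\<not> \<pi> dvd coeff (univariate n f) i" "\<And>k. k < i \<Longrightarrow> \<pi> dvd coeff (univariate n f) k"
    unfolding i_def using LeastI_ex[OF ex(1)] not_less_Least by blast+
  have j: "\<not> \<pi> dvd coeff (univariate n g) j" "\<And>k. k < j \<Longrightarrow> \<pi> dvd coeff (univariate n g) k"
    unfolding j_def using LeastI_ex[OF ex(2)] not_less_Least by blast+
  let ?t = "\<lambda>k. coeff (univariate n f) k * coeff (univariate n g) (i + j - k)"
  have "\<pi> dvd (\<Sum>k\<le>i+j. ?t k)"
    using iffD1[OF dvd_iff_dvd_coeffs[OF assms(1)] fg(3)] unfolding univariate_mult coeff_mult by blast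
  also have "(\<Sum>k\<le>i+j. ?t k) = ?t i + (\<Sum>k\<in>{..i+j}-{i}. ?t k)"
    by (rule sum.remove) auto
  finally have "\<pi> dvd ?t i + (\<Sum>k\<in>{..i+j}-{i}. ?t k)" .
  moreover have "\<pi> dvd (\<Sum>k\<in>{..i+j}-{i}. ?t k)"
  proof (rule dvd_sum)
    fix k assume "k \<in> {..i+j} - {i}"
    then have "k < i \<or> i + j - k < j" by auto
    then show "\<pi> dvd ?t k" using i(2) j(2) by auto
  qed
  ultimately have "\<pi> dvd ?t i" using dvd_add_left_iff by blast
  then show False
    using assms(2) i(1) j(1) fg(1,2)[THEN coeff_univariate_in_lessThan] unfolding prime_on_def by auto
qed

lemma dvd_mult_unitD:
  fixes d :: "'a::comm_ring_1"
  assumes "d dvd 1" "q dvd d * f"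
  shows "q dvd f"
proof -
  obtain e where "1 = d * e" using assms(1) by (auto elim: dvdE)
  then have "e * (d * f) = f" by (simp add: mult.commute mult.left_commute flip: mult.assoc)
  then show ?thesis using dvd_mult[OF assms(2), of e] by simp
qed

text \<open>
  Gauss's lemma without fraction fields.  If \<open>q\<close> involves \<open>x\<^sub>n\<close> and divides \<open>f * g\<close>, let \<open>r\<close> have
  least degree in \<open>x\<^sub>n\<close> among the nonzero combinations of \<open>q\<close> and \<open>f\<close>.  By pseudo-division \<open>r\<close>
  divides \<open>q\<close> and \<open>f\<close> up to nonzero factors free of \<open>x\<^sub>n\<close>, and such factors can be removed because
  their irreducible factors are prime and do not divide \<open>q\<close>.  Since \<open>q\<close> is irreducible,
  either \<open>q\<close> divides \<open>r\<close> and hence \<open>f\<close>, or \<open>r\<close> is itself free of \<open>x\<^sub>n\<close>, and then \<open>q\<close> divides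
  \<open>r * g\<close> and hence \<open>g\<close>.
\<close>
lemma irreducible_imp_prime_on_Suc:
  assumes IH: "\<And>\<pi>. \<pi> \<in> polys_in {..<n} \<Longrightarrow> irreducible \<pi> \<Longrightarrow> prime_on n \<pi>"
    and q: "q \<in> polys_in {..<Suc n}" "irreducible q"
  shows "prime_on (Suc n) q"
proof (cases "degree (univariate n q) = 0")
  case True
  then have "univariate n q = [:coeff (univariate n q) 0:]" by (metis degree_0_id)
  then have "q = coeff (univariate n q) 0"
    using poly_univariate[of n q] by (metis add.right_neutral mult_zero_right poly_0 poly_pCons)
  then have "q \<in> polys_in {..<n}" using coeff_univariate_in_lessThan[OF q(1), of 0] by simp
  then show ?thesis using IH q(2) prime_on_Suc by blast
next
  case False
  let ?R = "polys_in {..<n} :: nat cpoly set" and ?S = "polys_in {..<Suc n} :: nat cpoly set"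
  have RS: "?R \<subseteq> ?S" using polys_in_mono by fastforce
  have q0: "q \<noteq> 0" using q(2) by auto
  have degR: "degree (univariate n d) = 0" if "d \<in> ?R" for d
    using univariate_constant[OF that] by simp
  have not_dvd: "\<not> q dvd d" if "d \<in> ?R" "d \<noteq> 0" for d
  proof
    assume "q dvd d"
    then obtain e where e: "d = q * e" by (auto elim: dvdE)
    then have "q \<in> ?R" using polys_in_factor[of q e] that by simp
    then show False using degR[of q] False by simp
  qed
  have prime_S: "\<pi> dvd f \<or> \<pi> dvd g"
    if "\<pi> \<in> ?R" "irreducible \<pi>" "f \<in> ?S" "g \<in> ?S" "\<pi> dvd f * g" for \<pi> f g
    using prime_on_Suc[OF that(1) IH[OF that(1,2)]] that(3,4,5) unfolding prime_on_def by blast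
  \<comment> \<open>A nonzero factor from the smaller ring can be cancelled, one prime at a time.\<close>
  have cancel: "q dvd f" if "d \<in> ?R" "d \<noteq> 0" "f \<in> ?S" "q dvd d * f" for d f
    using that
  proof (induction "total_degree d" arbitrary: d rule: less_induct)
    case less
    show ?case
    proof (cases "d dvd 1")
      case True
      then show ?thesis using less.prems(4) by (rule dvd_mult_unitD)
    next
      case False
      obtain \<pi> d' where \<pi>: "irreducible \<pi>" "d = \<pi> * d'"
        using irreducible_factor_exists[OF less.prems(2) False] .
      have nz: "\<pi> \<noteq> 0" "d' \<noteq> 0" using \<pi> less.prems(2) by auto
      have R: "\<pi> \<in> ?R" "d' \<in> ?R"
        using polys_in_factor[of \<pi> d'] polys_in_factor[of d' \<pi>] \<pi> less.prems by (auto simp: mult.commute)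
      show ?thesis
      proof (cases "f = 0")
        case False
        obtain h where h: "d * f = q * h" using less.prems(4) by (auto elim: dvdE)
        have "d * f \<in> ?S" using less.prems RS by auto
        then have hS: "h \<in> ?S" using polys_in_factor[of h q] h less.prems False by (metis mult.commute mult_eq_0_iff)
        have "\<pi> dvd q * h" using h \<pi> by (metis dvd_mult2 dvd_triv_left)
        then have "\<pi> dvd q \<or> \<pi> dvd h" using prime_S[OF R(1) \<pi>(1) q(1) hS] by blast
        moreover have "\<not> \<pi> dvd q"
        proof
          assume "\<pi> dvd q"
          then obtain s where s: "q = \<pi> * s" by (auto elim: dvdE)
          then have "s dvd 1" using q(2) \<pi>(1) by (auto simp: irreducible_def)
          moreover have "q dvd s * \<pi>" using s by (simp add: mult.commute)
          ultimately have "q dvd \<pi>" by (rule dvd_mult_unitD)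
          then show False using not_dvd[OF R(1) nz(1)] by blast
        qed
        ultimately obtain h' where "h = \<pi> * h'" by (auto elim: dvdE)
        then have "\<pi> * (d' * f) = \<pi> * (q * h')" using h \<pi> by (simp add: mult_ac)
        then have "d' * f = q * h'" using nz by simp
        then have "q dvd d' * f" by simp
        moreover have "total_degree d' < total_degree d"
          using total_degree_mult[OF nz] \<pi> cpoly_unit_iff[of \<pi>] nz by (auto simp: irreducible_def)
        ultimately show ?thesis using less.hyps R nz less.prems(3) by blast
      qed simp
    qed
  qed
  \<comment> \<open>The same cancellation, keeping track of which factor absorbs each prime.\<close>
  have split: "q dvd r \<or> q dvd s"
    if "d \<in> ?R" "d \<noteq> 0" "r \<in> ?S" "s \<in> ?S" "d * q = r * s" for d r s
    using that
  proof (induction "total_degree d" arbitrary: d r s rule: less_induct)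
    case less
    show ?case
    proof (cases "d dvd 1")
      case True
      then obtain e where e: "1 = d * e" by (auto elim: dvdE)
      have q_eq: "q = (e * r) * s"
      proof -
        have "q = e * (d * q)" using e by (simp add: mult.left_commute flip: mult.assoc)
        then show ?thesis using less.prems(5) by (simp add: mult.assoc)
      qed
      then have "e * r dvd 1 \<or> s dvd 1" using q(2) by (auto simp: irreducible_def)
      moreover have "q dvd s" if "e * r dvd 1"
      proof (rule dvd_mult_unitD[OF that])
        show "q dvd e * r * s" unfolding q_eq[symmetric] by simp
      qed
      moreover have "q dvd r" if "s dvd 1"
      proof -
        have "q dvd s * (e * r)" unfolding mult.commute[of s] q_eq[symmetric] by simp
        then have "q dvd e * r" by (rule dvd_mult_unitD[OF that])
        then have "q dvd d * (e * r)" by (rule dvd_mult)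
        moreover have "d * (e * r) = r" using e by (simp flip: mult.assoc)
        ultimately show ?thesis by simp
      qed
      ultimately show ?thesis by blast
    next
      case False
      obtain \<pi> d' where \<pi>: "irreducible \<pi>" "d = \<pi> * d'"
        using irreducible_factor_exists[OF less.prems(2) False] .
      have nz: "\<pi> \<noteq> 0" "d' \<noteq> 0" using \<pi> less.prems(2) by auto
      have R: "\<pi> \<in> ?R" "d' \<in> ?R"
        using polys_in_factor[of \<pi> d'] polys_in_factor[of d' \<pi>] \<pi> less.prems by (auto simp: mult.commute)
      have deg: "total_degree d' < total_degree d"
        using total_degree_mult[OF nz] \<pi> cpoly_unit_iff[of \<pi>] nz by (auto simp: irreducible_def)
      have rs0: "r * s \<noteq> 0" using less.prems(5) less.prems(2) q0 by (metis mult_eq_0_iff)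
      have "\<pi> dvd r * s" using less.prems(5) \<pi> by (metis dvd_mult2 dvd_triv_left)
      then consider "\<pi> dvd r" | "\<pi> dvd s" using prime_S[OF R(1) \<pi>(1)] less.prems by blast
      then show ?thesis
      proof cases
        case 1
        then obtain r' where r': "r = \<pi> * r'" by (auto elim: dvdE)
        then have "r' \<in> ?S" using polys_in_factor[of r' \<pi>] less.prems rs0 by (simp add: mult.commute)
        moreover have "d' * q = r' * s" using less.prems(5) r' \<pi> nz by (simp add: mult.assoc)
        ultimately have "q dvd r' \<or> q dvd s" using less.hyps deg R nz less.prems by blast
        then show ?thesis using r' by auto
      next
        case 2
        then obtain s' where s': "s = \<pi> * s'" by (auto elim: dvdE)
        then have "s' \<in> ?S" using polys_in_factor[of s' \<pi>] less.prems rs0 by (simp add: mult.commute)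
        moreover have "d' * q = r * s'" using less.prems(5) s' \<pi> nz by (simp add: mult.left_commute)
        ultimately have "q dvd r \<or> q dvd s'" using less.hyps deg R nz less.prems by blast
        then show ?thesis using s' by auto
      qed
    qed
  qed
  show ?thesis
    unfolding prime_on_def
  proof (intro ballI impI)
    fix f g assume fg: "f \<in> ?S" "g \<in> ?S" "q dvd f * g"
    \<comment> \<open>The ideal generated by \<open>q\<close> and \<open>f\<close>.\<close>
    define J where "J = {a * q + b * f | a b. a \<in> ?S \<and> b \<in> ?S}"
    let ?deg = "\<lambda>p. degree (univariate n p)" and ?lc = "\<lambda>p. lead_coeff (univariate n p)"
    have qJ: "q \<in> J" unfolding J_def by (rule CollectI, rule exI[of _ 1], rule exI[of _ 0]) simp
    have fJ: "f \<in> J" unfolding J_def by (rule CollectI, rule exI[of _ 0], rule exI[of _ 1]) simp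
    have JS: "J \<subseteq> ?S" unfolding J_def using q(1) fg(1) by auto
    have J_comb: "a * x - b * y \<in> J" if xy: "x \<in> J" "y \<in> J" and ab: "a \<in> ?S" "b \<in> ?S" for a b x y
    proof -
      obtain a1 b1 a2 b2 where *: "x = a1 * q + b1 * f" "y = a2 * q + b2 * f"
        "a1 \<in> ?S" "b1 \<in> ?S" "a2 \<in> ?S" "b2 \<in> ?S" using xy unfolding J_def by blast
      have "a * x - b * y = (a * a1 - b * a2) * q + (a * b1 - b * b2) * f"
        by (simp add: * algebra_simps)
      moreover have "a * a1 - b * a2 \<in> ?S" "a * b1 - b * b2 \<in> ?S" using * ab by auto
      ultimately show ?thesis unfolding J_def by blast
    qed
    obtain r where r: "r \<in> J" "r \<noteq> 0" "\<And>p. p \<in> J \<Longrightarrow> p \<noteq> 0 \<Longrightarrow> ?deg r \<le> ?deg p"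
      using ex_has_least_nat[of "\<lambda>p. p \<in> J \<and> p \<noteq> 0" q ?deg] qJ q0 by blast
    have rS: "r \<in> ?S" using r JS by blast
    have lcR: "?lc p \<in> ?R" if "p \<in> J" for p using that JS by (blast intro: coeff_univariate_in_lessThan)
    \<comment> \<open>Pseudo-division by an element of least degree.\<close>
    have div: "\<exists>d\<in>?R. d \<noteq> 0 \<and> r dvd d * p" if "p \<in> J" for p
      using that
    proof (induction "?deg p" arbitrary: p rule: less_induct)
      case less
      show ?case
      proof (cases "p = 0")
        case True
        show ?thesis by (rule bexI[of _ 1]) (use True in auto)
      next
        case p0: False
        define k where "k = ?deg p - ?deg r"
        define p1 where "p1 = ?lc r * p - (?lc p * Var n ^ k) * r"
        have le: "?deg r \<le> ?deg p" using r(3) less.prems p0 by blast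
        have p1J: "p1 \<in> J"
          unfolding p1_def by (rule J_comb[OF less.prems r(1)])
            (use lcR[OF r(1)] lcR[OF less.prems] RS in auto)
        have uV: "univariate n (Var n) = [:0, 1:]"
          by (simp add: univariate_def subst_Var[OF is_ring_hom_pCons_Const])
        have uc: "univariate n d = [:d:]" if "d \<in> ?R" for d
          by (rule univariate_constant[OF that]) simp
        have u: "univariate n p1 = smult (?lc r) (univariate n p) - smult (?lc p) (monom 1 k * univariate n r)"
          unfolding p1_def
          by (simp add: is_ring_hom_diff[OF is_ring_hom_univariate] univariate_mult uc lcR[OF r(1)] lcR[OF less.prems]
              is_ring_hom_power[OF is_ring_hom_univariate] uV monom_altdef)
        have deg_le: "?deg p1 \<le> ?deg p"
          unfolding u
        proof (intro degree_diff_le order.trans[OF degree_smult_le])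
          have "degree (monom 1 k * univariate n r) \<le> k + ?deg r"
            using degree_mult_le[of "monom 1 k" "univariate n r"] degree_monom_le[of "1::nat cpoly" k] by linarith
          then show "degree (monom 1 k * univariate n r) \<le> ?deg p" using le k_def by simp
        qed simp
        have "coeff (univariate n p1) (?deg p) = 0"
          unfolding u using le by (simp add: k_def coeff_monom_mult)
        then have "p1 = 0 \<or> ?deg p1 < ?deg p"
          using deg_le by (metis le_neq_implies_less leading_coeff_0_iff univariate_eq_0_iff)
        then obtain d where d: "d \<in> ?R" "d \<noteq> 0" "r dvd d * p1"
          using less.hyps[of p1] p1J by (metis dvd_0_right mult_zero_right polys_in_1 zero_neq_one)
        have "d * ?lc r * p = d * p1 + r * (d * ?lc p * Var n ^ k)"
          by (simp add: p1_def algebra_simps)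
        then have "r dvd (d * ?lc r) * p" using d(3) by simp
        moreover have "d * ?lc r \<noteq> 0" using d r(2) by simp
        moreover have "d * ?lc r \<in> ?R" using d lcR[OF r(1)] by simp
        ultimately show ?thesis by blast
      qed
    qed
    obtain d where d: "d \<in> ?R" "d \<noteq> 0" "r dvd d * q" using div[OF qJ] by blast
    then obtain s where s: "d * q = r * s" by (auto elim: dvdE)
    have "d * q \<in> ?S" "d * q \<noteq> 0" using d q RS q0 by auto
    then have sS: "s \<in> ?S" "s \<noteq> 0" using polys_in_factor[of s r] s by (auto simp: mult.commute)
    from split[OF d(1,2) rS sS(1) s] show "q dvd f \<or> q dvd g"
    proof
      assume "q dvd r"
      moreover obtain e where e: "e \<in> ?R" "e \<noteq> 0" "r dvd e * f" using div[OF fJ] by blast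
      ultimately have "q dvd e * f" using dvd_trans by blast
      then show ?thesis using cancel e fg(1) by blast
    next
      assume "q dvd s"
      then obtain s' where s': "s = q * s'" by (auto elim: dvdE)
      then have "d = r * s'" using s q0 by (simp add: mult.left_commute mult.commute)
      then have rR: "r \<in> ?R" using polys_in_factor[of r s'] d by simp
      obtain a b where "r = a * q + b * f" using r(1) unfolding J_def by blast
      then have "r * g = q * (a * g) + b * (f * g)" by (simp add: algebra_simps)
      then have "q dvd r * g" using fg(3) by simp
      then show ?thesis using cancel[OF rR r(2) fg(2)] by blast
    qed
  qed
qed

lemma irreducible_imp_prime_elem_cpoly:
  fixes q :: "nat cpoly"
  assumes "irreducible q"
  shows "prime_elem q"
proof -
  have *: "prime_on n q" if "q \<in> polys_in {..<n}" "irreducible q" for n q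
    using that
  proof (induction n arbitrary: q)
    case 0
    then obtain a where "q = Const a"
    proof -
      have "Poly_Mapping.keys q \<subseteq> {0}" using 0(1) by (auto simp: polys_in_def)
      then have "q = Const (Poly_Mapping.lookup q 0)"
        by (intro poly_mapping_eqI) (auto simp: Const_def lookup_single when_def in_keys_iff)
      then show ?thesis using that by blast
    qed
    then show ?case using 0(2) Const_dvd_1 by (auto simp: irreducible_def)
  next
    case (Suc n)
    then show ?case using irreducible_imp_prime_on_Suc by blast
  qed
  show ?thesis
  proof (rule prime_elemI)
    fix f g assume fg: "q dvd f * g"
    obtain n1 n2 n3 where "q \<in> polys_in {..<n1}" "f \<in> polys_in {..<n2}" "g \<in> polys_in {..<n3}"
      using polys_in_finite by metis
    then have "q \<in> polys_in {..<n1+n2+n3}" "f \<in> polys_in {..<n1+n2+n3}" "g \<in> polys_in {..<n1+n2+n3}"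
      by (auto elim!: polys_in_mono)
    then show "q dvd f \<or> q dvd g" using * assms fg unfolding prime_on_def by blast
  qed (use assms in \<open>auto simp: irreducible_def\<close>)
qed

section \<open>Orders along prime divisors\<close>

text \<open>
  The relation behind \<open>order_along\<close>.  It is additive under products, and for prime \<open>q\<close> it
  determines \<open>k\<close>, so orders can be computed factor by factor.
\<close>
definition has_order :: "nat cpoly \<Rightarrow> ratfun \<Rightarrow> int \<Rightarrow> bool" where
  "has_order q f k \<longleftrightarrow> (\<exists>P Q. \<not> q dvd P \<and> \<not> q dvd Q \<and> f = Fract q 1 powi k * Fract P Q)"

lemma Fract_eq_0_iff: "Q \<noteq> 0 \<Longrightarrow> Fract P Q = 0 \<longleftrightarrow> P = 0" for P Q :: "'a::idom"
  by (simp add: Zero_fract_def eq_fract)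

lemma Fract_1_eq_0_iff [simp]: "Fract P 1 = 0 \<longleftrightarrow> P = 0" for P :: "'a::idom"
  by (simp add: Fract_eq_0_iff)

lemma Fract_1_inject [simp]: "Fract P 1 = Fract Q 1 \<longleftrightarrow> P = Q" for P Q :: "'a::idom"
  by (simp add: eq_fract)

lemma Fract_1_power: "Fract P 1 ^ n = Fract (P ^ n) 1" for P :: "'a::idom"
  by (induction n) (simp_all add: One_fract_def)

lemma Fract_1_mult: "Fract (P * Q) 1 = Fract P 1 * Fract Q 1" for P Q :: "'a::idom"
  by simp

lemma Fract_1_prod: "(\<Prod>i\<in>I. Fract (f i) 1) = Fract (\<Prod>i\<in>I. f i) 1" for f :: "'b \<Rightarrow> 'a::idom"
  by (induction I rule: infinite_finite_induct) (simp_all add: One_fract_def)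

lemma is_ring_hom_Fract_1: "is_ring_hom (\<lambda>P. Fract P 1)"
  by (simp add: is_ring_hom_def One_fract_def)

lemma Fract_conv_divide: "Q \<noteq> 0 \<Longrightarrow> Fract P Q = Fract P 1 * inverse (Fract Q 1)" for P Q :: "'a::idom"
  by simp

lemma has_order_unique_aux:
  assumes q: "prime_elem q" and "has_order q f k" "has_order q f l"
  shows "k \<le> l"
proof (rule ccontr)
  assume "\<not> k \<le> l"
  define n where "n = nat (k - l)"
  have n: "k = l + int n" "n > 0" using \<open>\<not> k \<le> l\<close> by (auto simp: n_def)
  have q0: "q \<noteq> 0" using q by auto
  obtain P Q where 1: "\<not> q dvd P" "\<not> q dvd Q" "f = Fract q 1 powi k * Fract P Q"
    using assms(2) unfolding has_order_def by blast
  obtain P' Q' where 2: "\<not> q dvd P'" "\<not> q dvd Q'" "f = Fract q 1 powi l * Fract P' Q'"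
    using assms(3) unfolding has_order_def by blast
  have nz: "Q \<noteq> 0" "Q' \<noteq> 0" using 1 2 by auto
  have "Fract q 1 powi l * (Fract q 1 ^ n * Fract P Q) = Fract q 1 powi l * Fract P' Q'"
    using 1(3) 2(3) q0 by (simp add: n(1) power_int_add mult.assoc)
  then have "Fract q 1 ^ n * Fract P Q = Fract P' Q'" using q0 by simp
  then have "q ^ n * P * Q' = P' * Q"
    using nz by (simp add: Fract_1_power eq_fract)
  moreover have "q dvd q ^ n * P * Q'" using n(2) by (simp add: dvd_power dvd_mult2)
  ultimately have "q dvd P' * Q" by simp
  then show False using q 1 2 prime_elem_dvd_multD by blast
qed

lemma has_order_unique: "prime_elem q \<Longrightarrow> has_order q f k \<Longrightarrow> has_order q f l \<Longrightarrow> k = l"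
  by (meson has_order_unique_aux order.antisym)

lemma order_along_eq: "prime_elem q \<Longrightarrow> has_order q f k \<Longrightarrow> order_along q f = k"
  unfolding order_along_def has_order_def[symmetric]
  by (rule the_equality) (auto dest: has_order_unique)

lemma has_order_mult:
  assumes "prime_elem q" "has_order q f k" "has_order q g l"
  shows "has_order q (f * g) (k + l)"
proof -
  have q0: "q \<noteq> 0" using assms by auto
  obtain P Q where 1: "\<not> q dvd P" "\<not> q dvd Q" "f = Fract q 1 powi k * Fract P Q"
    using assms(2) unfolding has_order_def by blast
  obtain P' Q' where 2: "\<not> q dvd P'" "\<not> q dvd Q'" "g = Fract q 1 powi l * Fract P' Q'"
    using assms(3) unfolding has_order_def by blast
  have "f * g = (Fract q 1 powi k * Fract q 1 powi l) * (Fract P Q * Fract P' Q')"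
    unfolding 1(3) 2(3) by (simp only: mult_ac)
  also have "\<dots> = Fract q 1 powi (k + l) * Fract (P * P') (Q * Q')"
    using q0 by (simp add: power_int_add)
  finally show ?thesis
    using 1 2 prime_elem_dvd_multD[OF assms(1)] unfolding has_order_def by blast
qed

lemma has_order_inverse:
  assumes "has_order q f k"
  shows "has_order q (inverse f) (- k)"
proof -
  obtain P Q where 1: "\<not> q dvd P" "\<not> q dvd Q" "f = Fract q 1 powi k * Fract P Q"
    using assms unfolding has_order_def by blast
  have "inverse f = Fract q 1 powi (- k) * Fract Q P"
    unfolding 1(3) by (simp add: power_int_minus)
  then show ?thesis using 1 unfolding has_order_def by blast
qed

lemma has_order_Fract_0: "\<not> q dvd P \<Longrightarrow> \<not> q dvd Q \<Longrightarrow> has_order q (Fract P Q) 0"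
  unfolding has_order_def by auto

lemma has_order_1: "prime_elem q \<Longrightarrow> has_order q 1 0"
  using has_order_Fract_0[of q 1 1] by (simp add: One_fract_def prime_elem_def)

lemma has_order_power: "prime_elem q \<Longrightarrow> has_order q f k \<Longrightarrow> has_order q (f ^ n) (int n * k)"
proof (induction n)
  case (Suc n)
  then have "has_order q (f * f ^ n) (k + int n * k)" by (intro has_order_mult) auto
  then show ?case by (simp add: algebra_simps)
qed (simp add: has_order_1)

lemma has_order_powi:
  assumes "prime_elem q" "has_order q f k"
  shows "has_order q (f powi n) (n * k)"
proof (cases "n \<ge> 0")
  case True
  then show ?thesis using has_order_power[OF assms, of "nat n"] by (simp add: power_int_def)
next
  case False
  then show ?thesis
    using has_order_power[OF assms(1) has_order_inverse[OF assms(2)], of "nat (- n)"]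
    by (simp add: power_int_def)
qed

lemma has_order_prod:
  assumes "prime_elem q" "\<And>i. i \<in> I \<Longrightarrow> has_order q (f i) (k i)"
  shows "has_order q (\<Prod>i\<in>I. f i) (\<Sum>i\<in>I. k i)"
  using assms(2)
  by (induction I rule: infinite_finite_induct) (auto intro: has_order_mult has_order_1 assms(1))

lemma associated_of_irreducible_dvd:
  fixes q l :: "nat cpoly"
  assumes "irreducible q" "irreducible l" "q dvd l"
  obtains s where "l = q * s" "s dvd 1" "l dvd q"
proof -
  obtain s where s: "l = q * s" using assms(3) by (auto elim: dvdE)
  then have u: "s dvd 1" using assms(1,2) by (auto simp: irreducible_def)
  have "l dvd s * q" using s by (simp add: mult.commute)
  then show ?thesis using that s u dvd_mult_unitD by blast
qed

lemma has_order_irreducible: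
  fixes q l :: "nat cpoly"
  assumes "irreducible q" "irreducible l"
  shows "has_order q (Fract l 1) (if q dvd l \<and> l dvd q then 1 else 0)"
proof (cases "q dvd l")
  case True
  obtain s where s: "l = q * s" "s dvd 1" "l dvd q"
    using associated_of_irreducible_dvd[OF assms True] .
  have "\<not> q dvd s" "\<not> q dvd 1" using s(2) assms(1) dvd_trans by (auto simp: irreducible_def)
  moreover have "Fract l 1 = Fract q 1 powi 1 * Fract s 1" using s(1) by simp
  ultimately show ?thesis using True s(3) unfolding has_order_def by auto
next
  case False
  then show ?thesis using has_order_Fract_0[OF False, of 1] assms(1) by (auto simp: irreducible_def)
qed

text \<open>
  The two equations of the same divisor differ by a unit, and a unit has order zero.
\<close>
lemma has_order_associated:
  assumes "irreducible q" "irreducible l" "q dvd l" "l dvd q" "has_order l f k"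
  shows "has_order q f k"
proof -
  have q: "prime_elem q" by (rule irreducible_imp_prime_elem_cpoly[OF assms(1)])
  obtain P Q where 1: "\<not> l dvd P" "\<not> l dvd Q" "f = Fract l 1 powi k * Fract P Q"
    using assms(5) unfolding has_order_def by blast
  have "has_order q (Fract l 1) 1"
    using has_order_irreducible[OF assms(1,2)] assms(3,4) by simp
  from has_order_powi[OF q this, of k] have "has_order q (Fract l 1 powi k) k" by simp
  moreover have "has_order q (Fract P Q) 0"
    using 1 assms(4) dvd_trans by (blast intro: has_order_Fract_0)
  ultimately show ?thesis unfolding 1(3) using has_order_mult[OF q] by fastforce
qed

lemma has_order_exists_poly:
  assumes "irreducible q" "P \<noteq> 0"
  obtains k where "has_order q (Fract P 1) (int k)" "q dvd P \<Longrightarrow> k > 0"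
proof -
  have q: "q \<noteq> 0" "\<not> q dvd 1" using assms(1) by (auto simp: irreducible_def)
  have "\<exists>k P'. P = q ^ k * P' \<and> \<not> q dvd P'" using assms(2)
  proof (induction "total_degree P" arbitrary: P rule: less_induct)
    case less
    show ?case
    proof (cases "q dvd P")
      case True
      then obtain R where R: "P = q * R" by (auto elim: dvdE)
      then have R0: "R \<noteq> 0" using less.prems by auto
      have "total_degree R < total_degree P"
        using total_degree_mult[OF q(1) R0] q cpoly_unit_iff[of q] by (simp add: R)
      from less.hyps[OF this R0] obtain k P' where "R = q ^ k * P'" "\<not> q dvd P'" by blast
      then have "P = q ^ Suc k * P' \<and> \<not> q dvd P'" using R by (simp add: mult.assoc)
      then show ?thesis by blast
    next
      case False
      then have "P = q ^ 0 * P \<and> \<not> q dvd P" by simp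
      then show ?thesis by blast
    qed
  qed
  then obtain k P' where k: "P = q ^ k * P'" "\<not> q dvd P'" by blast
  then have "has_order q (Fract P 1) (int k)"
    unfolding has_order_def using q(2) by (intro exI[of _ P'] exI[of _ 1]) (simp add: Fract_1_power)
  moreover have "k > 0" if "q dvd P" using k that by (cases k) auto
  ultimately show ?thesis using that by blast
qed

lemma has_order_exists:
  assumes "irreducible q" "f \<noteq> 0"
  obtains k where "has_order q f k"
proof -
  have q: "prime_elem q" by (rule irreducible_imp_prime_elem_cpoly[OF assms(1)])
  obtain P Q where f: "f = Fract P Q" "Q \<noteq> 0" by (cases f)
  then have "P \<noteq> 0" using assms(2) by (auto simp: Fract_eq_0_iff)
  obtain k where k: "has_order q (Fract P 1) (int k)"
    using has_order_exists_poly[OF assms(1) \<open>P \<noteq> 0\<close>] by blast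
  obtain l where l: "has_order q (Fract Q 1) (int l)"
    using has_order_exists_poly[OF assms(1) f(2)] by blast
  show ?thesis
    using has_order_mult[OF q k has_order_inverse[OF l]] f that Fract_conv_divide[OF f(2)] by metis
qed

section \<open>Global sections\<close>

lemma linear_form_homogeneous: "linear_form c f \<Longrightarrow> homogeneous 1 f"
  unfolding linear_form_def
  using homogeneous_mult[OF homogeneous_Const homogeneous_Var]
  by (auto intro!: homogeneous_sum)

lemma linear_form_polys_in: "linear_form c f \<Longrightarrow> f \<in> polys_in {..c}"
  unfolding linear_form_def by (auto intro!: polys_in_sum polys_in_mult)

lemma linear_form_irreducible:
  assumes "linear_form c f" "f \<noteq> 0"
  shows "irreducible f"
proof -
  have d: "total_degree f = 1"
    by (rule total_degree_homogeneous[OF linear_form_homogeneous[OF assms(1)] assms(2)])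
  show ?thesis
  proof (rule irreducibleI)
    show "\<not> f dvd 1" using d cpoly_unit_iff by simp
    fix a b assume ab: "f = a * b"
    then have nz: "a \<noteq> 0" "b \<noteq> 0" using assms(2) by auto
    then have "total_degree a + total_degree b = 1" using ab d total_degree_mult by metis
    then show "a dvd 1 \<or> b dvd 1" using nz cpoly_unit_iff[of a] cpoly_unit_iff[of b] by auto
  qed (rule assms(2))
qed

text \<open>
  For exponents that sum to zero this is a rational function on projective space.
\<close>
definition section_monomial :: "('i::finite \<Rightarrow> nat cpoly) \<Rightarrow> ('i \<Rightarrow> int) \<Rightarrow> ratfun" where
  "section_monomial ell h = (\<Prod>i\<in>UNIV. Fract (ell i) 1 powi h i)"

lemma section_monomial_add:
  assumes "\<And>i. ell i \<noteq> 0"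
  shows "section_monomial ell (\<lambda>i. h i + k i) = section_monomial ell h * section_monomial ell k"
  unfolding section_monomial_def prod.distrib[symmetric]
  by (intro prod.cong refl power_int_add) (use assms in simp)

lemma section_monomial_0 [simp]: "section_monomial ell (\<lambda>i. 0) = 1"
  by (simp add: section_monomial_def)

lemma section_monomial_int:
  "section_monomial ell (\<lambda>i. int (n i)) = Fract (\<Prod>i\<in>UNIV. ell i ^ n i) 1"
  by (simp add: section_monomial_def Fract_1_power Fract_1_prod)

lemma section_monomial_nonzero:
  assumes "\<And>i. ell i \<noteq> 0"
  shows "section_monomial ell h \<noteq> 0"
  unfolding section_monomial_def using assms by (auto simp: prod_zero_iff)

lemma section_monomial_Fract:
  assumes nz: "\<And>i. ell i \<noteq> 0"
  shows "section_monomial ell h =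
     Fract (\<Prod>i\<in>UNIV. ell i ^ nat (h i)) (\<Prod>i\<in>UNIV. ell i ^ nat (- h i))"
proof -
  have "section_monomial ell h * section_monomial ell (\<lambda>i. int (nat (- h i)))
      = section_monomial ell (\<lambda>i. int (nat (h i)))"
    unfolding section_monomial_add[of ell, OF nz, symmetric]
    by (intro arg_cong[of _ _ "section_monomial ell"] ext) auto
  then have eq: "section_monomial ell h * Fract (\<Prod>i\<in>UNIV. ell i ^ nat (- h i)) 1
      = Fract (\<Prod>i\<in>UNIV. ell i ^ nat (h i)) 1"
    unfolding section_monomial_int .
  have Q0: "(\<Prod>i\<in>UNIV. ell i ^ nat (- h i)) \<noteq> 0" using nz by (auto simp: prod_zero_iff)
  then have "Fract (\<Prod>i\<in>UNIV. ell i ^ nat (- h i)) 1 \<noteq> 0" by simp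
  from iffD2[OF nonzero_eq_divide_eq[OF this] eq] show ?thesis
    unfolding Fract_conv_divide[OF Q0] divide_inverse .
qed

lemma has_order_section_monomial:
  assumes "irreducible q" "\<And>i. irreducible (ell i)"
  shows "has_order q (section_monomial ell h) (\<Sum>i | q dvd ell i \<and> ell i dvd q. h i)"
proof -
  have q: "prime_elem q" by (rule irreducible_imp_prime_elem_cpoly[OF assms(1)])
  have "has_order q (section_monomial ell h)
      (\<Sum>i\<in>UNIV. h i * (if q dvd ell i \<and> ell i dvd q then 1 else 0))"
    unfolding section_monomial_def
    by (intro has_order_prod has_order_powi q has_order_irreducible assms)
  also have "(\<Sum>i\<in>UNIV. h i * (if q dvd ell i \<and> ell i dvd q then 1 else 0))
      = (\<Sum>i | q dvd ell i \<and> ell i dvd q. h i)"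
    by (simp add: sum.If_cases if_distrib[of "(*) _"] cong: if_cong)
  finally show ?thesis .
qed

lemma section_monomial_in_global_sections:
  assumes lin: "\<And>i. linear_form c (ell i)" and nz: "\<And>i. ell i \<noteq> 0"
    and sum0: "(\<Sum>i\<in>UNIV. h i) = 0" and le: "\<And>i. - ereal (of_int (h i)) \<le> a i"
  shows "section_monomial ell h \<in> global_sections c ell a"
proof -
  have irr: "irreducible (ell i)" for i by (rule linear_form_irreducible[OF lin nz])
  let ?P = "\<Prod>i\<in>UNIV. ell i ^ nat (h i)" and ?Q = "\<Prod>i\<in>UNIV. ell i ^ nat (- h i)"
  have hom: "homogeneous (\<Sum>i\<in>UNIV. 1 * n i) (\<Prod>i\<in>UNIV. ell i ^ n i)" for n
    by (intro homogeneous_prod homogeneous_power linear_form_homogeneous[OF lin])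
  have "int (\<Sum>i\<in>UNIV. nat (h i)) - int (\<Sum>i\<in>UNIV. nat (- h i)) = (\<Sum>i\<in>UNIV. h i)"
    by (simp flip: sum_subtractf) (rule sum.cong, auto)
  then have "(\<Sum>i\<in>UNIV. nat (h i)) = (\<Sum>i\<in>UNIV. nat (- h i))" using sum0 by linarith
  then have "homogeneous (\<Sum>i\<in>UNIV. nat (h i)) ?P" "homogeneous (\<Sum>i\<in>UNIV. nat (h i)) ?Q"
    using hom[of "\<lambda>i. nat (h i)"] hom[of "\<lambda>i. nat (- h i)"] by simp_all
  moreover have "?P \<in> polys_in {..c}" "?Q \<in> polys_in {..c}"
    using linear_form_polys_in[OF lin] by (auto intro!: polys_in_prod polys_in_power)
  moreover have "?Q \<noteq> 0" using nz by (auto simp: prod_zero_iff)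
  ultimately have ff: "section_monomial ell h \<in> function_field c"
    unfolding section_monomial_Fract[of ell, OF nz] function_field_def by blast
  have "0 \<le> ereal (of_int (order_along q (section_monomial ell h))) + (\<Sum>i | q dvd ell i \<and> ell i dvd q. a i)"
    if "irreducible_form c q" for q
  proof -
    have q: "irreducible q" using that by (simp add: irreducible_form_def)
    let ?I = "{i. q dvd ell i \<and> ell i dvd q}"
    have "order_along q (section_monomial ell h) = (\<Sum>i\<in>?I. h i)"
      by (rule order_along_eq[OF irreducible_imp_prime_elem_cpoly[OF q] has_order_section_monomial[OF q irr]])
    then have "ereal (of_int (order_along q (section_monomial ell h))) + (\<Sum>i\<in>?I. a i)
        = (\<Sum>i\<in>?I. ereal (of_int (h i)) + a i)"
      by (simp add: sum.distrib flip: sum_ereal)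
    also have "\<dots> \<ge> 0"
    proof (rule sum_nonneg)
      fix i show "0 \<le> ereal (of_int (h i)) + a i" using le[of i] by (cases "a i") auto
    qed
    finally show ?thesis .
  qed
  then show ?thesis unfolding global_sections_def using ff by blast
qed

text \<open>
  An irreducible factor of the denominator is again a form, and it must divide the numerator, as
  otherwise the order along it would be negative; cancelling such factors one after the other
  makes the denominator constant.
\<close>
lemma Fract_homogeneous_eq_form:
  fixes P Q :: "nat cpoly"
  assumes "P \<noteq> 0" "Q \<noteq> 0" "homogeneous m P" "homogeneous n Q" "P \<in> polys_in {..c}" "Q \<in> polys_in {..c}"
    and "\<And>q. irreducible_form c q \<Longrightarrow> \<exists>k\<ge>0. has_order q (Fract P Q) k"
  shows "\<exists>g d. homogeneous d g \<and> g \<in> polys_in {..c} \<and> Fract P Q = Fract g 1 \<and> m = n + d"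
  using assms
proof (induction "total_degree Q" arbitrary: P Q m n rule: less_induct)
  case less
  note prems = less.prems
  show ?case
  proof (cases "Q dvd 1")
    case True
    then have "total_degree Q = 0" using cpoly_unit_iff by blast
    then obtain a where a: "Q = Const a" using total_degree_0_imp_Const by blast
    have a0: "a \<noteq> 0" using a prems(2) by auto
    have "n = 0" using total_degree_homogeneous[OF prems(4,2)] \<open>total_degree Q = 0\<close> by simp
    have "Fract P Q = Fract (Const (1 / a) * P) 1"
      using a0 by (simp add: a eq_fract) (metis Const_1 Const_mult mult.assoc mult.commute mult.right_neutral nonzero_divide_eq_eq)
    moreover have "homogeneous (0 + m) (Const (1 / a) * P)" by (intro homogeneous_mult prems(3) homogeneous_Const)
    moreover have "Const (1 / a) * P \<in> polys_in {..c}" using prems(5) by simp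
    ultimately show ?thesis using \<open>n = 0\<close> by (metis add_0)
  next
    case False
    obtain q R where q: "irreducible q" "Q = q * R"
      using irreducible_factor_exists[OF prems(2) False] .
    have nz: "q \<noteq> 0" "R \<noteq> 0" using q prems(2) by auto
    have q_in: "q \<in> polys_in {..c}" and R_in: "R \<in> polys_in {..c}"
      using polys_in_factor[of q R] polys_in_factor[of R q] prems(2,6) q(2) by (auto simp: mult.commute)
    obtain e where e: "homogeneous e q" using homogeneous_factor[of n q R] prems(2,4) q(2) by auto
    obtain e' where e': "homogeneous e' R"
      using homogeneous_factor[of n R q] prems(2,4) q(2) by (auto simp: mult.commute)
    have form: "irreducible_form c q" using q_in q(1) e unfolding irreducible_form_def by blast
    have prime: "prime_elem q" by (rule irreducible_imp_prime_elem_cpoly[OF q(1)])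
    have "q dvd P"
    proof (rule ccontr)
      assume "\<not> q dvd P"
      obtain k where k: "has_order q (Fract Q 1) (int k)" "k > 0"
        using has_order_exists_poly[OF q(1) prems(2)] q(2) by auto
      have "has_order q (Fract P 1) 0"
        using \<open>\<not> q dvd P\<close> q(1) by (intro has_order_Fract_0) (auto simp: irreducible_def)
      from has_order_mult[OF prime this has_order_inverse[OF k(1)]]
      have "has_order q (Fract P Q) (- int k)" using prems(2) by simp
      then show False using prems(7)[OF form] has_order_unique[OF prime] k(2) by fastforce
    qed
    then obtain P' where P': "P = q * P'" by (auto elim: dvdE)
    then have P'0: "P' \<noteq> 0" using prems(1) by auto
    have "P' \<in> polys_in {..c}" using polys_in_factor[of P' q] prems(1,5) P' by (auto simp: mult.commute)
    obtain m' where m': "homogeneous m' P'"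
      using homogeneous_factor[of m P' q] prems(1,3) P' by (auto simp: mult.commute)
    have Fr: "Fract P Q = Fract P' R" using nz by (simp add: P' q(2) mult_fract_cancel)
    have "total_degree R < total_degree Q"
      using total_degree_mult[OF nz] q cpoly_unit_iff[of q] nz by (auto simp: irreducible_def)
    moreover have "m = e + m'" "n = e + e'"
      using total_degree_homogeneous[OF homogeneous_mult[OF e m']] total_degree_homogeneous[OF prems(3)]
        total_degree_homogeneous[OF homogeneous_mult[OF e e']] total_degree_homogeneous[OF prems(4)]
        prems(1,2) P' q(2) by auto
    moreover note less.hyps[OF _ P'0 nz(2) m' e' \<open>P' \<in> polys_in {..c}\<close> R_in]
    ultimately show ?thesis using prems(7) unfolding Fr by fastforce
  qed
qed

text \<open>
  Multiplying a section by \<open>\<Prod> ell\<^sub>i powi b\<^sub>i\<close> cancels its poles and leaves a form.  Where the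
  divisor has coefficient \<open>\<infinity>\<close>, the order of the given section bounds the pole, so a large
  integer will do.
\<close>
lemma global_section_normal_form:
  assumes lin: "\<And>i. linear_form c (ell i)" and nz: "\<And>i. ell i \<noteq> 0"
    and f: "f \<in> global_sections c ell a" "f \<noteq> 0"
    and a: "\<And>i. a i = \<infinity> \<or> (\<exists>k::int. a i = ereal (of_int k))"
  obtains b g n where "\<And>i. ereal (of_int (b i)) \<le> a i" "homogeneous n g" "g \<in> polys_in {..c}"
    "int n = (\<Sum>i\<in>UNIV. b i)" "f = Fract g 1 * section_monomial ell (\<lambda>i. - b i)"
proof -
  have irr: "irreducible (ell i)" for i by (rule linear_form_irreducible[OF lin nz])
  define fin where "fin = (\<lambda>i. if a i = \<infinity> then 0 else \<lfloor>real_of_ereal (a i)\<rfloor>)"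
  \<comment> \<open>The summand over all indices makes up for negative finite coefficients at proportional forms, which exist when \<open>c = 0\<close>.\<close>
  define b where "b = (\<lambda>i. if a i = \<infinity> then \<bar>order_along (ell i) f\<bar> + (\<Sum>j\<in>UNIV. \<bar>fin j\<bar>) else fin i)"
  have a_fin: "a i = ereal (of_int (fin i))" if "a i \<noteq> \<infinity>" for i
    using a[of i] that by (auto simp: fin_def)
  have b_le: "ereal (of_int (b i)) \<le> a i" for i
    using a_fin[of i] by (auto simp: b_def)
  obtain P Q n where PQ: "f = Fract P Q" "P \<in> polys_in {..c}" "Q \<in> polys_in {..c}" "Q \<noteq> 0"
    "homogeneous n P" "homogeneous n Q"
    using f(1) unfolding global_sections_def function_field_def by blast
  have P0: "P \<noteq> 0" using f(2) PQ by (auto simp: Fract_eq_0_iff)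
  let ?B = "\<Prod>i\<in>UNIV. ell i ^ nat (b i)" and ?B' = "\<Prod>i\<in>UNIV. ell i ^ nat (- b i)"
  have B0: "?B \<noteq> 0" "?B' \<noteq> 0" using nz by (auto simp: prod_zero_iff)
  have Bin: "?B \<in> polys_in {..c}" "?B' \<in> polys_in {..c}"
    using linear_form_polys_in[OF lin] by (auto intro!: polys_in_prod polys_in_power)
  have hom: "homogeneous (\<Sum>i\<in>UNIV. 1 * k i) (\<Prod>i\<in>UNIV. ell i ^ k i)" for k
    by (intro homogeneous_prod homogeneous_power linear_form_homogeneous[OF lin])
  have f': "f * section_monomial ell b = Fract (P * ?B) (Q * ?B')"
    unfolding PQ(1) section_monomial_Fract[of ell, OF nz] by simp
  have "\<exists>k\<ge>0. has_order q (f * section_monomial ell b) k" if q: "irreducible_form c q" for q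
  proof -
    let ?I = "{i. q dvd ell i \<and> ell i dvd q}"
    have irq: "irreducible q" using q by (simp add: irreducible_form_def)
    have prime: "prime_elem q" by (rule irreducible_imp_prime_elem_cpoly[OF irq])
    obtain k where k: "has_order q f k" using has_order_exists[OF irq f(2)] .
    have ord: "0 \<le> ereal (of_int k) + (\<Sum>i\<in>?I. a i)"
      using f q order_along_eq[OF prime k] unfolding global_sections_def by auto
    have "0 \<le> k + (\<Sum>i\<in>?I. b i)"
    proof (cases "\<exists>i\<in>?I. a i = \<infinity>")
      case False
      then have "(\<Sum>i\<in>?I. a i) = (\<Sum>i\<in>?I. ereal (of_int (b i)))"
        using a_fin by (intro sum.cong refl) (auto simp: b_def)
      then have "0 \<le> ereal (of_int (k + (\<Sum>i\<in>?I. b i)))" using ord by simp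
      then show ?thesis by (simp only: ereal_less_eq zero_ereal_def of_int_0_le_iff)
    next
      case True
      then obtain i where i: "i \<in> ?I" "a i = \<infinity>" by blast
      obtain l where l: "has_order (ell i) f l" using has_order_exists[OF irr f(2)] .
      have "l = k"
        using has_order_associated[OF irq irr _ _ l] i(1) has_order_unique[OF prime _ k] by auto
      then have "order_along (ell i) f = k"
        using order_along_eq[OF irreducible_imp_prime_elem_cpoly[OF irr] l] by simp
      then have bi: "b i = \<bar>k\<bar> + (\<Sum>j\<in>UNIV. \<bar>fin j\<bar>)" using i(2) by (simp add: b_def)
      have "b j \<ge> - \<bar>fin j\<bar>" for j by (auto simp: b_def intro: order.trans[OF _ add_nonneg_nonneg] sum_nonneg)
      then have "(\<Sum>j\<in>?I - {i}. - \<bar>fin j\<bar>) \<le> (\<Sum>j\<in>?I - {i}. b j)" by (intro sum_mono)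
      moreover have "(\<Sum>j\<in>?I - {i}. \<bar>fin j\<bar>) \<le> (\<Sum>j\<in>UNIV. \<bar>fin j\<bar>)" by (intro sum_mono2) auto
      moreover have "(\<Sum>j\<in>?I. b j) = b i + (\<Sum>j\<in>?I - {i}. b j)" using i(1) by (intro sum.remove) auto
      ultimately show ?thesis using bi by (simp add: sum_negf)
    qed
    moreover have "has_order q (f * section_monomial ell b) (k + (\<Sum>i\<in>?I. b i))"
      by (rule has_order_mult[OF prime k has_order_section_monomial[OF irq irr]])
    ultimately show ?thesis by blast
  qed
  then obtain g d where g: "homogeneous d g" "g \<in> polys_in {..c}" "f * section_monomial ell b = Fract g 1"
    "n + (\<Sum>i\<in>UNIV. 1 * nat (b i)) = n + (\<Sum>i\<in>UNIV. 1 * nat (- b i)) + d"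
    using Fract_homogeneous_eq_form[OF _ _ homogeneous_mult[OF PQ(5) hom] homogeneous_mult[OF PQ(6) hom], of "\<lambda>i. nat (b i)" "\<lambda>i. nat (- b i)" c]
      P0 PQ(2,3,4) B0 Bin unfolding f' by auto
  have "int (\<Sum>i\<in>UNIV. nat (b i)) - int (\<Sum>i\<in>UNIV. nat (- b i)) = (\<Sum>i\<in>UNIV. b i)"
    by (simp flip: sum_subtractf) (rule sum.cong, auto)
  moreover have "(\<Sum>i\<in>UNIV. nat (b i)) = (\<Sum>i\<in>UNIV. nat (- b i)) + d" using g(4) by simp
  ultimately have d: "int d = (\<Sum>i\<in>UNIV. b i)" by linarith
  have "section_monomial ell b * section_monomial ell (\<lambda>i. - b i) = 1"
    unfolding section_monomial_add[of ell, OF nz, symmetric] by simp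
  then have "f = Fract g 1 * section_monomial ell (\<lambda>i. - b i)"
    unfolding g(3)[symmetric] by (simp add: mult.assoc)
  with that b_le g d show ?thesis by blast
qed

section \<open>Affine charts given by independent linear forms\<close>

lemma (in vector_space) span_subset_of_card_le:
  assumes "finite T" "independent S" "S \<subseteq> span T" "card T \<le> card S"
  shows "T \<subseteq> span S"
proof (rule ccontr)
  assume "\<not> T \<subseteq> span S"
  then obtain x where x: "x \<in> T" "x \<notin> span S" by blast
  have fin: "finite S" using independent_span_bound[OF assms(1-3)] by simp
  have "x \<notin> S" using x(2) span_base by blast
  have "independent (insert x S)" using x(2) assms(2) by (simp add: independent_insert)
  moreover have "insert x S \<subseteq> span T" using x(1) assms(3) span_base by blast
  ultimately have "card (insert x S) \<le> card T" using independent_span_bound[OF assms(1)] by blast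
  then show False using \<open>x \<notin> S\<close> fin assms(4) by simp
qed

lemma (in vector_space) independent_family:
  assumes "finite I" and zero: "\<And>a. (\<Sum>i\<in>I. scale (a i) (f i)) = 0 \<Longrightarrow> \<forall>i\<in>I. a i = 0"
  shows "inj_on f I" and "independent (f ` I)"
proof -
  show inj: "inj_on f I"
  proof (rule inj_onI, rule ccontr)
    fix i j assume ij: "i \<in> I" "j \<in> I" "f i = f j" "i \<noteq> j"
    define a :: "'c \<Rightarrow> 'a" where "a = (\<lambda>k. if k = i then 1 else if k = j then - 1 else 0)"
    have "(\<Sum>k\<in>I. scale (a k) (f k)) = (\<Sum>k\<in>{i, j}. scale (a k) (f k))"
      using ij \<open>finite I\<close> by (intro sum.mono_neutral_right) (auto simp: a_def)
    also have "\<dots> = 0" using ij by (simp add: a_def)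
    finally have "a i = 0" using zero ij(1) by blast
    then show False by (simp add: a_def)
  qed
  show "independent (f ` I)"
  proof (rule independent_if_scalars_zero)
    fix u x assume 0: "(\<Sum>v\<in>f ` I. scale (u v) v) = 0" and "x \<in> f ` I"
    then obtain i where i: "i \<in> I" "x = f i" by blast
    have "(\<Sum>i\<in>I. scale (u (f i)) (f i)) = 0" using 0 unfolding sum.reindex[OF inj] by simp
    from bspec[OF zero[OF this] i(1)] show "u x = 0" using i(2) by simp
  qed (use \<open>finite I\<close> in simp)
qed

lemma (in vector_space) span_subset_of_independent_family:
  assumes "finite I" "\<And>a. (\<Sum>i\<in>I. scale (a i) (f i)) = 0 \<Longrightarrow> \<forall>i\<in>I. a i = 0"
    and "finite T" "f ` I \<subseteq> span T" "card T \<le> card I"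
  shows "T \<subseteq> span (f ` I)"
  using span_subset_of_card_le[OF assms(3) independent_family(2)[of I f] assms(4)]
    independent_family(1)[of I f] assms card_image by metis

lemma vector_space_cpoly: "vector_space (\<lambda>a (p :: 'k cpoly). Const a * p)"
  by unfold_locales (simp_all add: Const_add Const_mult algebra_simps)

lemma lookup_Const_mult: "Poly_Mapping.lookup (Const a * p) b = a * Poly_Mapping.lookup p b"
proof -
  have "Poly_Mapping.lookup (Const a * p) b
      = (\<Sum>d\<in>Poly_Mapping.keys p. a * Poly_Mapping.lookup (Poly_Mapping.single d (Poly_Mapping.lookup p d)) b)"
    by (subst poly_mapping_expand[of p])
      (simp add: Const_def sum_distrib_left mult_single lookup_sum lookup_single when_def if_distrib cong: if_cong)
  also have "\<dots> = a * Poly_Mapping.lookup p b"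
    by (subst (3) poly_mapping_expand[of p]) (simp add: lookup_sum sum_distrib_left)
  finally show ?thesis .
qed

lemma lookup_single_mult:
  fixes p :: "'k cpoly"
  shows "Poly_Mapping.lookup (Poly_Mapping.single a x * p) (a + b) = x * Poly_Mapping.lookup p b"
proof -
  have "Poly_Mapping.lookup (Poly_Mapping.single a x * p) (a + b)
      = (\<Sum>d\<in>Poly_Mapping.keys p. x * Poly_Mapping.lookup (Poly_Mapping.single d (Poly_Mapping.lookup p d)) b)"
    by (subst poly_mapping_expand[of p])
      (simp add: sum_distrib_left mult_single lookup_sum lookup_single when_def if_distrib cong: if_cong)
  also have "\<dots> = x * Poly_Mapping.lookup p b"
    by (subst (3) poly_mapping_expand[of p]) (simp add: lookup_sum sum_distrib_left)
  finally show ?thesis .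
qed

lemma is_ring_hom_constant_coeff: "is_ring_hom (\<lambda>p :: 'k cpoly. Poly_Mapping.lookup p 0)"
proof -
  have id: "is_ring_hom (\<lambda>x::complex. x)" by (simp add: is_ring_hom_def)
  have "power_product (\<lambda>_. 0::complex) a = (if a = 0 then 1 else 0)" for a :: "'k \<Rightarrow>\<^sub>0 nat"
  proof (cases "a = 0")
    case False
    then obtain i where "i \<in> Poly_Mapping.keys a" by (metis all_not_in_conv keys_eq_empty)
    then show ?thesis using False unfolding power_product_def
      by (auto simp: prod_zero_iff in_keys_iff intro!: bexI[of _ i])
  qed simp
  then have "subst (\<lambda>x. x) (\<lambda>_. 0) p = Poly_Mapping.lookup p 0" for p :: "'k cpoly"
    unfolding subst_def power_product_def[symmetric]
    by (auto simp: sum.If_cases if_distrib[of "(*) _"] in_keys_iff cong: if_cong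
        intro!: sum.neutral)
  then have "subst (\<lambda>x. x) (\<lambda>_. 0) = (\<lambda>p :: 'k cpoly. Poly_Mapping.lookup p 0)" by (rule ext)
  then show ?thesis using is_ring_hom_subst[OF id, of "\<lambda>_. 0"] by metis
qed

lemma lookup_Var [simp]: "Poly_Mapping.lookup (Var j) (Poly_Mapping.single s 1) = (if j = s then 1 else 0)"
proof -
  have "Poly_Mapping.single j (1::nat) = Poly_Mapping.single s 1 \<longleftrightarrow> j = s"
    by (metis keys_single one_neq_zero singleton_inject)
  then show ?thesis by (simp add: Var_def lookup_single when_def)
qed

lemma lookup_Var_0 [simp]: "Poly_Mapping.lookup (Var j) 0 = 0"
proof -
  have "Poly_Mapping.single j (1::nat) \<noteq> 0" by (metis lookup_single_eq lookup_zero one_neq_zero)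
  then show ?thesis by (simp add: Var_def lookup_single when_def)
qed

locale general_arrangement =
  fixes c :: nat and ell :: "'m::finite option \<Rightarrow> nat cpoly"
  assumes lin: "linear_form c (ell i)"
    and full: "full_rank c ell"
    and gen: "general_linear_position c ell"
begin

lemma linear_form_Var: "s \<le> c \<Longrightarrow> linear_form c (Var s)"
  unfolding linear_form_def
  by (rule exI[of _ "\<lambda>j. if j = s then 1 else 0"])
    (simp add: if_distrib[of Const] if_distribR if_distrib[of "\<lambda>x. x * _"] sum.delta cong: if_cong)

lemma card_indices: "c + 1 \<le> CARD('m option)"
proof -
  interpret vector_space "\<lambda>a (p :: nat cpoly). Const a * p" by (rule vector_space_cpoly)
  have zero: "\<forall>s\<in>{..c}. a s = 0" if 0: "(\<Sum>s\<in>{..c}. Const (a s) * Var s :: nat cpoly) = 0" for a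
  proof
    fix s assume s: "s \<in> {..c}"
    have "0 = Poly_Mapping.lookup (\<Sum>j\<le>c. Const (a j) * Var j) (Poly_Mapping.single s 1)"
      using 0 by simp
    also have "\<dots> = (\<Sum>j\<le>c. if j = s then a s else 0)"
      unfolding lookup_sum lookup_Const_mult
      by (intro sum.cong refl) (simp del: One_nat_def)
    also have "\<dots> = a s" using s by simp
    finally show "a s = 0" by simp
  qed
  have inj: "inj_on (Var :: nat \<Rightarrow> nat cpoly) {..c}"
    and "independent (Var ` {..c} :: nat cpoly set)"
    using independent_family[of "{..c}" Var] zero by simp_all
  moreover have "Var ` {..c} \<subseteq> span (range ell)"
  proof safe
    fix s assume "s \<le> c"
    then obtain a where "Var s = (\<Sum>i\<in>UNIV. Const (a i) * ell i)"
      using full linear_form_Var unfolding full_rank_def by blast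
    then show "Var s \<in> span (range ell)" by (simp only:) (intro span_sum span_scale span_base rangeI)
  qed
  ultimately have "card (Var ` {..c} :: nat cpoly set) \<le> card (range ell)"
    using independent_span_bound[of "range ell"] by simp
  also have "\<dots> \<le> CARD('m option)" by (rule card_image_le) simp
  finally show ?thesis using card_image[OF inj] by simp
qed

lemma nonzero: "ell i \<noteq> 0"
proof
  assume 0: "ell i = 0"
  obtain S where S: "card S = c" "S \<subseteq> UNIV - {i}"
    using obtain_subset_with_card_n[of c "UNIV - {i}"] card_indices by auto
  define a :: "'m option \<Rightarrow> complex" where "a = (\<lambda>j. if j = i then 1 else 0)"
  have "card (insert i S) = c + 1" using S finite_subset[of S] by (subst card_insert_disjoint) auto
  moreover have "(\<Sum>j\<in>insert i S. Const (a j) * ell j) = 0"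
    using 0 by (intro sum.neutral) (auto simp: a_def)
  ultimately have "a i = 0"
    using gen unfolding general_linear_position_def by blast
  then show False by (simp add: a_def)
qed

end

text \<open>
  A chart: \<open>c\<close> of the forms serve as affine coordinates after division by the form with index
  \<open>j0\<close>.
\<close>
locale arrangement_chart = general_arrangement c ell
  for c and ell :: "'m::finite option \<Rightarrow> nat cpoly" +
  fixes K :: "'m option set" and j0 :: "'m option"
  assumes card_K: "card K = c" and j0: "j0 \<notin> K"
begin

lemma card_insert_K: "j \<notin> K \<Longrightarrow> card (insert j K) = c + 1"
  using card_K by simp

lemma coordinates_exist:
  "\<exists>b. \<forall>s\<le>c. Var s = (\<Sum>l\<in>insert j0 K. Const (b s l) * ell l)"
proof -
  interpret vector_space "\<lambda>a (p :: nat cpoly). Const a * p" by (rule vector_space_cpoly)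
  let ?L = "insert j0 K"
  have zero: "\<forall>i\<in>?L. a i = 0" if "(\<Sum>i\<in>?L. Const (a i) * ell i) = 0" for a
    using gen card_insert_K[OF j0] that unfolding general_linear_position_def by blast
  have inj: "inj_on ell ?L" by (rule independent_family(1)[OF _ zero]) simp_all
  have sub_span: "ell ` ?L \<subseteq> span (Var ` {..c})"
  proof
    fix x assume "x \<in> ell ` ?L"
    then obtain l where l: "x = ell l" by blast
    obtain a where "ell l = (\<Sum>j\<le>c. Const (a j) * Var j)" using lin unfolding linear_form_def by blast
    then show "x \<in> span (Var ` {..c})" unfolding l by (simp only:) (intro span_sum span_scale span_base imageI)
  qed
  have card_le: "card (Var ` {..c} :: nat cpoly set) \<le> card ?L"
    using card_insert_K[OF j0] card_image_le[of "{..c}" "Var :: nat \<Rightarrow> nat cpoly"] by simp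
  have sub: "Var ` {..c} \<subseteq> span (ell ` ?L)"
    by (rule span_subset_of_independent_family[OF _ zero _ sub_span card_le]) simp_all
  have "\<exists>b. Var s = (\<Sum>l\<in>?L. Const (b l) * ell l)" if "s \<le> c" for s
  proof -
    have "Var s \<in> span (ell ` ?L)" using sub that by blast
    then obtain u where "Var s = (\<Sum>v\<in>ell ` ?L. Const (u v) * v)"
      by (subst (asm) span_finite) auto
    then have "Var s = (\<Sum>l\<in>?L. Const (u (ell l)) * ell l)" unfolding sum.reindex[OF inj] by simp
    then show ?thesis by (rule exI[of _ "\<lambda>l. u (ell l)"])
  qed
  then show ?thesis by metis
qed

definition coordinates :: "nat \<Rightarrow> 'm option \<Rightarrow> complex" where
  "coordinates = (SOME b. \<forall>s\<le>c. Var s = (\<Sum>l\<in>insert j0 K. Const (b s l) * ell l))"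

lemma Var_coordinates: "s \<le> c \<Longrightarrow> Var s = (\<Sum>l\<in>insert j0 K. Const (coordinates s l) * ell l)"
  using someI_ex[OF coordinates_exist] unfolding coordinates_def by blast

text \<open>
  A polynomial rewritten in the forms with index in \<open>K \<union> {j0}\<close>, which take the role of the
  variables.
\<close>
definition homogeneous_chart :: "nat cpoly \<Rightarrow> 'm option cpoly" where
  "homogeneous_chart = subst Const (\<lambda>s. \<Sum>l\<in>insert j0 K. Const (coordinates s l) * Var l)"

lemma subst_homogeneous_chart:
  assumes "g \<in> polys_in {..c}"
  shows "subst Const ell (homogeneous_chart g) = g"
proof -
  have "subst Const ell (homogeneous_chart g)
      = subst Const (\<lambda>s. \<Sum>l\<in>insert j0 K. Const (coordinates s l) * ell l) g"
    unfolding homogeneous_chart_def subst_subst[OF is_ring_hom_Const]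
    by (simp add: subst_sum[OF is_ring_hom_Const] subst_mult[OF is_ring_hom_Const]
        subst_Const[OF is_ring_hom_Const] subst_Var[OF is_ring_hom_Const])
  also have "\<dots> = subst Const Var g"
    by (rule subst_cong[OF assms]) (simp add: Var_coordinates)
  finally show ?thesis by simp
qed

lemma form_expansion:
  assumes "homogeneous n g" "g \<in> polys_in {..c}"
  shows "\<exists>X C. finite X \<and> g = (\<Sum>\<beta>\<in>X. Const (C \<beta>) * power_product ell \<beta>) \<and>
    (\<forall>\<beta>\<in>X. Poly_Mapping.keys \<beta> \<subseteq> insert j0 K \<and> (\<Sum>i\<in>UNIV. Poly_Mapping.lookup \<beta> i) = n)"
proof -
  let ?G = "homogeneous_chart g"
  have hom1: "homogeneous 1 (\<Sum>l\<in>insert j0 K. Const (coordinates s l) * Var l)" for s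
    using homogeneous_mult[OF homogeneous_Const homogeneous_Var] by (intro homogeneous_sum) simp
  have "homogeneous n ?G"
    unfolding homogeneous_chart_def by (rule homogeneous_subst[OF assms(1) hom1])
  moreover have "?G \<in> polys_in (insert j0 K)"
    unfolding homogeneous_chart_def by (intro polys_in_subst polys_in_sum polys_in_mult) auto
  moreover have "(\<Sum>i\<in>Poly_Mapping.keys \<beta>. Poly_Mapping.lookup \<beta> i) = (\<Sum>i\<in>UNIV. Poly_Mapping.lookup \<beta> i)"
    for \<beta> :: "'m option \<Rightarrow>\<^sub>0 nat"
    by (rule sum.mono_neutral_left) (auto simp: in_keys_iff)
  moreover have "g = (\<Sum>\<beta>\<in>Poly_Mapping.keys ?G. Const (Poly_Mapping.lookup ?G \<beta>) * power_product ell \<beta>)"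
    using subst_homogeneous_chart[OF assms(2)] unfolding subst_def power_product_def by simp
  ultimately show ?thesis
    unfolding homogeneous_def polys_in_def by (intro exI[of _ "Poly_Mapping.keys ?G"] exI[of _ "Poly_Mapping.lookup ?G"]) auto
qed

text \<open>
  The dehomogenized chart: the form with index \<open>j0\<close> becomes \<open>1\<close>.
\<close>
definition affine_chart :: "nat cpoly \<Rightarrow> 'm option cpoly" where
  "affine_chart = subst Const (\<lambda>s. \<Sum>l\<in>insert j0 K. Const (coordinates s l) * (if l = j0 then 1 else Var l))"

lemma is_ring_hom_affine_chart: "is_ring_hom affine_chart"
  unfolding affine_chart_def by (rule is_ring_hom_subst[OF is_ring_hom_Const])

lemma affine_chart_ell:
  obtains e where "ell i = (\<Sum>l\<in>insert j0 K. Const (e l) * ell l)"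
    "affine_chart (ell i) = (\<Sum>l\<in>insert j0 K. Const (e l) * (if l = j0 then 1 else Var l))"
proof -
  let ?L = "insert j0 K"
  obtain a where a: "ell i = (\<Sum>s\<le>c. Const (a s) * Var s)" using lin unfolding linear_form_def by blast
  have swap: "(\<Sum>s\<le>c. Const (a s) * (\<Sum>l\<in>?L. Const (coordinates s l) * y l))
      = (\<Sum>l\<in>?L. Const (\<Sum>s\<le>c. a s * coordinates s l) * y l)" for y :: "'m option \<Rightarrow> 'k cpoly"
    unfolding is_ring_hom_sum[OF is_ring_hom_Const] Const_mult sum_distrib_left sum_distrib_right mult.assoc
    by (rule sum.swap)
  have "ell i = (\<Sum>s\<le>c. Const (a s) * (\<Sum>l\<in>?L. Const (coordinates s l) * ell l))"
    unfolding a by (intro sum.cong refl arg_cong2[of _ _ _ _ "(*)"] Var_coordinates) simp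
  moreover have "affine_chart (ell i)
      = (\<Sum>s\<le>c. Const (a s) * (\<Sum>l\<in>?L. Const (coordinates s l) * (if l = j0 then 1 else Var l)))"
    unfolding a affine_chart_def
    by (simp only: subst_sum[OF is_ring_hom_Const] subst_mult[OF is_ring_hom_Const]
        subst_Const[OF is_ring_hom_Const] subst_Var[OF is_ring_hom_Const])
  ultimately show ?thesis unfolding swap by (rule that)
qed

lemma affine_chart_coordinate:
  assumes "i \<in> K"
  shows "affine_chart (ell i) = Var i"
proof -
  let ?L = "insert j0 K"
  obtain e where e: "ell i = (\<Sum>l\<in>?L. Const (e l) * ell l)"
    "affine_chart (ell i) = (\<Sum>l\<in>?L. Const (e l) * (if l = j0 then 1 else Var l))"
    using affine_chart_ell .
  have delta: "(\<Sum>l\<in>?L. Const (if l = i then 1 else 0) * y l) = y i" for y :: "'m option \<Rightarrow> 'k cpoly"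
    using assms by (simp add: if_distrib[of Const] if_distrib[of "\<lambda>x. x * _"] sum.delta cong: if_cong del: sum.insert)
  have "(\<Sum>l\<in>?L. Const (e l - (if l = i then 1 else 0)) * ell l) = ell i - ell i"
    unfolding is_ring_hom_diff[OF is_ring_hom_Const] left_diff_distrib sum_subtractf delta e(1)[symmetric] ..
  then have "(\<Sum>l\<in>?L. Const (e l - (if l = i then 1 else 0)) * ell l) = 0" by (simp only: diff_self)
  then have "\<forall>l\<in>?L. e l - (if l = i then 1 else 0) = 0"
    using gen[unfolded general_linear_position_def, rule_format, OF card_insert_K[OF j0], of "\<lambda>l. e l - (if l = i then 1 else 0)"]
    by blast
  then have "affine_chart (ell i) = (\<Sum>l\<in>?L. Const (if l = i then 1 else 0) * (if l = j0 then 1 else Var l))"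
    unfolding e(2) by (intro sum.cong) auto
  also have "\<dots> = Var i" unfolding delta using assms j0 by auto
  finally show ?thesis .
qed

text \<open>
  By general position a form outside \<open>K\<close> does not vanish at the common zero of the forms in
  \<open>K\<close>, which is the origin of the chart: otherwise it would be a combination of those \<open>c\<close> forms.
\<close>
lemma affine_chart_constant_coeff:
  assumes "j \<notin> K"
  shows "Poly_Mapping.lookup (affine_chart (ell j)) 0 \<noteq> 0"
proof
  let ?L = "insert j0 K"
  assume 0: "Poly_Mapping.lookup (affine_chart (ell j)) 0 = 0"
  obtain e where e: "ell j = (\<Sum>l\<in>?L. Const (e l) * ell l)"
    "affine_chart (ell j) = (\<Sum>l\<in>?L. Const (e l) * (if l = j0 then 1 else Var l))"
    using affine_chart_ell .
  have "Poly_Mapping.lookup (affine_chart (ell j)) 0 = (\<Sum>l\<in>?L. if l = j0 then e j0 else 0)"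
    unfolding e(2) lookup_sum lookup_Const_mult
    by (intro sum.cong refl) auto
  then have "e j0 = 0" using 0 by (simp del: sum.insert)
  then have ej: "ell j = (\<Sum>l\<in>K. Const (e l) * ell l)" using e(1) j0 by simp
  define a where "a = (\<lambda>l. if l = j then 1 else - e l)"
  have "(\<Sum>l\<in>insert j K. Const (a l) * ell l) = ell j - (\<Sum>l\<in>K. Const (e l) * ell l)"
  proof -
    have "(\<Sum>l\<in>K. Const (a l) * ell l) = (\<Sum>l\<in>K. - (Const (e l) * ell l))"
      using assms by (intro sum.cong refl) (auto simp: a_def is_ring_hom_uminus[OF is_ring_hom_Const])
    then show ?thesis using assms by (simp add: a_def sum_negf)
  qed
  then have "(\<Sum>l\<in>insert j K. Const (a l) * ell l) = 0" using ej by simp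
  then have "a j = 0"
    using gen card_insert_K[OF assms] unfolding general_linear_position_def by blast
  then show False by (simp add: a_def)
qed

definition chart_exponent :: "('m option \<Rightarrow> nat) \<Rightarrow> 'm option \<Rightarrow>\<^sub>0 nat" where
  "chart_exponent n = (\<Sum>i\<in>K. Poly_Mapping.single i (n i))"

lemma lookup_chart_exponent: "i \<in> K \<Longrightarrow> Poly_Mapping.lookup (chart_exponent n) i = n i"
  by (simp add: chart_exponent_def lookup_sum lookup_single when_def sum.delta)

text \<open>
  The factors with index in \<open>K\<close> are coordinates and the others are units at the origin, so the
  product is a monomial in the coordinates times a polynomial with nonzero constant term.
\<close>
lemma affine_chart_monomial:
  shows "Poly_Mapping.lookup (affine_chart (\<Prod>i\<in>UNIV. ell i ^ n i)) (chart_exponent n) \<noteq> 0" (is ?nz)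
    and "\<beta> \<in> Poly_Mapping.keys (affine_chart (\<Prod>i\<in>UNIV. ell i ^ n i)) \<Longrightarrow> i \<in> K \<Longrightarrow> n i \<le> Poly_Mapping.lookup \<beta> i"
proof -
  define W where "W = (\<Prod>j\<in>-K. affine_chart (ell j) ^ n j)"
  have "affine_chart (\<Prod>i\<in>UNIV. ell i ^ n i) = (\<Prod>i\<in>UNIV. affine_chart (ell i) ^ n i)"
    by (simp only: is_ring_hom_prod[OF is_ring_hom_affine_chart] is_ring_hom_power[OF is_ring_hom_affine_chart])
  also have "\<dots> = (\<Prod>i\<in>K. affine_chart (ell i) ^ n i) * W"
    unfolding W_def by (subst prod.union_disjoint[symmetric]) (auto intro: prod.cong)
  also have "(\<Prod>i\<in>K. affine_chart (ell i) ^ n i) = power_product Var (chart_exponent n)"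
    by (simp add: chart_exponent_def power_product_sum affine_chart_coordinate)
  finally have *: "affine_chart (\<Prod>i\<in>UNIV. ell i ^ n i) = Poly_Mapping.single (chart_exponent n) 1 * W"
    unfolding power_product_Var .
  have "Poly_Mapping.lookup W 0 = (\<Prod>j\<in>-K. Poly_Mapping.lookup (affine_chart (ell j)) 0 ^ n j)"
    unfolding W_def
    by (simp only: is_ring_hom_prod[OF is_ring_hom_constant_coeff] is_ring_hom_power[OF is_ring_hom_constant_coeff])
  then have "Poly_Mapping.lookup W 0 \<noteq> 0" using affine_chart_constant_coeff by (simp add: prod_zero_iff)
  then show ?nz unfolding * using lookup_single_mult[of "chart_exponent n" 1 W 0] by simp
  assume "\<beta> \<in> Poly_Mapping.keys (affine_chart (\<Prod>i\<in>UNIV. ell i ^ n i))" and i: "i \<in> K"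
  then obtain \<gamma> where "\<beta> = chart_exponent n + \<gamma>"
    unfolding * using keys_mult[of "Poly_Mapping.single (chart_exponent n) 1" W] by auto
  then show "n i \<le> Poly_Mapping.lookup \<beta> i" by (simp add: lookup_add lookup_chart_exponent[OF i])
qed

text \<open>
  In the affine chart every monomial has one lowest exponent.  An exponent that is not above any
  other lowest exponent on the right therefore survives on the right, so it must lie above some
  lowest exponent on the left.
\<close>
lemma leading_exponent_bound:
  fixes p :: "'a \<Rightarrow> complex" and q :: "'b \<Rightarrow> complex"
  assumes fin: "finite P" "finite Q"
    and eq: "(\<Sum>a\<in>P. Fract (Const (p a)) 1 * section_monomial ell (h a))
       = (\<Sum>b\<in>Q. Fract (Const (q b)) 1 * section_monomial ell (k b))"
    and b0: "b0 \<in> Q" "q b0 \<noteq> 0"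
    and min: "\<And>b. b \<in> Q \<Longrightarrow> b \<noteq> b0 \<Longrightarrow> \<not> (\<forall>i\<in>K. k b i \<le> k b0 i)"
  shows "\<exists>a\<in>P. \<forall>i\<in>K. h a i \<le> k b0 i"
proof -
  \<comment> \<open>A common shift of all exponents turns the identity of rational functions into one of polynomials.\<close>
  define N where "N = (\<Sum>a\<in>P. \<Sum>i\<in>UNIV. \<bar>h a i\<bar>) + (\<Sum>b\<in>Q. \<Sum>i\<in>UNIV. \<bar>k b i\<bar>)"
  have bound: "\<bar>f x i\<bar> \<le> (\<Sum>a\<in>S. \<Sum>i\<in>UNIV. \<bar>f a i\<bar>)" if "x \<in> S" "finite S" for f :: "'c \<Rightarrow> 'm option \<Rightarrow> int" and x S i
  proof -
    have "\<bar>f x i\<bar> \<le> (\<Sum>i\<in>UNIV. \<bar>f x i\<bar>)" by (rule member_le_sum) auto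
    also have "\<dots> \<le> (\<Sum>a\<in>S. \<Sum>i\<in>UNIV. \<bar>f a i\<bar>)"
      by (rule member_le_sum[where f = "\<lambda>a. \<Sum>i\<in>UNIV. \<bar>f a i\<bar>"]) (use that in \<open>auto intro: sum_nonneg\<close>)
    finally show ?thesis .
  qed
  have nonneg: "0 \<le> (\<Sum>a\<in>S. \<Sum>i\<in>UNIV. \<bar>f a i\<bar>)" for f :: "'c \<Rightarrow> 'm option \<Rightarrow> int" and S
    by (intro sum_nonneg) simp
  have hN: "0 \<le> h a i + N" if "a \<in> P" for a i
    using bound[OF that fin(1), of h i] nonneg[of k Q] unfolding N_def by linarith
  have kN: "0 \<le> k b i + N" if "b \<in> Q" for b i
    using bound[OF that fin(2), of k i] nonneg[of h P] unfolding N_def by linarith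
  define n where "n = (\<lambda>a i. nat (h a i + N))"
  define n' where "n' = (\<lambda>b i. nat (k b i + N))"
  have shift: "section_monomial ell f * section_monomial ell (\<lambda>_. N)
      = Fract (\<Prod>i\<in>UNIV. ell i ^ nat (f i + N)) 1" if "\<And>i. 0 \<le> f i + N" for f
    unfolding section_monomial_add[of ell, OF nonzero, symmetric] section_monomial_int[symmetric]
    using that by simp
  have "Fract (\<Sum>a\<in>P. Const (p a) * (\<Prod>i\<in>UNIV. ell i ^ n a i)) 1
      = (\<Sum>a\<in>P. Fract (Const (p a)) 1 * section_monomial ell (h a)) * section_monomial ell (\<lambda>_. N)"
    unfolding is_ring_hom_sum[OF is_ring_hom_Fract_1] sum_distrib_right Fract_1_mult
    by (intro sum.cong refl) (simp only: shift hN mult.assoc n_def)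
  also have "\<dots> = (\<Sum>b\<in>Q. Fract (Const (q b)) 1 * section_monomial ell (k b)) * section_monomial ell (\<lambda>_. N)"
    unfolding eq ..
  also have "\<dots> = Fract (\<Sum>b\<in>Q. Const (q b) * (\<Prod>i\<in>UNIV. ell i ^ n' b i)) 1"
    unfolding is_ring_hom_sum[OF is_ring_hom_Fract_1] sum_distrib_right Fract_1_mult
    by (intro sum.cong refl) (simp only: shift kN mult.assoc n'_def)
  finally have "(\<Sum>a\<in>P. Const (p a) * (\<Prod>i\<in>UNIV. ell i ^ n a i))
      = (\<Sum>b\<in>Q. Const (q b) * (\<Prod>i\<in>UNIV. ell i ^ n' b i))" by simp
  from arg_cong[OF this, of affine_chart]
  have chart: "(\<Sum>a\<in>P. Const (p a) * affine_chart (\<Prod>i\<in>UNIV. ell i ^ n a i))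
      = (\<Sum>b\<in>Q. Const (q b) * affine_chart (\<Prod>i\<in>UNIV. ell i ^ n' b i))"
    unfolding is_ring_hom_sum[OF is_ring_hom_affine_chart] is_ring_homD(3)[OF is_ring_hom_affine_chart]
    by (simp add: affine_chart_def subst_Const[OF is_ring_hom_Const])
  let ?\<beta> = "chart_exponent (n' b0)"
  have rhs: "(\<Sum>b\<in>Q. q b * Poly_Mapping.lookup (affine_chart (\<Prod>i\<in>UNIV. ell i ^ n' b i)) ?\<beta>) \<noteq> 0"
  proof -
    have zero: "Poly_Mapping.lookup (affine_chart (\<Prod>i\<in>UNIV. ell i ^ n' b i)) ?\<beta> = 0"
      if b: "b \<in> Q" "b \<noteq> b0" for b
    proof (rule ccontr)
      assume "Poly_Mapping.lookup (affine_chart (\<Prod>i\<in>UNIV. ell i ^ n' b i)) ?\<beta> \<noteq> 0"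
      then have key: "?\<beta> \<in> Poly_Mapping.keys (affine_chart (\<Prod>i\<in>UNIV. ell i ^ n' b i))"
        by (simp add: in_keys_iff)
      have "k b i \<le> k b0 i" if "i \<in> K" for i
        using affine_chart_monomial(2)[OF key that] kN[OF b(1), of i] kN[OF b0(1), of i]
        unfolding lookup_chart_exponent[OF that] n'_def by linarith
      then show False using min[OF b] by blast
    qed
    have "(\<Sum>b\<in>Q. q b * Poly_Mapping.lookup (affine_chart (\<Prod>i\<in>UNIV. ell i ^ n' b i)) ?\<beta>)
        = (\<Sum>b\<in>{b0}. q b * Poly_Mapping.lookup (affine_chart (\<Prod>i\<in>UNIV. ell i ^ n' b i)) ?\<beta>)"
      by (rule sum.mono_neutral_right) (use fin b0 zero in auto)
    then show ?thesis using b0(2) affine_chart_monomial(1)[of "n' b0"] by simp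
  qed
  have "(\<Sum>a\<in>P. p a * Poly_Mapping.lookup (affine_chart (\<Prod>i\<in>UNIV. ell i ^ n a i)) ?\<beta>) \<noteq> 0"
    using rhs arg_cong[OF chart, of "\<lambda>f. Poly_Mapping.lookup f ?\<beta>"]
    unfolding lookup_sum lookup_Const_mult by simp
  then obtain a where a: "a \<in> P" "Poly_Mapping.lookup (affine_chart (\<Prod>i\<in>UNIV. ell i ^ n a i)) ?\<beta> \<noteq> 0"
    by (auto elim!: sum.not_neutral_contains_not_neutral)
  then have key: "?\<beta> \<in> Poly_Mapping.keys (affine_chart (\<Prod>i\<in>UNIV. ell i ^ n a i))"
    by (simp add: in_keys_iff)
  have "h a i \<le> k b0 i" if "i \<in> K" for i
    using affine_chart_monomial(2)[OF key that] hN[OF a(1), of i] kN[OF b0(1), of i]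
    unfolding lookup_chart_exponent[OF that] n'_def n_def by linarith
  then show ?thesis using a(1) by blast
qed

text \<open>
  The numerator of the section is expanded in the forms with index in \<open>K \<union> {j0}\<close>.  Only their
  exponents vary, they can only increase, and the one at \<open>j0\<close> is fixed by the degree, so the
  monomials differ along \<open>K\<close>.
\<close>
lemma global_section_expansion:
  assumes f: "f \<in> global_sections c ell a" "f \<noteq> 0"
    and a: "\<And>i. a i = \<infinity> \<or> (\<exists>k::int. a i = ereal (of_int k))"
  obtains X :: "('m option \<Rightarrow> int) set" and C where "finite X"
    "f = (\<Sum>h\<in>X. Fract (Const (C h)) 1 * section_monomial ell h)"
    "\<And>h. h \<in> X \<Longrightarrow> (\<Sum>i\<in>UNIV. h i) = 0"
    "\<And>h i. h \<in> X \<Longrightarrow> - ereal (of_int (h i)) \<le> a i"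
    "\<And>h h'. h \<in> X \<Longrightarrow> h' \<in> X \<Longrightarrow> \<forall>i\<in>K. h i = h' i \<Longrightarrow> h = h'"
proof -
  obtain b g n where b: "\<And>i. ereal (of_int (b i)) \<le> a i" and g: "homogeneous n g" "g \<in> polys_in {..c}"
    and n: "int n = (\<Sum>i\<in>UNIV. b i)" and fg: "f = Fract g 1 * section_monomial ell (\<lambda>i. - b i)"
    using global_section_normal_form[OF lin nonzero f a] by blast
  obtain Y C where Y: "finite Y" "g = (\<Sum>\<beta>\<in>Y. Const (C \<beta>) * power_product ell \<beta>)"
    "\<And>\<beta>. \<beta> \<in> Y \<Longrightarrow> Poly_Mapping.keys \<beta> \<subseteq> insert j0 K"
    "\<And>\<beta>. \<beta> \<in> Y \<Longrightarrow> (\<Sum>i\<in>UNIV. Poly_Mapping.lookup \<beta> i) = n"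
    using form_expansion[OF g] by blast
  define h where "h = (\<lambda>\<beta> i. int (Poly_Mapping.lookup \<beta> i) - b i)"
  have inj: "\<beta> = \<beta>'" if \<beta>: "\<beta> \<in> Y" "\<beta>' \<in> Y" and eq: "\<And>i. i \<in> K \<Longrightarrow> h \<beta> i = h \<beta>' i" for \<beta> \<beta>'
  proof (rule poly_mapping_eqI)
    have K: "Poly_Mapping.lookup \<beta> i = Poly_Mapping.lookup \<beta>' i" if "i \<noteq> j0" for i
    proof (cases "i \<in> K")
      case False
      then have "i \<notin> Poly_Mapping.keys \<beta>" "i \<notin> Poly_Mapping.keys \<beta>'"
        using Y(3)[OF \<beta>(1)] Y(3)[OF \<beta>(2)] that by blast+
      then show ?thesis by (simp add: in_keys_iff)
    qed (use eq[of i] in \<open>simp add: h_def\<close>)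
    have "(\<Sum>i\<in>UNIV. Poly_Mapping.lookup \<beta> i) = (\<Sum>i\<in>UNIV. Poly_Mapping.lookup \<beta>' i)"
      using Y(4) \<beta> by simp
    moreover have "(\<Sum>i\<in>UNIV - {j0}. Poly_Mapping.lookup \<beta> i) = (\<Sum>i\<in>UNIV - {j0}. Poly_Mapping.lookup \<beta>' i)"
      using K by (intro sum.cong) auto
    ultimately have "Poly_Mapping.lookup \<beta> j0 = Poly_Mapping.lookup \<beta>' j0"
      by (simp add: sum.remove[of UNIV j0])
    then show "Poly_Mapping.lookup \<beta> i = Poly_Mapping.lookup \<beta>' i" for i using K by (cases "i = j0") auto
  qed
  have inj_h: "inj_on h Y" by (rule inj_onI) (rule inj, auto)
  have mono: "Fract (power_product ell \<beta>) 1 * section_monomial ell (\<lambda>i. - b i) = section_monomial ell (h \<beta>)" for \<beta>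
  proof -
    have "power_product ell \<beta> = (\<Prod>i\<in>UNIV. ell i ^ Poly_Mapping.lookup \<beta> i)"
      by (rule power_product_superset) auto
    then show ?thesis
      unfolding h_def diff_conv_add_uminus section_monomial_add[of ell, OF nonzero] section_monomial_int
      by simp
  qed
  have "f = (\<Sum>\<beta>\<in>Y. Fract (Const (C \<beta>)) 1 * section_monomial ell (h \<beta>))"
    unfolding fg Y(2) is_ring_hom_sum[OF is_ring_hom_Fract_1] Fract_1_mult sum_distrib_right mult.assoc mono ..
  also have "\<dots> = (\<Sum>h'\<in>h ` Y. Fract (Const (C (inv_into Y h h'))) 1 * section_monomial ell h')"
    by (subst sum.reindex[OF inj_h]) (auto intro!: sum.cong simp: inv_into_f_f[OF inj_h])
  finally have eq: "f = (\<Sum>h'\<in>h ` Y. Fract (Const (C (inv_into Y h h'))) 1 * section_monomial ell h')" .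
  show ?thesis
  proof (rule that[OF _ eq])
    fix h' assume "h' \<in> h ` Y"
    then obtain \<beta> where \<beta>: "\<beta> \<in> Y" "h' = h \<beta>" by blast
    show "(\<Sum>i\<in>UNIV. h' i) = 0"
      using Y(4)[OF \<beta>(1)] n by (simp add: \<beta>(2) h_def sum_subtractf flip: of_nat_sum)
    show "- ereal (of_int (h' i)) \<le> a i" for i
    proof -
      have "ereal (- of_int (h' i)) \<le> ereal (of_int (b i))" by (simp add: \<beta>(2) h_def)
      then show ?thesis using order.trans[OF _ b[of i]] by simp
    qed
  next
    fix h1 h2 assume "h1 \<in> h ` Y" "h2 \<in> h ` Y" "\<forall>i\<in>K. h1 i = h2 i"
    then show "h1 = h2" using inj by (smt (verit) imageE)
  qed (use Y(1) in simp)
qed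

end

section \<open>Exponents and the dual monoid\<close>

text \<open>
  The exponents of all \<open>m + 1\<close> forms in \<open>\<Prod>\<^sub>j (ell\<^sub>j / ell\<^sub>0) powi h\<^sub>j\<close>; equivalently the pairings
  of \<open>h\<close> with the rays.
\<close>
definition full_exponent :: "int ^ 'm \<Rightarrow> 'm::finite option \<Rightarrow> int" where
  "full_exponent h i = (case i of None \<Rightarrow> - (\<Sum>j\<in>UNIV. h $ j) | Some j \<Rightarrow> h $ j)"

lemma sum_UNIV_option: "(\<Sum>i\<in>UNIV. f i) = f None + (\<Sum>j\<in>UNIV. f (Some j))"
  for f :: "'m::finite option \<Rightarrow> 'a::comm_monoid_add"
  unfolding UNIV_option_conv by (subst sum.insert) (auto simp: sum.reindex)

lemma prod_UNIV_option: "(\<Prod>i\<in>UNIV. f i) = f None * (\<Prod>j\<in>UNIV. f (Some j))"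
  for f :: "'m::finite option \<Rightarrow> 'a::comm_monoid_mult"
  unfolding UNIV_option_conv by (subst prod.insert) (auto simp: prod.reindex)

lemma sum_full_exponent: "(\<Sum>i\<in>UNIV. full_exponent h i) = 0"
  by (simp add: sum_UNIV_option full_exponent_def)

lemma full_exponent_add: "full_exponent (h + h') i = full_exponent h i + full_exponent h' i"
  by (simp add: full_exponent_def sum.distrib split: option.splits)

lemma full_exponent_0 [simp]: "full_exponent 0 i = 0"
  by (simp add: full_exponent_def split: option.splits)

lemma full_exponent_surj:
  assumes "(\<Sum>i\<in>UNIV. k i) = 0"
  obtains h where "full_exponent h = k"
proof
  show "full_exponent (\<chi> j. k (Some j)) = k"
    using assms by (auto simp: fun_eq_iff full_exponent_def sum_UNIV_option split: option.splits)
qed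

lemma pairing_add: "pairing (e + e') z = pairing e z + pairing e' z"
  by (simp add: pairing_def algebra_simps sum.distrib)

lemma pairing_0: "pairing 0 z = 0"
  by (simp add: pairing_def)

lemma pairing_zero_left: "pairing e (0, x) = snd e x"
  by (simp add: pairing_def)

lemma linear_pairing: "linear (snd e) \<Longrightarrow> linear (pairing e)"
  unfolding pairing_def
  by (rule linearI) (simp_all add: linear_add linear_cmul algebra_simps sum.distrib sum_distrib_left)

lemma pairing_ray: "pairing e (ray i, x) = of_int (full_exponent (fst e) i) + snd e x"
proof (cases i)
  case None
  then show ?thesis
    by (simp add: pairing_def full_exponent_def ray_def axis_def sum_negf)
next
  case (Some j)
  then show ?thesis
    by (simp add: pairing_def full_exponent_def ray_def axis_def if_distrib cong: if_cong)
qed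

lemma sum_Pair_zero: "(\<Sum>i\<in>I. (f i, 0)) = (\<Sum>i\<in>I. f i, 0)"
  by (induction I rule: infinite_finite_induct) (simp_all add: zero_prod_def)

lemma pairing_sum_rays:
  assumes "linear (snd e)"
  shows "pairing e (\<Sum>i\<in>K. l i *\<^sub>R ray i, x) = (\<Sum>i\<in>K. l i * of_int (full_exponent (fst e) i)) + snd e x"
proof -
  have eq: "(\<Sum>i\<in>K. l i *\<^sub>R ray i, x) = (\<Sum>i\<in>K. l i *\<^sub>R (ray i, 0)) + (0, x)"
    by (simp add: sum_Pair_zero)
  have "pairing e (\<Sum>i\<in>K. l i *\<^sub>R (ray i, 0)) = (\<Sum>i\<in>K. l i * pairing e (ray i, 0))"
    by (simp add: linear_sum[OF linear_pairing[OF assms]] linear_cmul[OF linear_pairing[OF assms]] del: scaleR_Pair)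
  moreover have "pairing e (0, x) = snd e x" by (simp add: pairing_def)
  ultimately show ?thesis
    unfolding eq linear_add[OF linear_pairing[OF assms]]
    using linear_0[OF assms] by (simp add: pairing_ray)
qed

lemma pairing_nonneg_on_hull:
  assumes "linear (snd e)"
  shows "(\<forall>z\<in>convex_cone hull S. 0 \<le> pairing e z) \<longleftrightarrow> (\<forall>z\<in>S. 0 \<le> pairing e z)"
proof
  assume S: "\<forall>z\<in>S. 0 \<le> pairing e z"
  have "convex_cone {z. 0 \<le> pairing e z}"
    using linear_add[OF linear_pairing[OF assms]] linear_cmul[OF linear_pairing[OF assms]] linear_0[OF linear_pairing[OF assms]]
    by (simp add: convex_cone_iff)
  then have "convex_cone hull S \<subseteq> {z. 0 \<le> pairing e z}"
    using S by (intro hull_minimal) auto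
  then show "\<forall>z\<in>convex_cone hull S. 0 \<le> pairing e z" by blast
qed (meson hull_subset subsetD)

lemma sigma_polyhedron_bounded_below:
  assumes "sigma_polyhedron N \<sigma> D" "u \<in> weight_monoid N \<sigma>" "D \<noteq> {}"
  obtains B :: real where "\<And>x. x \<in> D \<Longrightarrow> B \<le> u x"
proof -
  have lin: "linear u" and nonneg: "\<And>x. x \<in> \<sigma> \<Longrightarrow> 0 \<le> u x"
    using assms(2) by (auto simp: weight_monoid_def dual_lattice_def)
  obtain P where P: "rational_polytope N P" "D = P + \<sigma>"
    using assms(1,3) by (auto simp: sigma_polyhedron_def)
  then obtain V where V: "finite V" "V \<noteq> {}"
    "P = {\<Sum>x\<in>V. of_rat (q x) *\<^sub>R x | q. (\<forall>x\<in>V. q x \<ge> 0) \<and> sum q V = 1}"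
    unfolding rational_polytope_def by blast
  have "Min (u ` V) \<le> u x" if "x \<in> D" for x
  proof -
    have "x \<in> P + \<sigma>" using that P(2) by simp
    then obtain p s where ps: "x = p + s" "p \<in> P" "s \<in> \<sigma>" unfolding set_plus_def by blast
    obtain q where q: "p = (\<Sum>x\<in>V. of_rat (q x) *\<^sub>R x)" "\<And>x. x \<in> V \<Longrightarrow> q x \<ge> 0" "sum q V = 1"
      using ps(2) V(3) by blast
    have "Min (u ` V) = (\<Sum>x\<in>V. of_rat (q x) * Min (u ` V))"
    proof -
      have "(\<Sum>x\<in>V. of_rat (q x)) = (1 :: real)" using q(3) by (metis of_rat_1 of_rat_sum)
      then show ?thesis by (simp flip: sum_distrib_right)
    qed
    also have "\<dots> \<le> (\<Sum>x\<in>V. of_rat (q x) * u x)"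
      using q(2) V(1) by (intro sum_mono mult_left_mono) auto
    also have "\<dots> = u p"
      unfolding q(1) by (simp add: linear_sum[OF lin] linear_cmul[OF lin])
    also have "\<dots> \<le> u x" using nonneg[OF ps(3)] by (simp add: ps(1) linear_add[OF lin])
    finally show ?thesis .
  qed
  then show ?thesis using that by blast
qed

lemma floor_value_cases: "floor_value D u = \<infinity> \<or> (\<exists>k::int. floor_value D u = ereal (of_int k))"
  unfolding floor_value_def by auto

text \<open>
  For an integer, lying below the infimum and lying below its floor are the same.  Boundedness
  below matters because \<open>floor_value\<close> would read \<open>-\<infinity>\<close> as \<open>0\<close>.
\<close>
lemma neg_le_floor_value_iff:
  assumes "sigma_polyhedron N \<sigma> D" "u \<in> weight_monoid N \<sigma>"
  shows "- ereal (of_int k) \<le> floor_value D u \<longleftrightarrow> (\<forall>x\<in>D. 0 \<le> of_int k + u x)"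
proof (cases "D = {}")
  case True
  then show ?thesis by (simp add: floor_value_def support_value_def top_ereal_def)
next
  case False
  obtain B where B: "\<And>x. x \<in> D \<Longrightarrow> B \<le> u x"
    using sigma_polyhedron_bounded_below[OF assms False] by blast
  have "ereal B \<le> support_value D u" unfolding support_value_def by (rule INF_greatest) (use B in simp)
  moreover obtain x where x: "x \<in> D" using False by blast
  then have "support_value D u \<le> ereal (u x)" unfolding support_value_def by (rule INF_lower)
  ultimately obtain s where s: "support_value D u = ereal s"
    by (cases "support_value D u") auto
  have "- ereal (of_int k) \<le> floor_value D u \<longleftrightarrow> - k \<le> \<lfloor>s\<rfloor>"
    unfolding floor_value_def s by (simp flip: of_int_minus)
  also have "\<dots> \<longleftrightarrow> ereal (of_int (- k)) \<le> support_value D u"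
    unfolding le_floor_iff s by simp
  also have "\<dots> \<longleftrightarrow> (\<forall>x\<in>D. 0 \<le> of_int k + u x)"
    unfolding support_value_def le_INF_iff by (simp add: le_minus_iff) (smt (verit))
  finally show ?thesis .
qed

text \<open>
  It suffices to test the generators of the cone; those over the ray \<open>e\<^sub>i\<close> give the bound on the
  \<open>i\<close>-th exponent.
\<close>
lemma mem_delta_dual_monoid_iff:
  assumes "\<And>i. sigma_polyhedron N \<sigma> (\<Delta> i)"
  shows "e \<in> delta_dual_monoid N \<sigma> \<Delta> \<longleftrightarrow> snd e \<in> weight_monoid N \<sigma> \<and>
    (\<forall>i. - ereal (of_int (full_exponent (fst e) i)) \<le> floor_value (\<Delta> i) (snd e))"
proof (cases "snd e \<in> dual_lattice N")
  case True
  then have lin: "linear (snd e)" by (simp add: dual_lattice_def)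
  have "(\<forall>z\<in>delta_cone \<sigma> \<Delta>. 0 \<le> pairing e z) \<longleftrightarrow>
      (\<forall>x\<in>\<sigma>. 0 \<le> snd e x) \<and> (\<forall>i. \<forall>x\<in>\<Delta> i. 0 \<le> of_int (full_exponent (fst e) i) + snd e x)"
    unfolding delta_cone_def pairing_nonneg_on_hull[OF lin]
    by (auto simp: ball_Un pairing_ray pairing_zero_left)
  then show ?thesis
    using True neg_le_floor_value_iff[OF assms, of "snd e"]
    unfolding delta_dual_monoid_def weight_monoid_def by auto
qed (simp add: delta_dual_monoid_def weight_monoid_def)

text \<open>
  The product of the monomials \<open>h\<close> with multiplicities \<open>a h\<close>, written additively.  Multiples are
  repeated sums because exponents form a mere monoid without scalar multiplication.
\<close>
definition combination :: "('h::comm_monoid_add \<Rightarrow>\<^sub>0 nat) \<Rightarrow> 'h" where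
  "combination a = (\<Sum>h\<in>Poly_Mapping.keys a. sum_list (replicate (Poly_Mapping.lookup a h) h))"

lemma combination_superset:
  assumes "finite S" "Poly_Mapping.keys a \<subseteq> S"
  shows "combination a = (\<Sum>h\<in>S. sum_list (replicate (Poly_Mapping.lookup a h) h))"
  unfolding combination_def
  by (rule sum.mono_neutral_left) (use assms in \<open>auto simp: in_keys_iff\<close>)

lemma combination_add: "combination (a + b) = combination a + combination b"
proof -
  let ?S = "Poly_Mapping.keys a \<union> Poly_Mapping.keys b"
  show ?thesis
    using keys_add[of a b]
    by (subst (1 2 3) combination_superset[where S = ?S]) (auto simp: lookup_add replicate_add sum.distrib)
qed

lemma combination_single: "combination (Poly_Mapping.single h 1) = h"
  by (simp add: combination_def)

lemma combination_in:
  assumes "0 \<in> S" "\<And>x y. x \<in> S \<Longrightarrow> y \<in> S \<Longrightarrow> x + y \<in> S" "Poly_Mapping.keys a \<subseteq> S"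
  shows "combination a \<in> S"
proof -
  have "sum_list (replicate n h) \<in> S" if "h \<in> S" for n h
    by (induction n) (use that assms in auto)
  then have "(\<Sum>h\<in>X. sum_list (replicate (Poly_Mapping.lookup a h) h)) \<in> S" if "X \<subseteq> S" for X
    using that by (induction X rule: infinite_finite_induct) (use assms in auto)
  then show ?thesis using assms(3) by (simp add: combination_def)
qed

lemma combination_power_product:
  fixes f :: "'h::comm_monoid_add \<Rightarrow> 'r::comm_ring_1"
  assumes "f 0 = 1" "\<And>x y. f (x + y) = f x * f y"
  shows "f (combination a) = power_product f a"
proof -
  have "f (sum_list (replicate n h)) = f h ^ n" for n h
    by (induction n) (simp_all add: assms)
  moreover have "f (\<Sum>i\<in>I. g i) = (\<Prod>i\<in>I. f (g i))" for I and g :: "'h \<Rightarrow> 'h"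
    by (induction I rule: infinite_finite_induct) (simp_all add: assms)
  ultimately show ?thesis by (simp add: combination_def power_product_def)
qed

lemma combination_additive:
  fixes f :: "'h::comm_monoid_add \<Rightarrow> 'r::comm_ring_1"
  assumes "f 0 = 0" "\<And>x y. f (x + y) = f x + f y"
  shows "f (combination a) = (\<Sum>h\<in>Poly_Mapping.keys a. of_nat (Poly_Mapping.lookup a h) * f h)"
proof -
  have "f (sum_list (replicate n h)) = of_nat n * f h" for n h
    by (induction n) (simp_all add: assms algebra_simps)
  moreover have "f (\<Sum>i\<in>I. g i) = (\<Sum>i\<in>I. f (g i))" for I and g :: "'h \<Rightarrow> 'h"
    by (induction I rule: infinite_finite_induct) (simp_all add: assms)
  ultimately show ?thesis by (simp add: combination_def)
qed

lemma combination_of_list: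
  assumes "set hs \<subseteq> H"
  shows "\<exists>a. Poly_Mapping.keys a \<subseteq> H \<and> combination a = sum_list hs"
  using assms
proof (induction hs)
  case Nil
  show ?case by (rule exI[of _ 0]) (simp add: combination_def)
next
  case (Cons h hs)
  then obtain a where "Poly_Mapping.keys a \<subseteq> H" "combination a = sum_list hs" by auto
  then show ?case
    using Cons.prems keys_add[of "Poly_Mapping.single h 1" a]
    by (intro exI[of _ "Poly_Mapping.single h 1 + a"])
      (auto simp: combination_add combination_single simp del: One_nat_def)
qed

lemma hilbert_basis_iff_combination:
  fixes S :: "'h::comm_monoid_add set"
  assumes "hilbert_basis H S"
  shows "S = {combination a | a. Poly_Mapping.keys a \<subseteq> H}"
proof -
  have S: "S = {sum_list hs | hs. set hs \<subseteq> H}" using assms by (simp add: hilbert_basis_def)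
  have "combination a \<in> S" if "Poly_Mapping.keys a \<subseteq> H" for a
  proof (rule combination_in)
    show "0 \<in> S" unfolding S by (rule CollectI, rule exI[of _ "[]"]) simp
    show "x + y \<in> S" if xy: "x \<in> S" "y \<in> S" for x y
    proof -
      obtain xs ys where "x = sum_list xs" "y = sum_list ys" "set xs \<subseteq> H" "set ys \<subseteq> H"
        using xy unfolding S by blast
      then show ?thesis unfolding S by (intro CollectI exI[of _ "xs @ ys"]) simp
    qed
    have "h \<in> S" if "h \<in> H" for h
      unfolding S by (rule CollectI, rule exI[of _ "[h]"]) (use that in simp)
    then show "Poly_Mapping.keys a \<subseteq> S" using that by blast
  qed
  moreover have "\<exists>a. x = combination a \<and> Poly_Mapping.keys a \<subseteq> H" if "x \<in> S" for x
  proof -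
    obtain hs where "x = sum_list hs" "set hs \<subseteq> H" using \<open>x \<in> S\<close> unfolding S by blast
    then show ?thesis using combination_of_list[of hs H] by metis
  qed
  ultimately show ?thesis by blast
qed

lemma restricted_monomial_eq:
  assumes "\<And>i. ell i \<noteq> 0"
  shows "restricted_monomial ell e = Poly_Mapping.single (snd e) (section_monomial ell (full_exponent (fst e)))"
proof -
  let ?X = "\<lambda>i. Fract (ell i) 1"
  have nz: "?X i \<noteq> 0" for i using assms by simp
  have "(\<Prod>j\<in>UNIV. Fract (ell (Some j)) (ell None) powi (fst e $ j))
      = (\<Prod>j\<in>UNIV. ?X (Some j) powi (fst e $ j) * ?X None powi (- (fst e $ j)))"
    unfolding Fract_conv_divide[OF assms]
    by (intro prod.cong refl) (simp add: power_int_mult_distrib power_int_inverse power_int_minus del: mult_fract inverse_fract)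
  also have "\<dots> = (\<Prod>j\<in>UNIV. ?X (Some j) powi (fst e $ j)) * (\<Prod>j\<in>UNIV. ?X None powi (- (fst e $ j)))"
    by (rule prod.distrib)
  also have "(\<Prod>j\<in>I. ?X None powi k j) = ?X None powi (\<Sum>j\<in>I. k j)" for I and k :: "'a \<Rightarrow> int"
    by (induction I rule: infinite_finite_induct) (simp_all add: power_int_add[OF disjI1[OF nz]])
  finally show ?thesis
    unfolding restricted_monomial_def section_monomial_def prod_UNIV_option full_exponent_def
    by (simp add: sum_negf mult.commute)
qed

lemma restricted_monomial_add:
  assumes "\<And>i. ell i \<noteq> 0"
  shows "restricted_monomial ell (e + e') = restricted_monomial ell e * restricted_monomial ell e'"
proof -
  have "full_exponent (h + h') = (\<lambda>i. full_exponent h i + full_exponent h' i)" for h h' :: "int ^ 'a"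
    by (rule ext) (rule full_exponent_add)
  then show ?thesis
    unfolding restricted_monomial_eq[of ell, OF assms] mult_single
      section_monomial_add[of ell, OF assms, symmetric]
    by simp
qed

lemma restricted_monomial_0:
  assumes "\<And>i. ell i \<noteq> 0"
  shows "restricted_monomial ell (0 :: ('m::finite, 'v) exponent) = 1"
proof -
  have "full_exponent (0 :: int ^ 'm) = (\<lambda>i. 0)" by (rule ext) simp
  then show ?thesis by (simp add: restricted_monomial_eq[of ell, OF assms])
qed

section \<open>Maximal cones of the tropical linear space\<close>

lemma convex_cone_hull_image_subset:
  fixes f :: "'i \<Rightarrow> 'a::real_vector"
  assumes "finite K"
  shows "convex_cone hull (f ` K) \<subseteq> {\<Sum>i\<in>K. l i *\<^sub>R f i | l. \<forall>i\<in>K. 0 \<le> l i}" (is "_ \<subseteq> ?C")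
proof (rule hull_minimal)
  show "f ` K \<subseteq> ?C"
  proof safe
    fix i assume "i \<in> K"
    then show "\<exists>l. f i = (\<Sum>i\<in>K. l i *\<^sub>R f i) \<and> (\<forall>i\<in>K. 0 \<le> l i)"
      using assms by (intro exI[of _ "\<lambda>j. if j = i then 1 else 0"]) (simp add: if_distrib if_distribR sum.delta cong: if_cong)
  qed
  show "convex_cone ?C"
    unfolding convex_cone_iff
  proof (intro conjI ballI allI impI)
    show "0 \<in> ?C" by (rule CollectI, rule exI[of _ "\<lambda>_. 0"]) simp
    fix x assume "x \<in> ?C"
    then obtain l where l: "x = (\<Sum>i\<in>K. l i *\<^sub>R f i)" "\<forall>i\<in>K. 0 \<le> l i" by blast
    { fix y assume "y \<in> ?C"
      then obtain l' where l': "y = (\<Sum>i\<in>K. l' i *\<^sub>R f i)" "\<forall>i\<in>K. 0 \<le> l' i" by blast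
      show "x + y \<in> ?C"
        using l l' by (intro CollectI exI[of _ "\<lambda>i. l i + l' i"]) (simp add: scaleR_add_left sum.distrib) }
    fix r :: real assume "0 \<le> r"
    then show "r *\<^sub>R x \<in> ?C"
      using l by (intro CollectI exI[of _ "\<lambda>i. r * l i"]) (simp add: scaleR_sum_right)
  qed
qed

text \<open>
  A point of the relative interior stays in the cone when pushed a little away from the sum of
  all generators, which leaves a surplus in every coefficient.
\<close>
lemma rel_interior_cone_positive:
  fixes f :: "'i \<Rightarrow> 'a::euclidean_space"
  assumes "finite K" "w \<in> rel_interior (convex_cone hull (f ` K))"
  obtains l where "\<And>i. i \<in> K \<Longrightarrow> 0 < l i" "w = (\<Sum>i\<in>K. l i *\<^sub>R f i)"
proof -
  let ?C = "convex_cone hull (f ` K)"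
  have "(\<Sum>i\<in>J. f i) \<in> ?C" if "J \<subseteq> K" for J
    using that
  proof (induction J rule: infinite_finite_induct)
    case (insert i J)
    then have "f i \<in> ?C" "(\<Sum>i\<in>J. f i) \<in> ?C" by (auto intro: hull_inc)
    then show ?case using insert.hyps by (simp add: convex_cone_hull_add)
  qed (simp_all add: convex_cone_hull_contains_0)
  then have y: "(\<Sum>i\<in>K. f i) \<in> ?C" by blast
  obtain e where e: "e > 1" "(1 - e) *\<^sub>R (\<Sum>i\<in>K. f i) + e *\<^sub>R w \<in> ?C"
    using assms(2) y convex_rel_interior_iff[OF convex_convex_cone_hull convex_cone_hull_nonempty] by blast
  then obtain l where l: "(1 - e) *\<^sub>R (\<Sum>i\<in>K. f i) + e *\<^sub>R w = (\<Sum>i\<in>K. l i *\<^sub>R f i)" "\<forall>i\<in>K. 0 \<le> l i"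
    using convex_cone_hull_image_subset[OF assms(1), of f] by blast
  have "e *\<^sub>R w = (\<Sum>i\<in>K. (l i + (e - 1)) *\<^sub>R f i)"
    using l(1) by (simp add: algebra_simps sum.distrib scaleR_sum_right sum_subtractf)
  moreover have "w = (1 / e) *\<^sub>R (e *\<^sub>R w)" using e(1) by simp
  ultimately have "w = (1 / e) *\<^sub>R (\<Sum>i\<in>K. (l i + (e - 1)) *\<^sub>R f i)" by metis
  then have "w = (\<Sum>i\<in>K. ((l i + (e - 1)) / e) *\<^sub>R f i)" by (simp add: scaleR_sum_right)
  moreover have "0 < (l i + (e - 1)) / e" if "i \<in> K" for i using e(1) l(2) that by (intro divide_pos_pos add_nonneg_pos) auto
  ultimately show ?thesis by (intro that[of "\<lambda>i. (l i + (e - 1)) / e"])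
qed

text \<open>
  In homogeneous coordinates the point is its vector of coefficients, up to a common shift coming
  from the ray with index \<open>0\<close>.
\<close>
lemma min_indices_sum_rays:
  fixes K :: "'m::finite option set"
  assumes "K \<noteq> UNIV" "\<And>i. i \<in> K \<Longrightarrow> 0 < l i"
  shows "min_indices (\<Sum>i\<in>K. l i *\<^sub>R ray i) = - K"
proof -
  let ?w = "\<Sum>i\<in>K. l i *\<^sub>R ray i"
  define l' where "l' = (\<lambda>i. if i \<in> K then l i else 0)"
  have w: "?w = (\<Sum>i\<in>UNIV. l' i *\<^sub>R ray i)"
    by (rule sum.mono_neutral_cong_left) (auto simp: l'_def)
  have comp: "?w $ j = l' (Some j) - l' None" for j
    unfolding w sum_UNIV_option
    by (simp add: ray_def axis_def if_distrib cong: if_cong)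
  have hom: "hom_coord ?w i = l' i - l' None" for i
    by (cases i) (simp_all only: hom_coord_def option.case comp diff_self)
  have nonneg: "0 \<le> l' i" for i using assms(2) by (auto simp: l'_def less_imp_le)
  obtain i0 where i0: "i0 \<notin> K" using assms(1) by blast
  have "Min (range (hom_coord ?w)) = - l' None"
    by (rule Min_eqI) (use nonneg i0 in \<open>auto simp: hom l'_def intro!: image_eqI[of _ _ i0]\<close>)
  moreover have "l' i = 0 \<longleftrightarrow> i \<notin> K" for i using assms(2)[of i] by (auto simp: l'_def)
  ultimately show ?thesis by (auto simp: min_indices_def hom)
qed

section \<open>Injectivity of the weights\<close>

text \<open>
  A rational linear functional on the reals turns a real relation between rational rows into a
  rational one, and it can be chosen not to vanish on a given nonzero coefficient.
\<close>
lemma rational_independent_imp_real: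
  fixes A :: "nat \<Rightarrow> 'h \<Rightarrow> rat"
  assumes ind: "\<And>r :: nat \<Rightarrow> rat. (\<forall>h\<in>H. (\<Sum>k<d. r k * A k h) = 0) \<Longrightarrow> \<forall>k<d. r k = 0"
    and rel: "\<And>h. h \<in> H \<Longrightarrow> (\<Sum>k<d. r k * real_of_rat (A k h)) = 0"
  shows "\<forall>k<d. r k = 0"
proof (rule ccontr)
  assume "\<not> (\<forall>k<d. r k = 0)"
  then obtain k where k: "k < d" "r k \<noteq> 0" by blast
  interpret Q: vector_space_pair "\<lambda>(q::rat) (x::real). of_rat q * x" "\<lambda>(q::rat) (x::rat). q * x"
    by unfold_locales (simp_all add: of_rat_add of_rat_mult algebra_simps)
  have "Q.vs1.independent {r k}" using k(2) by (simp add: Q.vs1.independent_insert)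
  then obtain g where g: "Vector_Spaces.linear (\<lambda>(q::rat) (x::real). of_rat q * x) (\<lambda>(q::rat) (x::rat). q * x) g" "g (r k) = 1"
    using Q.linear_independent_extend[of "{r k}" "\<lambda>_. 1"] by auto
  interpret g: Vector_Spaces.linear "\<lambda>(q::rat) (x::real). of_rat q * x" "\<lambda>(q::rat) (x::rat). q * x" g
    by (rule g(1))
  have "(\<Sum>k<d. g (r k) * A k h) = 0" if "h \<in> H" for h
  proof -
    have "0 = g (\<Sum>k<d. of_rat (A k h) * r k)" using rel[OF that] g.zero by (simp add: mult.commute)
    also have "\<dots> = (\<Sum>k<d. A k h * g (r k))" by (simp only: g.sum g.scale)
    finally show ?thesis by (simp add: mult.commute)
  qed
  then have "g (r k) = 0" using ind[of "\<lambda>k. g (r k)"] k(1) by blast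
  then show False using g(2) by simp
qed

lemma lattice_basis:
  fixes N :: "'v::real_vector set"
  assumes "is_lattice N"
  obtains B where "finite B" "card B = dim N" "span B = (UNIV :: 'v set)"
proof -
  obtain B where B: "finite B" "independent B" "span B = UNIV"
    "N = {\<Sum>b\<in>B. of_int (k b) *\<^sub>R b | k :: 'v \<Rightarrow> int. True}"
    using assms unfolding is_lattice_def by blast
  have "B \<subseteq> N"
  proof
    fix b assume "b \<in> B"
    then have "b = (\<Sum>x\<in>B. of_int (if x = b then 1 else 0) *\<^sub>R x)"
      using B(1) by (simp add: if_distrib if_distribR sum.delta cong: if_cong)
    then show "b \<in> N" unfolding B(4) by (intro CollectI exI[of _ "\<lambda>x. if x = b then 1 else 0"]) simp
  qed
  then have "span N = UNIV" using span_mono[of B N] B(3) by auto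
  then have "dim N = card B" using dim_eq_card[OF _ B(2)] B(3) by simp
  then show ?thesis using that B by simp
qed

text \<open>
  The rows come from as many points as the space \<open>span \<tau> \<times> N\<^sub>\<real>\<close> has dimensions, and these
  points are linearly independent because the rows are; so an exponent that pairs to zero with
  all of them vanishes on the whole space.
\<close>
lemma weights_injective:
  fixes N :: "'v::real_vector set" and K :: "'m::finite option set"
    and z :: "nat \<Rightarrow> (real ^ 'm) \<times> 'v"
  assumes N: "is_lattice N" and H: "\<And>h. h \<in> H \<Longrightarrow> linear (snd h)"
    and K: "card K = c"
    and z: "\<And>k. k < c + dim N \<Longrightarrow> z k = (\<Sum>i\<in>K. l k i *\<^sub>R ray i, x k)"
    and A: "\<And>k h. k < c + dim N \<Longrightarrow> h \<in> H \<Longrightarrow> real_of_rat (A k h) = pairing h (z k)"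
    and ind: "\<And>r :: nat \<Rightarrow> rat. (\<forall>h\<in>H. (\<Sum>k<c + dim N. r k * A k h) = 0) \<Longrightarrow> \<forall>k<c + dim N. r k = 0"
    and e: "linear (snd e)" "linear (snd e')" "\<And>k. k < c + dim N \<Longrightarrow> pairing e (z k) = pairing e' (z k)"
  shows "snd e = snd e'" and "\<And>i. i \<in> K \<Longrightarrow> full_exponent (fst e) i = full_exponent (fst e') i"
proof -
  let ?d = "c + dim N"
  obtain B where B: "finite B" "card B = dim N" "span B = (UNIV :: 'v set)"
    using lattice_basis[OF N] .
  define T :: "((real ^ 'm) \<times> 'v) set" where "T = (\<lambda>i. (ray i, 0)) ` K \<union> Pair 0 ` B"
  have finT: "finite T" unfolding T_def using B(1) by simp
  have cardT: "card T \<le> ?d"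
  proof -
    have "card T \<le> card ((\<lambda>i. (ray i, 0 :: 'v)) ` K) + card (Pair (0 :: real ^ 'm) ` B)"
      unfolding T_def by (rule card_Un_le)
    also have "\<dots> \<le> card K + card B" using B(1) by (intro add_mono card_image_le) auto
    finally show ?thesis using K B(2) by simp
  qed
  have pair_B: "(0, y) \<in> span T" for y
  proof -
    have "y \<in> span B" using B(3) by simp
    then have "(0 :: real ^ 'm, y) \<in> Pair 0 ` span B" by simp
    also have "Pair (0 :: real ^ 'm) ` span B = span (Pair 0 ` B)"
      by (rule linear_span_image[symmetric]) (auto intro!: linearI)
    also have "\<dots> \<subseteq> span T" unfolding T_def by (rule span_mono) blast
    finally show ?thesis .
  qed
  have pair_K: "(ray i, 0) \<in> span T" if "i \<in> K" for i
    unfolding T_def using that by (intro span_base) auto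
  have zT: "z ` {..<?d} \<subseteq> span T"
  proof (rule image_subsetI)
    fix k assume "k \<in> {..<?d}"
    then have k: "k < ?d" by simp
    have "z k = (\<Sum>i\<in>K. l k i *\<^sub>R (ray i, 0)) + (0, x k)"
      unfolding z[OF k] by (simp add: sum_Pair_zero)
    then show "z k \<in> span T"
      using pair_K pair_B by (simp only:) (intro span_add span_sum span_scale, auto)
  qed
  have zero: "\<forall>k\<in>{..<?d}. r k = 0" if r: "(\<Sum>k<?d. r k *\<^sub>R z k) = 0" for r
  proof -
    have rel: "(\<Sum>k<?d. r k * real_of_rat (A k h)) = 0" if h: "h \<in> H" for h
    proof -
      have "(\<Sum>k<?d. r k * real_of_rat (A k h)) = pairing h (\<Sum>k<?d. r k *\<^sub>R z k)"
        unfolding linear_sum[OF linear_pairing[OF H[OF h]]]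
        by (intro sum.cong refl) (simp add: A[OF _ h] linear_cmul[OF linear_pairing[OF H[OF h]]])
      then show ?thesis using r linear_0[OF linear_pairing[OF H[OF h]]] by simp
    qed
    have "\<forall>k<?d. r k = 0"
      by (rule rational_independent_imp_real[where A = A and H = H]) (fact ind, fact rel)
    then show ?thesis by simp
  qed
  have "T \<subseteq> span (z ` {..<?d})"
    by (rule real_vector.span_subset_of_independent_family[OF _ zero finT zT]) (use cardT in auto)
  then have sub: "span T \<subseteq> span (z ` {..<?d})" using span_minimal subspace_span by blast
  have eq: "pairing e y = pairing e' y" if "y \<in> span T" for y
    by (rule linear_eq_on[OF linear_pairing[OF e(1)] linear_pairing[OF e(2)] subsetD[OF sub that]])
      (use e(3) in auto)
  show "snd e = snd e'" using eq[OF pair_B] by (simp add: pairing_def fun_eq_iff)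
  show "full_exponent (fst e) i = full_exponent (fst e') i" if "i \<in> K" for i
    using eq[OF pair_K[OF that]] linear_0[OF e(1)] linear_0[OF e(2)] by (simp add: pairing_ray)
qed

section \<open>The valuation\<close>

lemma list_le_componentwise:
  fixes xs ys :: "'a::linorder list"
  shows "list_all2 (\<le>) xs ys \<Longrightarrow> xs \<le> ys"
  by (induction rule: list_all2_induct) auto

lemma map_strict_mono_le_iff:
  fixes f :: "'a::linorder \<Rightarrow> 'b::linorder"
  assumes "strict_mono f"
  shows "map f xs \<le> map f ys \<longleftrightarrow> xs \<le> ys"
proof (induction xs arbitrary: ys)
  case (Cons x xs)
  then show ?case
    by (cases ys) (auto simp: strict_mono_less[OF assms] strict_mono_eq[OF assms])
qed simp

lemma strict_mono_real_of_rat: "strict_mono real_of_rat"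
  by (simp add: strict_mono_def of_rat_less)

text \<open>
  \<open>K\<close> indexes the rays of the maximal cone, and the \<open>k\<close>-th row of the matrix is given by the
  point with coordinates \<open>l k\<close> in the relative interior of that cone and \<open>x k\<close> in \<open>N\<^sub>\<real>\<close>.
\<close>
locale tropical_valuation = arrangement_chart c ell K j0
  for c and ell :: "'m::finite option \<Rightarrow> nat cpoly" and K j0 +
  fixes N \<sigma> :: "'v::real_vector set" and \<Delta> :: "'m option \<Rightarrow> 'v set"
    and H :: "('m, 'v) exponent set" and d :: nat
    and A :: "nat \<Rightarrow> ('m, 'v) exponent \<Rightarrow> rat"
    and l :: "nat \<Rightarrow> 'm option \<Rightarrow> real" and x :: "nat \<Rightarrow> 'v"
  assumes polyhedra: "sigma_polyhedron N \<sigma> (\<Delta> i)"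
    and basis: "hilbert_basis H (delta_dual_monoid N \<sigma> \<Delta>)"
    and rows: "k < d \<Longrightarrow> h \<in> H \<Longrightarrow> real_of_rat (A k h) = pairing h (\<Sum>i\<in>K. l k i *\<^sub>R ray i, x k)"
    and l_pos: "k < d \<Longrightarrow> i \<in> K \<Longrightarrow> 0 < l k i"
    and separating: "e \<in> delta_dual_monoid N \<sigma> \<Delta> \<Longrightarrow> e' \<in> delta_dual_monoid N \<sigma> \<Delta> \<Longrightarrow>
      (\<And>k. k < d \<Longrightarrow> pairing e (\<Sum>i\<in>K. l k i *\<^sub>R ray i, x k) = pairing e' (\<Sum>i\<in>K. l k i *\<^sub>R ray i, x k)) \<Longrightarrow>
      snd e = snd e' \<and> (\<forall>i\<in>K. full_exponent (fst e) i = full_exponent (fst e') i)"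
begin

abbreviation M where "M \<equiv> delta_dual_monoid N \<sigma> \<Delta>"

abbreviation (input) exponents_in :: "(('m, 'v) exponent \<Rightarrow>\<^sub>0 nat) set" where
  "exponents_in \<equiv> {a. Poly_Mapping.keys a \<subseteq> H}"

definition weights :: "('m, 'v) exponent \<Rightarrow> real list" where
  "weights e = map (\<lambda>k. pairing e (\<Sum>i\<in>K. l k i *\<^sub>R ray i, x k)) [0..<d]"

lemma M_combination: "M = combination ` exponents_in"
  using hilbert_basis_iff_combination[OF basis] by auto

lemma M_linear: "e \<in> M \<Longrightarrow> linear (snd e)"
  by (simp add: delta_dual_monoid_def dual_lattice_def)

lemma matrix_weight_combination:
  assumes "a \<in> exponents_in"
  shows "map real_of_rat (matrix_weight d A a) = weights (combination a)"
proof -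
  have "real_of_rat (\<Sum>h\<in>Poly_Mapping.keys a. A k h * of_nat (Poly_Mapping.lookup a h))
      = pairing (combination a) (\<Sum>i\<in>K. l k i *\<^sub>R ray i, x k)" if "k < d" for k
  proof -
    let ?z = "(\<Sum>i\<in>K. l k i *\<^sub>R ray i, x k)"
    have "pairing (combination a) ?z
        = (\<Sum>h\<in>Poly_Mapping.keys a. of_nat (Poly_Mapping.lookup a h) * pairing h ?z)"
      by (rule combination_additive) (simp_all add: pairing_0 pairing_add)
    also have "\<dots> = (\<Sum>h\<in>Poly_Mapping.keys a. real_of_rat (A k h * of_nat (Poly_Mapping.lookup a h)))"
      using assms by (intro sum.cong refl) (auto simp: of_rat_mult rows[OF that] subset_iff)
    finally show ?thesis by (simp add: of_rat_sum)
  qed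
  then show ?thesis by (simp add: matrix_weight_def weights_def)
qed

lemma matrix_weight_le_iff:
  assumes "a \<in> exponents_in" "b \<in> exponents_in"
  shows "matrix_weight d A a \<le> matrix_weight d A b \<longleftrightarrow> weights (combination a) \<le> weights (combination b)"
  unfolding matrix_weight_combination[OF assms(1), symmetric] matrix_weight_combination[OF assms(2), symmetric]
    map_strict_mono_le_iff[OF strict_mono_real_of_rat] ..

text \<open>
  All rows have positive coefficients, so a componentwise comparison of exponents holds in every
  row at once and in particular lexicographically.
\<close>
lemma weights_mono:
  assumes "e \<in> M" "e' \<in> M" "snd e = snd e'"
    and "\<And>i. i \<in> K \<Longrightarrow> full_exponent (fst e) i \<le> full_exponent (fst e') i"
  shows "weights e \<le> weights e'"
proof (rule list_le_componentwise)
  have "pairing e (\<Sum>i\<in>K. l k i *\<^sub>R ray i, x k) \<le> pairing e' (\<Sum>i\<in>K. l k i *\<^sub>R ray i, x k)" if "k < d" for k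
    unfolding pairing_sum_rays[OF M_linear[OF assms(1)]] pairing_sum_rays[OF M_linear[OF assms(2)]] assms(3)
    by (intro add_right_mono sum_mono mult_left_mono) (use assms(4) l_pos[OF that] in \<open>auto intro: less_imp_le\<close>)
  then show "list_all2 (\<le>) (weights e) (weights e')"
    by (simp add: weights_def list_all2_conv_all_nth)
qed

lemma weights_eq_iff:
  assumes "e \<in> M" "e' \<in> M"
  shows "weights e = weights e' \<longleftrightarrow>
    snd e = snd e' \<and> (\<forall>i\<in>K. full_exponent (fst e) i = full_exponent (fst e') i)"
proof
  assume eq: "weights e = weights e'"
  show "snd e = snd e' \<and> (\<forall>i\<in>K. full_exponent (fst e) i = full_exponent (fst e') i)"
  proof (rule separating[OF assms])
    fix k assume "k < d"
    then show "pairing e (\<Sum>i\<in>K. l k i *\<^sub>R ray i, x k) = pairing e' (\<Sum>i\<in>K. l k i *\<^sub>R ray i, x k)"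
      using arg_cong[OF eq, of "\<lambda>xs. xs ! k"] by (simp add: weights_def)
  qed
next
  assume "snd e = snd e' \<and> (\<forall>i\<in>K. full_exponent (fst e) i = full_exponent (fst e') i)"
  then show "weights e = weights e'"
    using weights_mono[OF assms] weights_mono[OF assms(2,1)] by (intro order.antisym) auto
qed

lemma is_ring_hom_ratfun_constants: "is_ring_hom (\<lambda>a. Poly_Mapping.single 0 (Fract (Const a) 1) :: 'v graded)"
  by (simp add: is_ring_hom_def mult_single Const_mult Const_add flip: single_add One_fract_def)

lemma presentation_single:
  "presentation ell (Poly_Mapping.single a t) = Poly_Mapping.single (snd (combination a))
     (Fract (Const t) 1 * section_monomial ell (full_exponent (fst (combination a))))"
  for a :: "('m, 'v) exponent \<Rightarrow>\<^sub>0 nat"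
proof -
  have "power_product (restricted_monomial ell) a = restricted_monomial ell (combination a)"
    by (rule combination_power_product[symmetric])
      (simp_all add: restricted_monomial_0[of ell, OF nonzero] restricted_monomial_add[of ell, OF nonzero])
  then show ?thesis
    unfolding presentation_def subst_single[OF is_ring_hom_ratfun_constants]
    by (simp add: restricted_monomial_eq[of ell, OF nonzero] mult_single)
qed

lemma presentation_sum: "presentation ell (\<Sum>i\<in>I. f i) = (\<Sum>i\<in>I. presentation ell (f i) :: 'v graded)"
  unfolding presentation_def by (rule subst_sum[OF is_ring_hom_ratfun_constants])

lemma lookup_presentation:
  "Poly_Mapping.lookup (presentation ell p) u = (\<Sum>a | a \<in> Poly_Mapping.keys p \<and> snd (combination a) = u.
     Fract (Const (Poly_Mapping.lookup p a)) 1 * section_monomial ell (full_exponent (fst (combination a))))"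
  for p :: "('m, 'v) exponent cpoly"
proof -
  have "presentation ell p
      = (\<Sum>a\<in>Poly_Mapping.keys p. presentation ell (Poly_Mapping.single a (Poly_Mapping.lookup p a)))"
    unfolding presentation_sum[symmetric] using poly_mapping_expand[of p] by simp
  then show ?thesis
    by (simp add: presentation_single lookup_sum lookup_single when_def sum.If_cases Int_def)
qed

lemma polys_in_H_keys: "p \<in> polys_in H \<Longrightarrow> a \<in> Poly_Mapping.keys p \<Longrightarrow> a \<in> exponents_in"
  by (simp add: polys_in_def)

lemma combination_in_M: "a \<in> exponents_in \<Longrightarrow> combination a \<in> M"
  using M_combination by blast

text \<open>
  In the degree of the lowest monomial of \<open>q\<close>, no other monomial of \<open>q\<close> has exponents below it
  along \<open>K\<close>.  Hence some monomial of \<open>p\<close> has, and its weight is at most the lowest weight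
  of \<open>q\<close>.
\<close>
lemma weight_valuation_le:
  assumes pq: "p \<in> polys_in H" "q \<in> polys_in H" "presentation ell p = presentation ell q"
    and b0: "b0 \<in> Poly_Mapping.keys q"
    and min: "\<And>b. b \<in> Poly_Mapping.keys q \<Longrightarrow> b \<noteq> b0 \<Longrightarrow> weights (combination b0) < weights (combination b)"
  shows "weight_valuation d A p \<le> matrix_weight d A b0"
proof -
  let ?u = "snd (combination b0)" and ?h = "\<lambda>a. full_exponent (fst (combination a))"
  let ?P = "{a. a \<in> Poly_Mapping.keys p \<and> snd (combination a) = ?u}"
  let ?Q = "{a. a \<in> Poly_Mapping.keys q \<and> snd (combination a) = ?u}"
  have M: "combination a \<in> M" if "a \<in> Poly_Mapping.keys p \<or> a \<in> Poly_Mapping.keys q" for a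
    using that polys_in_H_keys pq combination_in_M by blast
  have "\<exists>a\<in>?P. \<forall>i\<in>K. ?h a i \<le> ?h b0 i"
  proof (rule leading_exponent_bound[where p = "Poly_Mapping.lookup p" and q = "Poly_Mapping.lookup q"
        and k = ?h and Q = ?Q])
    show "(\<Sum>a\<in>?P. Fract (Const (Poly_Mapping.lookup p a)) 1 * section_monomial ell (?h a))
        = (\<Sum>a\<in>?Q. Fract (Const (Poly_Mapping.lookup q a)) 1 * section_monomial ell (?h a))"
      unfolding lookup_presentation[symmetric] pq(3) ..
    show "b0 \<in> ?Q" "Poly_Mapping.lookup q b0 \<noteq> 0" using b0 by (auto simp: in_keys_iff)
    fix b assume b: "b \<in> ?Q" "b \<noteq> b0"
    show "\<not> (\<forall>i\<in>K. ?h b i \<le> ?h b0 i)"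
    proof
      assume "\<forall>i\<in>K. ?h b i \<le> ?h b0 i"
      then have "weights (combination b) \<le> weights (combination b0)"
        using b b0 by (intro weights_mono M) auto
      then show False using min[of b] b by auto
    qed
  qed simp_all
  then obtain a where a: "a \<in> Poly_Mapping.keys p" "snd (combination a) = ?u" "\<forall>i\<in>K. ?h a i \<le> ?h b0 i" by blast
  have "weights (combination a) \<le> weights (combination b0)"
    using a b0 by (intro weights_mono M) auto
  then have "matrix_weight d A a \<le> matrix_weight d A b0"
    using matrix_weight_le_iff polys_in_H_keys pq(1,2) a(1) b0 by blast
  moreover have "weight_valuation d A p \<le> matrix_weight d A a"
    unfolding weight_valuation_def using a(1) by (intro Min_le) auto
  ultimately show ?thesis by (rule order.trans[rotated])
qed

lemma valuation_presentation:
  assumes q: "q \<in> polys_in H" and b0: "b0 \<in> Poly_Mapping.keys q"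
    and min: "\<And>b. b \<in> Poly_Mapping.keys q \<Longrightarrow> b \<noteq> b0 \<Longrightarrow> weights (combination b0) < weights (combination b)"
  shows "valuation d ell H A (presentation ell q) = matrix_weight d A b0"
  unfolding valuation_def
proof (rule Greatest_equality)
  have "matrix_weight d A b0 \<le> matrix_weight d A b" if "b \<in> Poly_Mapping.keys q" for b
    using min[OF that] matrix_weight_le_iff[of b0 b] polys_in_H_keys[OF q] b0 that by (cases "b = b0") auto
  then have "matrix_weight d A b0 = weight_valuation d A q"
    unfolding weight_valuation_def using b0 by (intro Min_eqI[symmetric]) auto
  then show "\<exists>p\<in>polys_in H. presentation ell p = presentation ell q \<and> matrix_weight d A b0 = weight_valuation d A p"
    using q by blast
  fix y assume "\<exists>p\<in>polys_in H. presentation ell p = presentation ell q \<and> y = weight_valuation d A p"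
  then show "y \<le> matrix_weight d A b0" using weight_valuation_le[OF _ q _ b0 min] by blast
qed

lemma valuation_monomial:
  assumes "a \<in> exponents_in"
  shows "restricted_monomial ell (combination a) \<in> divisor_ring N \<sigma> c ell \<Delta> - {0}"
    and "valuation d ell H A (restricted_monomial ell (combination a)) = matrix_weight d A a"
proof -
  let ?e = "combination a"
  have rm: "restricted_monomial ell ?e = presentation ell (Poly_Mapping.single a 1)"
    by (simp add: presentation_single restricted_monomial_eq[of ell, OF nonzero] flip: One_fract_def)
  have e: "snd ?e \<in> weight_monoid N \<sigma>"
    "\<And>i. - ereal (of_int (full_exponent (fst ?e) i)) \<le> floor_value (\<Delta> i) (snd ?e)"
    using combination_in_M[OF assms] mem_delta_dual_monoid_iff[of N \<sigma> \<Delta>, OF polyhedra] by blast+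
  have "section_monomial ell (full_exponent (fst ?e)) \<in> global_sections c ell (\<lambda>i. floor_value (\<Delta> i) (snd ?e))"
    by (rule section_monomial_in_global_sections[OF lin nonzero sum_full_exponent e(2)])
  then show "restricted_monomial ell ?e \<in> divisor_ring N \<sigma> c ell \<Delta> - {0}"
    using e(1) section_monomial_nonzero[of ell, OF nonzero]
    unfolding restricted_monomial_eq[of ell, OF nonzero] divisor_ring_def
    by (auto dest: arg_cong[of _ _ "\<lambda>F. Poly_Mapping.lookup F (snd ?e)"])
  show "valuation d ell H A (restricted_monomial ell ?e) = matrix_weight d A a"
    unfolding rm by (rule valuation_presentation) (use assms in \<open>auto simp: polys_in_def\<close>)
qed

text \<open>
  The expansion of the homogeneous components into monomial sections lifts to the polynomial
  ring, since every such monomial is a product of generators; different monomials have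
  different weights because they differ in degree or along \<open>K\<close>.
\<close>
lemma presentation_normal_form:
  assumes F: "F \<in> divisor_ring N \<sigma> c ell \<Delta>"
  obtains q where "q \<in> polys_in H" "presentation ell q = F"
    "inj_on (\<lambda>a. weights (combination a)) (Poly_Mapping.keys q)"
proof -
  let ?keys = "Poly_Mapping.keys F"
  define expands where "expands = (\<lambda>u X C.
    Poly_Mapping.lookup F u = (\<Sum>h\<in>X. Fract (Const (C h)) 1 * section_monomial ell h) \<and>
    (\<forall>h\<in>X. (\<Sum>i\<in>UNIV. h i) = 0 \<and> (\<forall>i. - ereal (of_int (h i)) \<le> floor_value (\<Delta> i) u)) \<and>
    (\<forall>h\<in>X. \<forall>h'\<in>X. (\<forall>i\<in>K. h i = h' i) \<longrightarrow> h = h'))"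
  have "\<exists>X C. expands u X C" if u: "u \<in> ?keys" for u
  proof -
    have sec: "Poly_Mapping.lookup F u \<in> global_sections c ell (\<lambda>i. floor_value (\<Delta> i) u)"
      using F u by (simp add: divisor_ring_def)
    have nz: "Poly_Mapping.lookup F u \<noteq> 0" using u by (simp add: in_keys_iff)
    obtain X C where "finite X" "Poly_Mapping.lookup F u = (\<Sum>h\<in>X. Fract (Const (C h)) 1 * section_monomial ell h)"
      "\<And>h. h \<in> X \<Longrightarrow> (\<Sum>i\<in>UNIV. h i) = 0"
      "\<And>h i. h \<in> X \<Longrightarrow> - ereal (of_int (h i)) \<le> floor_value (\<Delta> i) u"
      "\<And>h h'. h \<in> X \<Longrightarrow> h' \<in> X \<Longrightarrow> \<forall>i\<in>K. h i = h' i \<Longrightarrow> h = h'"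
      using global_section_expansion[OF sec nz floor_value_cases] by blast
    then have "expands u X C" unfolding expands_def by auto
    then show ?thesis by blast
  qed
  then obtain X C where "\<And>u. u \<in> ?keys \<Longrightarrow> expands u (X u) (C u)" by metis
  then have X: "\<And>u. u \<in> ?keys \<Longrightarrow> Poly_Mapping.lookup F u = (\<Sum>h\<in>X u. Fract (Const (C u h)) 1 * section_monomial ell h)"
    "\<And>u h. u \<in> ?keys \<Longrightarrow> h \<in> X u \<Longrightarrow> (\<Sum>i\<in>UNIV. h i) = 0"
    "\<And>u h i. u \<in> ?keys \<Longrightarrow> h \<in> X u \<Longrightarrow> - ereal (of_int (h i)) \<le> floor_value (\<Delta> i) u"
    "\<And>u h h'. u \<in> ?keys \<Longrightarrow> h \<in> X u \<Longrightarrow> h' \<in> X u \<Longrightarrow> \<forall>i\<in>K. h i = h' i \<Longrightarrow> h = h'"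
    unfolding expands_def by blast+
  have "\<exists>a. a \<in> exponents_in \<and> snd (combination a) = u \<and> full_exponent (fst (combination a)) = h"
    if uh: "u \<in> ?keys" "h \<in> X u" for u h
  proof -
    obtain k where k: "full_exponent k = h" using full_exponent_surj[OF X(2)[OF uh]] .
    have "u \<in> weight_monoid N \<sigma>" using F uh(1) by (simp add: divisor_ring_def)
    then have "(k, u) \<in> M"
      using X(3)[OF uh] k by (subst mem_delta_dual_monoid_iff[of N \<sigma> \<Delta>, OF polyhedra]) auto
    then obtain a where a: "(k, u) = combination a" "a \<in> exponents_in"
      unfolding M_combination by (rule imageE)
    then show ?thesis using k by (intro exI[of _ a]) (simp flip: a(1))
  qed
  then obtain a where a: "\<And>u h. u \<in> ?keys \<Longrightarrow> h \<in> X u \<Longrightarrow>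
      a u h \<in> exponents_in \<and> snd (combination (a u h)) = u \<and> full_exponent (fst (combination (a u h))) = h"
    by metis
  define q where "q = (\<Sum>u\<in>?keys. \<Sum>h\<in>X u. Poly_Mapping.single (a u h) (C u h))"
  have keys_q: "\<exists>u\<in>?keys. \<exists>h\<in>X u. b = a u h" if b: "b \<in> Poly_Mapping.keys q" for b
  proof (rule ccontr)
    assume "\<not> ?thesis"
    then have "Poly_Mapping.lookup q b = 0"
      unfolding q_def lookup_sum by (intro sum.neutral ballI) (auto simp: lookup_single when_def)
    then show False using b by (simp add: in_keys_iff)
  qed
  have "presentation ell q = (\<Sum>u\<in>?keys. Poly_Mapping.single u (Poly_Mapping.lookup F u))"
  proof -
    have single_sum: "(\<Sum>i\<in>I. Poly_Mapping.single u (f i)) = Poly_Mapping.single u (\<Sum>i\<in>I. f i)"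
      for I and u :: "'v \<Rightarrow> real" and f :: "('m option \<Rightarrow> int) \<Rightarrow> ratfun"
      by (induction I rule: infinite_finite_induct) (simp_all add: single_add)
    show ?thesis
      unfolding q_def presentation_sum presentation_single
    proof (rule sum.cong)
      fix u assume u: "u \<in> ?keys"
      have "(\<Sum>h\<in>X u. Poly_Mapping.single (snd (combination (a u h)))
          (Fract (Const (C u h)) 1 * section_monomial ell (full_exponent (fst (combination (a u h))))))
        = (\<Sum>h\<in>X u. Poly_Mapping.single u (Fract (Const (C u h)) 1 * section_monomial ell h))"
        by (rule sum.cong) (use a[OF u] in auto)
      then show "(\<Sum>h\<in>X u. Poly_Mapping.single (snd (combination (a u h)))
          (Fract (Const (C u h)) 1 * section_monomial ell (full_exponent (fst (combination (a u h))))))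
        = Poly_Mapping.single u (Poly_Mapping.lookup F u)"
        unfolding single_sum X(1)[OF u] .
    qed simp
  qed
  then have "presentation ell q = F" using poly_mapping_expand[of F] by simp
  moreover have "q \<in> polys_in H" unfolding polys_in_def using keys_q a by fastforce
  moreover have "inj_on (\<lambda>a. weights (combination a)) (Poly_Mapping.keys q)"
  proof (rule inj_onI)
    fix b b' assume b: "b \<in> Poly_Mapping.keys q" "b' \<in> Poly_Mapping.keys q"
      and eq: "weights (combination b) = weights (combination b')"
    obtain u h where uh: "u \<in> ?keys" "h \<in> X u" "b = a u h" using keys_q[OF b(1)] by blast
    obtain u' h' where uh': "u' \<in> ?keys" "h' \<in> X u'" "b' = a u' h'" using keys_q[OF b(2)] by blast
    have "snd (combination b) = snd (combination b') \<and>
        (\<forall>i\<in>K. full_exponent (fst (combination b)) i = full_exponent (fst (combination b')) i)"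
      using eq weights_eq_iff[of "combination b" "combination b'"] a[OF uh(1,2)] a[OF uh'(1,2)] uh(3) uh'(3)
        combination_in_M by blast
    then have "u = u'" "\<forall>i\<in>K. h i = h' i" using a[OF uh(1,2)] a[OF uh'(1,2)] uh(3) uh'(3) by auto
    then show "b = b'" using X(4)[OF uh(1,2), of h'] uh uh' by simp
  qed
  ultimately show ?thesis using that by blast
qed

text \<open>
  For a given ring element the lowest monomial of a preimage with pairwise different weights
  gives the value, and conversely a single monomial is its own lowest one.
\<close>
lemma valuation_image:
  "valuation d ell H A ` (divisor_ring N \<sigma> c ell \<Delta> - {0}) = matrix_weight d A ` exponents_in"
proof (intro equalityI image_subsetI)
  fix F assume F: "F \<in> divisor_ring N \<sigma> c ell \<Delta> - {0}"
  then obtain q where q: "q \<in> polys_in H" "presentation ell q = F"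
    "inj_on (\<lambda>a. weights (combination a)) (Poly_Mapping.keys q)"
    using presentation_normal_form by blast
  let ?W = "(\<lambda>a. weights (combination a)) ` Poly_Mapping.keys q"
  have "q \<noteq> 0" using F q(2) by (auto simp: presentation_def)
  then have "Min ?W \<in> ?W" by (intro Min_in) auto
  then obtain b0 where b0: "b0 \<in> Poly_Mapping.keys q" "weights (combination b0) = Min ?W" by auto
  have "weights (combination b0) < weights (combination b)" if "b \<in> Poly_Mapping.keys q" "b \<noteq> b0" for b
    using that b0 q(3) by (metis (no_types, lifting) Min_le finite_imageI finite_keys image_eqI inj_onD order_le_less)
  from valuation_presentation[OF q(1) b0(1) this]
  show "valuation d ell H A F \<in> matrix_weight d A ` exponents_in"
    using polys_in_H_keys[OF q(1) b0(1)] unfolding q(2) by blast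
next
  fix a assume "a \<in> exponents_in"
  then show "matrix_weight d A a \<in> valuation d ell H A ` (divisor_ring N \<sigma> c ell \<Delta> - {0})"
    using valuation_monomial[of a] by (metis image_eqI)
qed

section \<open>The value semigroup\<close>

lemma matrix_weight_add:
  assumes "a \<in> exponents_in" "b \<in> exponents_in"
  shows "map2 (+) (matrix_weight d A a) (matrix_weight d A b) = matrix_weight d A (a + b)"
proof -
  have ab: "a + b \<in> exponents_in" using assms keys_add[of a b] by blast
  have len: "length (matrix_weight d A a') = d" for a' by (simp add: matrix_weight_def)
  have nth: "real_of_rat (matrix_weight d A a' ! k) = pairing (combination a') (\<Sum>i\<in>K. l k i *\<^sub>R ray i, x k)"
    if "a' \<in> exponents_in" "k < d" for a' k
    using arg_cong[OF matrix_weight_combination[OF that(1)], of "\<lambda>xs. xs ! k"] that(2) len[of a']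
    by (simp add: weights_def)
  show ?thesis
  proof (rule nth_equalityI)
    fix k assume "k < length (map2 (+) (matrix_weight d A a) (matrix_weight d A b))"
    then have k: "k < d" by (simp add: len)
    have "real_of_rat (matrix_weight d A a ! k + matrix_weight d A b ! k) = real_of_rat (matrix_weight d A (a + b) ! k)"
      unfolding of_rat_add nth[OF assms(1) k] nth[OF assms(2) k] nth[OF ab k] combination_add pairing_add ..
    then show "map2 (+) (matrix_weight d A a) (matrix_weight d A b) ! k = matrix_weight d A (a + b) ! k"
      using k by (simp add: len)
  qed (simp add: len)
qed

definition project :: "(nat \<Rightarrow> 'm option) \<Rightarrow> ('m, 'v) exponent \<Rightarrow> (nat \<Rightarrow> int) \<times> ('v \<Rightarrow> real)" where
  "project idx e = (\<lambda>j. if j \<in> {1..c} then full_exponent (fst e) (idx j) else 0, snd e)"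

lemma project_add: "project idx (e + e') = project idx e + project idx e'"
  by (auto simp: project_def full_exponent_add)

lemma project_eq_iff:
  assumes "bij_betw idx {1..c} K" "e \<in> M" "e' \<in> M"
  shows "project idx e = project idx e' \<longleftrightarrow> weights e = weights e'"
proof -
  have "(\<forall>i\<in>K. P i) \<longleftrightarrow> (\<forall>j\<in>{1..c}. P (idx j))" for P
    using bij_betw_imp_surj_on[OF assms(1)] by blast
  then show ?thesis
    unfolding weights_eq_iff[OF assms(2,3)] by (auto simp: project_def fun_eq_iff)
qed

text \<open>
  Over \<open>(v,u)\<close> the exponents outside \<open>K\<close> are to be chosen with the lower bounds
  \<open>-\<lfloor>\<Delta>\<^sub>i(u)\<rfloor>\<close> and the sum \<open>- \<Sum> v\<^sub>j\<close>.  All of them can be put at their lower bound except one,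
  which takes up the rest.
\<close>
lemma project_image_M:
  assumes idx: "bij_betw idx {1..c} K" and w: "min_indices w = - K"
  shows "project idx ` M = carrier (S_w N \<sigma> c \<Delta> w idx)"
proof (intro equalityI subsetI)
  fix y assume "y \<in> project idx ` M"
  then obtain e where e: "e \<in> M" "y = project idx e" by blast
  let ?h = "full_exponent (fst e)" and ?u = "snd e"
  have u: "?u \<in> weight_monoid N \<sigma>" and le: "- ereal (of_int (?h i)) \<le> floor_value (\<Delta> i) ?u" for i
    using e(1) mem_delta_dual_monoid_iff[of N \<sigma> \<Delta>, OF polyhedra] by blast+
  have "(\<Sum>j=1..c. ?h (idx j)) = (\<Sum>i\<in>K. ?h i)" by (rule sum.reindex_bij_betw[OF idx])
  also have "\<dots> = (\<Sum>i\<in>-K. - ?h i)"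
    using sum_full_exponent[of "fst e"] sum.union_disjoint[of K "-K" ?h] by (simp add: sum_negf)
  finally have "ereal (of_int (\<Sum>j=1..c. ?h (idx j))) = (\<Sum>i\<in>-K. - ereal (of_int (?h i)))"
    by (simp flip: sum_ereal)
  also have "\<dots> \<le> (\<Sum>i\<in>-K. floor_value (\<Delta> i) ?u)" by (intro sum_mono le)
  finally have sum: "ereal (of_int (\<Sum>j=1..c. ?h (idx j))) \<le> (\<Sum>i\<in>-K. floor_value (\<Delta> i) ?u)" .
  have "- floor_value (\<Delta> i) ?u \<le> ereal (of_int (?h i))" for i
    using le[of i] ereal_uminus_le_reorder by blast
  then show "y \<in> carrier (S_w N \<sigma> c \<Delta> w idx)"
    using u sum unfolding e(2) project_def S_w_def w by simp
next
  fix y assume y: "y \<in> carrier (S_w N \<sigma> c \<Delta> w idx)"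
  obtain v u where vu: "y = (v, u)" by (cases y)
  have v0: "\<And>j. j \<notin> {1..c} \<Longrightarrow> v j = 0" and u: "u \<in> weight_monoid N \<sigma>"
    and sum: "ereal (of_int (\<Sum>j=1..c. v j)) \<le> (\<Sum>i\<in>-K. floor_value (\<Delta> i) u)"
    and ge: "\<And>j. j \<in> {1..c} \<Longrightarrow> - floor_value (\<Delta> (idx j)) u \<le> ereal (of_int (v j))"
    using y unfolding vu S_w_def w by auto
  let ?f = "\<lambda>i. floor_value (\<Delta> i) u"
  define fin where "fin = (\<lambda>i. if ?f i = \<infinity> then 0 else (SOME k. ?f i = ereal (of_int k)))"
  have fin: "?f i = ereal (of_int (fin i))" if "?f i \<noteq> \<infinity>" for i
    using floor_value_cases[of "\<Delta> i" u] that someI_ex[of "\<lambda>k. ?f i = ereal (of_int k)"] by (auto simp: fin_def)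
  \<comment> \<open>The index that takes up the rest has no lower bound if there is such an index.\<close>
  define i1 where "i1 = (if \<exists>i\<in>-K. ?f i = \<infinity> then SOME i. i \<in> -K \<and> ?f i = \<infinity> else j0)"
  have i1: "i1 \<notin> K" "?f i1 = \<infinity> \<or> (\<forall>i\<in>-K. ?f i \<noteq> \<infinity>)"
    using someI_ex[of "\<lambda>i. i \<in> -K \<and> ?f i = \<infinity>"] j0 by (auto simp: i1_def)
  define h where "h = (\<lambda>i. if i \<in> K then v (inv_into {1..c} idx i) else if i = i1
     then - (\<Sum>j=1..c. v j) + (\<Sum>i\<in>-K-{i1}. fin i) else - fin i)"
  have hK: "h (idx j) = v j" if "j \<in> {1..c}" for j
    using that idx inv_into_f_f[OF bij_betw_imp_inj_on[OF idx] that] bij_betwE[OF idx] by (simp add: h_def)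
  have "(\<Sum>i\<in>K. h i) = (\<Sum>j=1..c. v j)"
    unfolding sum.reindex_bij_betw[OF idx, symmetric] by (rule sum.cong[OF refl hK])
  moreover have "(\<Sum>i\<in>-K. h i) = h i1 + (\<Sum>i\<in>-K-{i1}. h i)"
    using i1(1) by (intro sum.remove) auto
  moreover have "(\<Sum>i\<in>-K-{i1}. h i) = (\<Sum>i\<in>-K-{i1}. - fin i)"
    by (rule sum.cong) (auto simp: h_def)
  moreover have "h i1 = - (\<Sum>j=1..c. v j) + (\<Sum>i\<in>-K-{i1}. fin i)" using i1(1) by (simp add: h_def)
  moreover have "(\<Sum>i\<in>UNIV. h i) = (\<Sum>i\<in>K. h i) + (\<Sum>i\<in>-K. h i)"
    by (subst sum.union_disjoint[symmetric]) auto
  ultimately have "(\<Sum>i\<in>UNIV. h i) = 0" by (simp add: sum_negf)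
  then obtain k where k: "full_exponent k = h" using full_exponent_surj by blast
  have le: "- ereal (of_int (h i)) \<le> ?f i" for i
  proof (cases "?f i = \<infinity>")
    case False
    consider "i \<in> K" | "i \<notin> K" "i \<noteq> i1" | "i = i1" by blast
    then show ?thesis
    proof cases
      case 1
      then obtain j where j: "j \<in> {1..c}" "i = idx j" using bij_betw_imp_surj_on[OF idx] by blast
      have "- ?f i \<le> ereal (of_int (h i))" using ge[OF j(1)] hK[OF j(1)] j(2) by simp
      then show ?thesis using ereal_uminus_le_reorder by blast
    next
      case 2
      then show ?thesis using fin[OF False] by (simp add: h_def)
    next
      case 3
      then have all: "?f i \<noteq> \<infinity>" if "i \<in> -K" for i using i1(2) False that by auto
      have "(\<Sum>i\<in>-K. ?f i) = (\<Sum>i\<in>-K. ereal (of_int (fin i)))"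
        by (intro sum.cong refl fin all)
      then have "ereal (of_int (\<Sum>j=1..c. v j)) \<le> (\<Sum>i\<in>-K. ereal (of_int (fin i)))"
        using sum by simp
      then have "(\<Sum>j=1..c. v j) \<le> (\<Sum>i\<in>-K. fin i)"
        by (simp flip: of_int_sum)
      also have "\<dots> = fin i1 + (\<Sum>i\<in>-K-{i1}. fin i)" using i1(1) by (intro sum.remove) auto
      finally have "- h i \<le> fin i" using 3 i1(1) by (simp add: h_def)
      then show ?thesis using fin[OF False] by (simp flip: of_int_minus)
    qed
  qed simp
  have "(k, u) \<in> M"
    using u le k by (subst mem_delta_dual_monoid_iff[of N \<sigma> \<Delta>, OF polyhedra]) simp
  moreover have "project idx (k, u) = y"
    unfolding vu project_def using k hK v0 by (auto simp: fun_eq_iff)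
  ultimately show "y \<in> project idx ` M" by blast
qed

text \<open>
  Monomials with equal weight have equal projection, so the projection is well defined on values;
  both the weight and the projection are additive, which makes it a homomorphism.
\<close>
lemma value_semigroup_iso:
  assumes idx: "bij_betw idx {1..c} K" and w: "min_indices w = - K"
  shows "value_semigroup d ell H A (divisor_ring N \<sigma> c ell \<Delta>) \<cong> S_w N \<sigma> c \<Delta> w idx"
proof -
  define f where "f = (\<lambda>y. project idx (combination (SOME a. a \<in> exponents_in \<and> matrix_weight d A a = y)))"
  have eq_iff: "project idx (combination a) = project idx (combination b) \<longleftrightarrow> matrix_weight d A a = matrix_weight d A b"
    if "a \<in> exponents_in" "b \<in> exponents_in" for a b
    unfolding project_eq_iff[OF idx combination_in_M[OF that(1)] combination_in_M[OF that(2)]]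
    using matrix_weight_le_iff[OF that] matrix_weight_le_iff[OF that(2,1)] by (metis order_antisym_conv order_refl)
  have f: "f (matrix_weight d A a) = project idx (combination a)" if a: "a \<in> exponents_in" for a
  proof -
    have "\<exists>b. b \<in> exponents_in \<and> matrix_weight d A b = matrix_weight d A a" using a by blast
    from someI_ex[OF this] show ?thesis unfolding f_def using eq_iff a by blast
  qed
  have car: "carrier (value_semigroup d ell H A (divisor_ring N \<sigma> c ell \<Delta>)) = matrix_weight d A ` exponents_in"
    by (simp add: value_semigroup_def valuation_image)
  have "f \<in> iso (value_semigroup d ell H A (divisor_ring N \<sigma> c ell \<Delta>)) (S_w N \<sigma> c \<Delta> w idx)"
  proof (rule isoI)
    have image: "f ` matrix_weight d A ` exponents_in = carrier (S_w N \<sigma> c \<Delta> w idx)"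
      using f unfolding project_image_M[OF idx w, symmetric] M_combination image_image by (auto intro!: image_cong)
    moreover have "inj_on f (matrix_weight d A ` exponents_in)"
      by (rule inj_onI) (use f eq_iff in force)
    ultimately show "bij_betw f (carrier (value_semigroup d ell H A (divisor_ring N \<sigma> c ell \<Delta>)))
        (carrier (S_w N \<sigma> c \<Delta> w idx))"
      unfolding car bij_betw_def by blast
    show "f \<in> hom (value_semigroup d ell H A (divisor_ring N \<sigma> c ell \<Delta>)) (S_w N \<sigma> c \<Delta> w idx)"
    proof (rule homI)
      fix y assume "y \<in> carrier (value_semigroup d ell H A (divisor_ring N \<sigma> c ell \<Delta>))"
      then show "f y \<in> carrier (S_w N \<sigma> c \<Delta> w idx)" using image unfolding car by blast
    next
      fix y y' assume "y \<in> carrier (value_semigroup d ell H A (divisor_ring N \<sigma> c ell \<Delta>))"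
        "y' \<in> carrier (value_semigroup d ell H A (divisor_ring N \<sigma> c ell \<Delta>))"
      then obtain a b where ab: "a \<in> exponents_in" "b \<in> exponents_in" "y = matrix_weight d A a" "y' = matrix_weight d A b"
        unfolding car by blast
      have "a + b \<in> exponents_in" using ab keys_add[of a b] by blast
      then have "f (map2 (+) y y') = f y + f y'"
        unfolding ab(3,4) matrix_weight_add[OF ab(1,2)] f[OF ab(1)] f[OF ab(2)]
        by (subst f) (simp_all only: combination_add project_add)
      then show "f (y \<otimes>\<^bsub>value_semigroup d ell H A (divisor_ring N \<sigma> c ell \<Delta>)\<^esub> y') = f y \<otimes>\<^bsub>S_w N \<sigma> c \<Delta> w idx\<^esub> f y'"
        by (simp add: value_semigroup_def S_w_def)
    qed
  qed
  then show ?thesis by (auto simp: is_iso_def)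
qed

end

theorem theorem5p2:
  fixes N \<sigma> :: "'v::real_vector set"
    and c :: nat
    and ell :: "'m::finite option \<Rightarrow> nat cpoly"
    and \<Delta> :: "'m option \<Rightarrow> 'v set"
    and \<tau> :: "(real ^ 'm) set"
    and w :: "real ^ 'm"
    and H :: "('m, 'v) exponent set"
    and A :: "nat \<Rightarrow> ('m, 'v) exponent \<Rightarrow> rat"
    and idx :: "nat \<Rightarrow> 'm option"
  assumes "is_lattice N"
    and "pointed_rational_cone N \<sigma>"
    and "\<And>i. linear_form c (ell i)"
    and "\<And>i. sigma_polyhedron N \<sigma> (\<Delta> i)"
    and "(\<Sum>i\<in>UNIV. \<Delta> i) \<subset> \<sigma>"
    and "full_rank c ell"
    and "general_linear_position c ell"
    and "trop_maximal_cone c ell \<tau>"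
    and "w \<in> rel_interior \<tau>"
    and "hilbert_basis H (delta_dual_monoid N \<sigma> \<Delta>)"
    and "valuation_matrix (c + dim N) H \<tau> A"
    and "bij_betw idx {1..c} (- min_indices w)"
  shows "value_semigroup (c + dim N) ell H A (divisor_ring N \<sigma> c ell \<Delta>) \<cong> S_w N \<sigma> c \<Delta> w idx"
proof -
  let ?d = "c + dim N"
  interpret general_arrangement c ell by unfold_locales (fact assms)+
  obtain K where K: "card K = c" "\<tau> = convex_cone hull (ray ` K)"
    using assms(8) unfolding trop_maximal_cone_def by blast
  have "K \<noteq> UNIV" using card_indices K(1) by auto
  then obtain j0 where j0: "j0 \<notin> K" by blast
  have pos: "\<exists>l. (\<forall>i\<in>K. 0 < l i) \<and> y = (\<Sum>i\<in>K. l i *\<^sub>R ray i)" if "y \<in> rel_interior \<tau>" for y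
    using rel_interior_cone_positive[of K y ray] that unfolding K(2) by (metis finite)
  have w: "min_indices w = - K" using pos[OF assms(9)] min_indices_sum_rays[OF \<open>K \<noteq> UNIV\<close>] by blast
  have "\<exists>l y. (\<forall>i\<in>K. 0 < l i) \<and> (\<forall>h\<in>H. real_of_rat (A k h) = pairing h (\<Sum>i\<in>K. l i *\<^sub>R ray i, y))"
    if k: "k < ?d" for k
  proof -
    obtain z where z: "z \<in> rel_interior \<tau> \<times> UNIV" "\<forall>h\<in>H. real_of_rat (A k h) = pairing h z"
      using assms(11) k unfolding valuation_matrix_def by blast
    obtain l where "\<forall>i\<in>K. 0 < l i" "fst z = (\<Sum>i\<in>K. l i *\<^sub>R ray i)" using pos[of "fst z"] z(1) by auto
    then show ?thesis using z(2) by (metis prod.collapse)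
  qed
  then obtain l x where lx: "\<And>k i. k < ?d \<Longrightarrow> i \<in> K \<Longrightarrow> 0 < l k i"
    "\<And>k h. k < ?d \<Longrightarrow> h \<in> H \<Longrightarrow> real_of_rat (A k h) = pairing h (\<Sum>i\<in>K. l k i *\<^sub>R ray i, x k)"
    by metis
  have ind: "\<forall>k<?d. r k = 0" if "\<forall>h\<in>H. (\<Sum>k<?d. r k * A k h) = 0" for r
    using assms(11) that unfolding valuation_matrix_def by blast
  have linear: "linear (snd e)" if "e \<in> delta_dual_monoid N \<sigma> \<Delta>" for e
    using that by (simp add: delta_dual_monoid_def dual_lattice_def)
  have H: "linear (snd h)" if "h \<in> H" for h
  proof (rule linear)
    have "sum_list [h] \<in> delta_dual_monoid N \<sigma> \<Delta>"
      using assms(10) that unfolding hilbert_basis_def by (metis (mono_tags, lifting) empty_set empty_subsetI insert_subset list.simps(15) mem_Collect_eq)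
    then show "h \<in> delta_dual_monoid N \<sigma> \<Delta>" by simp
  qed
  interpret tropical_valuation c ell K j0 N \<sigma> \<Delta> H ?d A l x
  proof unfold_locales
    fix e e' assume e: "e \<in> delta_dual_monoid N \<sigma> \<Delta>" "e' \<in> delta_dual_monoid N \<sigma> \<Delta>"
      "\<And>k. k < ?d \<Longrightarrow> pairing e (\<Sum>i\<in>K. l k i *\<^sub>R ray i, x k) = pairing e' (\<Sum>i\<in>K. l k i *\<^sub>R ray i, x k)"
    show "snd e = snd e' \<and> (\<forall>i\<in>K. full_exponent (fst e) i = full_exponent (fst e') i)"
      using weights_injective[where z = "\<lambda>k. (\<Sum>i\<in>K. l k i *\<^sub>R ray i, x k)" and l = l and x = x and A = A and H = H,
          OF assms(1) H K(1) refl lx(2) ind linear[OF e(1)] linear[OF e(2)] e(3)] by blast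
  qed (use K(1) j0 assms(4,10) lx in auto)
  show ?thesis using value_semigroup_iso assms(12) w by simp
qed

end
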